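(* Let $d\ge1$ and let $B$ be a two-parameter Brownian sheet in $\mathbf{R}^d$. Define $\mathcal{D}_d:=\{s\ge0:\ B(s,t_1)=B(s,t_2)\text{ for some }t_2>t_1>0\}$. Then for every non-random compact set $F\subset(0,\infty)$, \[ \mathrm{P}\{\mathcal{D}_d\cap F\neq\varnothing\}>0\iff \mathrm{Cap}_{(d-4)/2}(F)>0 . \]
   Context: A two-parameter Brownian sheet in $\mathbf{R}^d$ is a continuous centered Gaussian process $\{B(s,t)\}_{s,t\ge0}$ with values in $\mathbf{R}^d$ and $\mathrm{Cov}(B_i(s,t),B_j(u,v))=\min(s,u)\min(t,v)\delta_{i,j}$. Riesz capacity: for $\beta\in\mathbf{R}$ and $x\neq 0$ let $U_\beta(x)=1$ if $\beta<0$, $U_\beta(x)=\log_+(1/|x|)$ if $\beta=0$, $U_\beta(x)=|x|^{-\beta}$ if $\beta>0$, extended continuously to $x=0$ as a $[0,\infty]$-valued function. For a probability measure $\mu$, $I_\beta(\mu)=\iint U_\beta(x-y)\,\mu(dx)\mu(dy)$, and $\mathrm{Cap}_\beta(F)=[\inf_{\mu\in\mathcal{P}(F)}I_\beta(\mu)]^{-1}$, where $\mathcal{P}(F)$ is the set of Borel probability measures on $F$, $\inf\varnothing=\infty$, $1/\infty=0$. *)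

theory Defs
  imports "HOL-Probability.Probability"
begin

text \<open>Riesz kernel on the real line (the sets F considered are subsets of (0,\<infinity>)),
  with values in [0,\<infinity>], extended continuously to 0.\<close>
definition riesz_kernel :: "real \<Rightarrow> real \<Rightarrow> ennreal" where
  "riesz_kernel \<beta> x =
     (if \<beta> < 0 then 1
      else if x = 0 then \<top>
      else if \<beta> = 0 then ennreal (max 0 (ln (1 / \<bar>x\<bar>)))
      else ennreal (\<bar>x\<bar> powr (- \<beta>)))"

definition riesz_energy :: "real \<Rightarrow> real measure \<Rightarrow> ennreal" where
  "riesz_energy \<beta> \<mu> = (\<integral>\<^sup>+ x. (\<integral>\<^sup>+ y. riesz_kernel \<beta> (x - y) \<partial>\<mu>) \<partial>\<mu>)"

definition prob_measures_on :: "real set \<Rightarrow> real measure set" where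
  "prob_measures_on F =
     {\<mu>. sets \<mu> = sets borel \<and> prob_space \<mu> \<and> emeasure \<mu> F = 1}"

definition riesz_cap :: "real \<Rightarrow> real set \<Rightarrow> ennreal" where
  "riesz_cap \<beta> F = inverse (INF \<mu> \<in> prob_measures_on F. riesz_energy \<beta> \<mu>)"

definition centered_gaussian_rv :: "'a measure \<Rightarrow> ('a \<Rightarrow> real) \<Rightarrow> real \<Rightarrow> bool" where
  "centered_gaussian_rv M X v =
     (if v = 0 then (AE \<omega> in M. X \<omega> = 0)
      else distributed M lborel X (normal_density 0 (sqrt v)))"

text \<open>Two-parameter Brownian sheet in R^d (d = CARD('d)): continuous, centered Gaussian,
  with Cov(B_i(s,t),B_j(u,v)) = min s u * min t v * delta_ij.  Gaussianity with the given
  covariance is expressed by requiring every finite linear combination of coordinates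
  to be centered normal with the corresponding variance.\<close>
definition brownian_sheet ::
    "'a measure \<Rightarrow> (real \<times> real \<Rightarrow> 'a \<Rightarrow> real ^ 'd) \<Rightarrow> bool" where
  "brownian_sheet M B \<longleftrightarrow>
     prob_space M \<and>
     (\<forall>s t. 0 \<le> s \<longrightarrow> 0 \<le> t \<longrightarrow> B (s, t) \<in> borel_measurable M) \<and>
     (\<forall>\<omega> \<in> space M. continuous_on ({0..} \<times> {0..}) (\<lambda>p. B p \<omega>)) \<and>
     (\<forall>xs :: (real \<times> real \<times> 'd \<times> real) list.
        (\<forall>(s, t, i, c) \<in> set xs. 0 \<le> s \<and> 0 \<le> t) \<longrightarrow>
        centered_gaussian_rv M
          (\<lambda>\<omega>. \<Sum>(s, t, i, c) \<leftarrow> xs. c * (B (s, t) \<omega> $ i))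
          (\<Sum>(s, t, i, c) \<leftarrow> xs. \<Sum>(u, v, j, e) \<leftarrow> xs.
              c * e * (min s u * min t v * (if i = j then 1 else 0))))"

definition double_times :: "(real \<times> real \<Rightarrow> 'a \<Rightarrow> real ^ 'd) \<Rightarrow> 'a \<Rightarrow> real set" where
  "double_times B \<omega> =
     {s. 0 \<le> s \<and> (\<exists>t1 t2. 0 < t1 \<and> t1 < t2 \<and> B (s, t1) \<omega> = B (s, t2) \<omega>)}"

end

theory Submission
  imports Defs
begin

text \<open>
  Fix \<open>b < c\<close> and look at \<open>t1\<close> slightly below \<open>b\<close> and \<open>t2\<close> slightly above \<open>c\<close>. The increment
  \<open>B(s,t2) - B(s,t1)\<close> is the white noise of the rectangle \<open>[0,s] \<times> [t1,t2]\<close>, which increases with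
  each of the three parameters \<open>s\<close>, \<open>b - t1\<close> and \<open>t2 - c\<close>. Two such increments at parameter
  distance \<open>r\<close> are both of size \<open>\<epsilon>\<close> with probability of order \<open>\<epsilon>^2d (r + \<epsilon>^2)^(-d/2)\<close>; integrating
  this over the two \<open>t\<close>-parameters leaves the Riesz kernel of order \<open>(d - 4)/2\<close> in \<open>s\<close>. Hence the
  occupation measure of a small ball, weighted by a measure of finite energy on \<open>F\<close>, has bounded second
  moment, and Cauchy-Schwarz gives a hit with probability bounded below.

  Conversely, let \<open>\<mu>\<close> be the law of the \<open>s\<close>-coordinate of a selected hitting time. Given the past of that
  time (the noise of its rectangle), the expected occupation of its future is at least the one-sided
  potential of \<open>\<mu>\<close>, so Cairoli's maximal inequality, used in the dual form
  \<open>\<parallel>\<Sum>\<^sub>t E[g\<^sub>t | F\<^sub>t]\<parallel> \<le> 8 \<parallel>\<Sum>\<^sub>t g\<^sub>t\<parallel>\<close> in L2, bounds the energy of \<open>\<mu>\<close> by a constant divided by the hitting probability.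
  On finite grids conditioning is resampling of independent Gaussian cells, and the measures obtained
  there have a weak limit of finite energy.
\<close>

subsection \<open>Independence and characteristic functions\<close>

lemma borel_measurable_cis[measurable]: "cis \<in> borel_measurable borel"
  by (intro borel_measurable_continuous_onI continuous_intros)

context prob_space
begin

lemma integrable_cis:
  fixes f :: "'a \<Rightarrow> real"
  assumes "f \<in> borel_measurable M"
  shows "integrable M (\<lambda>\<omega>. cis (f \<omega>))"
  using assms by (intro integrable_const_bound[where B=1]) auto

lemma distr_density_eq_of_cis:
  fixes X u :: "'a \<Rightarrow> real"
  assumes X[measurable]: "X \<in> borel_measurable M"
    and u: "integrable M u" "\<And>\<omega>. 0 \<le> u \<omega>" "expectation u = 1"
    and cis: "\<And>t. (\<integral>\<omega>. u \<omega> *\<^sub>R cis (t * X \<omega>) \<partial>M) = (\<integral>\<omega>. cis (t * X \<omega>) \<partial>M)"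
  shows "distr (density M (\<lambda>\<omega>. ennreal (u \<omega>))) borel X = distr M borel X"
proof -
  have [measurable]: "u \<in> borel_measurable M" using u(1) by simp
  define Q where "Q = density M (\<lambda>\<omega>. ennreal (u \<omega>))"
  have "emeasure Q (space Q) = (\<integral>\<^sup>+\<omega>. ennreal (u \<omega>) \<partial>M)"
    unfolding Q_def by (simp add: emeasure_density cong: nn_integral_cong)
  also have "\<dots> = 1"
    using u by (subst nn_integral_eq_integral) auto
  finally interpret Q: prob_space Q by (rule prob_spaceI)
  have [measurable]: "X \<in> borel_measurable Q" unfolding Q_def by simp
  have "distr Q borel X = distr M borel X"
  proof (rule Levy_uniqueness)
    show "char (distr Q borel X) = char (distr M borel X)"
    proof
      fix t
      have "char (distr Q borel X) t = (\<integral>\<omega>. u \<omega> *\<^sub>R cis (t * X \<omega>) \<partial>M)"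
        unfolding char_def Q_def cis_conv_exp[symmetric] using u(2)
        by (subst integral_distr, simp, simp, subst integral_density) auto
      also have "\<dots> = char (distr M borel X) t"
        unfolding cis char_def cis_conv_exp[symmetric] by (subst integral_distr) auto
      finally show "char (distr Q borel X) t = char (distr M borel X) t" .
    qed
  qed simp_all
  then show ?thesis by (simp only: Q_def)
qed

lemma expectation_mult_indicator_of_cis_nonneg:
  fixes X u :: "'a \<Rightarrow> real"
  assumes X[measurable]: "X \<in> borel_measurable M"
    and u: "integrable M u" "\<And>\<omega>. 0 \<le> u \<omega>"
    and cis: "\<And>t. (\<integral>\<omega>. u \<omega> *\<^sub>R cis (t * X \<omega>) \<partial>M) = expectation u *\<^sub>R (\<integral>\<omega>. cis (t * X \<omega>) \<partial>M)"
    and A[measurable]: "A \<in> sets borel"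
  shows "expectation (\<lambda>\<omega>. u \<omega> * indicator A (X \<omega>)) = expectation u * prob (X -` A \<inter> space M)"
proof (cases "expectation u = 0")
  case True
  then have "AE \<omega> in M. u \<omega> = 0"
    using integral_nonneg_eq_0_iff_AE[OF u(1)] u(2) by simp
  then have "AE \<omega> in M. u \<omega> * indicator A (X \<omega>) = 0"
    by eventually_elim simp
  then have "expectation (\<lambda>\<omega>. u \<omega> * indicator A (X \<omega>)) = 0"
    by (rule integral_eq_zero_AE)
  then show ?thesis using True by simp
next
  case False
  define m where "m = expectation u"
  have m: "0 < m"
    using False u by (simp add: m_def less_le)
  have [measurable]: "u \<in> borel_measurable M" using u(1) by simp
  have "(\<integral>\<omega>. (u \<omega> / m) *\<^sub>R cis (t * X \<omega>) \<partial>M) = (\<integral>\<omega>. cis (t * X \<omega>) \<partial>M)" for t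
  proof -
    have "(\<integral>\<omega>. (u \<omega> / m) *\<^sub>R cis (t * X \<omega>) \<partial>M) = (1 / m) *\<^sub>R (\<integral>\<omega>. u \<omega> *\<^sub>R cis (t * X \<omega>) \<partial>M)"
      by (subst integral_scaleR_right[symmetric]) simp
    then show ?thesis using m by (simp add: cis m_def[symmetric])
  qed
  moreover have "expectation (\<lambda>\<omega>. u \<omega> / m) = 1"
    using m by (simp add: m_def[symmetric])
  ultimately have "distr (density M (\<lambda>\<omega>. ennreal (u \<omega> / m))) borel X = distr M borel X"
    using u m by (intro distr_density_eq_of_cis) auto
  then have "prob (X -` A \<inter> space M) = measure (density M (\<lambda>\<omega>. ennreal (u \<omega> / m))) (X -` A \<inter> space M)"
    using measure_distr[of X M borel A] measure_distr[of X "density M (\<lambda>\<omega>. ennreal (u \<omega> / m))" borel A] by simp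
  also have "\<dots> = (\<integral>\<omega>. indicator (X -` A \<inter> space M) \<omega> \<partial>density M (\<lambda>\<omega>. ennreal (u \<omega> / m)))"
    by simp
  also have "\<dots> = (\<integral>\<omega>. (u \<omega> / m) *\<^sub>R indicator (X -` A \<inter> space M) \<omega> \<partial>M)"
    using u(2) m by (intro integral_density) auto
  also have "\<dots> = (\<integral>\<omega>. (1 / m) * (u \<omega> * indicator A (X \<omega>)) \<partial>M)"
    by (intro Bochner_Integration.integral_cong) (auto simp: indicator_def)
  also have "\<dots> = (1 / m) * expectation (\<lambda>\<omega>. u \<omega> * indicator A (X \<omega>))"
    by (rule integral_mult_right_zero)
  finally show ?thesis using m by (simp add: m_def)
qed

lemma expectation_mult_indicator_of_cis_real:
  fixes X w :: "'a \<Rightarrow> real"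
  assumes X[measurable]: "X \<in> borel_measurable M"
    and w[measurable]: "w \<in> borel_measurable M" and bounded: "\<And>\<omega>. \<bar>w \<omega>\<bar> \<le> c"
    and cis: "\<And>t. (\<integral>\<omega>. w \<omega> *\<^sub>R cis (t * X \<omega>) \<partial>M) = expectation w *\<^sub>R (\<integral>\<omega>. cis (t * X \<omega>) \<partial>M)"
    and A[measurable]: "A \<in> sets borel"
  shows "expectation (\<lambda>\<omega>. w \<omega> * indicator A (X \<omega>)) = expectation w * prob (X -` A \<inter> space M)"
proof -
  have w_int[simp]: "integrable M w"
    using bounded by (intro integrable_const_bound[where B=c]) auto
  have ind_int[simp]: "integrable M (\<lambda>\<omega>. indicator A (X \<omega>) :: real)"
    by (intro integrable_const_bound[where B=1]) (auto simp: indicator_def)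
  have ind_w_int[simp]: "integrable M (\<lambda>\<omega>. w \<omega> * indicator A (X \<omega>))"
    using order_trans[OF abs_ge_zero bounded] bounded
    by (intro integrable_const_bound[where B=c]) (auto simp: indicator_def)
  have w_cis_int: "integrable M (\<lambda>\<omega>. w \<omega> *\<^sub>R cis (t * X \<omega>))" for t
    using bounded by (intro integrable_const_bound[where B=c]) auto
  have shift: "expectation (\<lambda>\<omega>. c + w \<omega>) = c + expectation w"
    by (simp add: prob_space)
  have "expectation (\<lambda>\<omega>. (c + w \<omega>) * indicator A (X \<omega>)) = expectation (\<lambda>\<omega>. c + w \<omega>) * prob (X -` A \<inter> space M)"
  proof (rule expectation_mult_indicator_of_cis_nonneg[OF X _ _ _ A])
    show "0 \<le> c + w \<omega>" for \<omega> using bounded[of \<omega>] by linarith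
    show "(\<integral>\<omega>. (c + w \<omega>) *\<^sub>R cis (t * X \<omega>) \<partial>M) = expectation (\<lambda>\<omega>. c + w \<omega>) *\<^sub>R (\<integral>\<omega>. cis (t * X \<omega>) \<partial>M)" for t
      unfolding shift scaleR_left_distrib cis[symmetric]
      by (simp add: w_cis_int integrable_cis Bochner_Integration.integral_add)
  qed simp
  moreover have "expectation (\<lambda>\<omega>. indicator A (X \<omega>)) = prob (X -` A \<inter> space M)"
    by (subst Bochner_Integration.integral_cong[OF refl, of M _ "indicator (X -` A \<inter> space M)"]) (auto simp: indicator_def)
  ultimately show ?thesis
    unfolding shift by (simp add: distrib_right)
qed

text \<open>The hypothesis passes to the complex conjugate of the weight, hence to its real and imaginary parts.\<close>

lemma expectation_mult_indicator_of_cis: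
  fixes X :: "'a \<Rightarrow> real" and W :: "'a \<Rightarrow> complex"
  assumes X[measurable]: "X \<in> borel_measurable M"
    and W[measurable]: "W \<in> borel_measurable M" and bounded: "\<And>\<omega>. norm (W \<omega>) \<le> c"
    and cis: "\<And>t. (\<integral>\<omega>. W \<omega> * cis (t * X \<omega>) \<partial>M) = (\<integral>\<omega>. W \<omega> \<partial>M) * (\<integral>\<omega>. cis (t * X \<omega>) \<partial>M)"
    and A[measurable]: "A \<in> sets borel"
  shows "(\<integral>\<omega>. indicator A (X \<omega>) *\<^sub>R W \<omega> \<partial>M) = prob (X -` A \<inter> space M) *\<^sub>R (\<integral>\<omega>. W \<omega> \<partial>M)"
proof -
  have W_int[simp]: "integrable M W"
    using bounded by (intro integrable_const_bound[where B=c]) auto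
  have W_cis_int[simp]: "integrable M (\<lambda>\<omega>. W \<omega> * cis (t * X \<omega>))" for t
    using bounded by (intro integrable_const_bound[where B=c]) (simp_all add: norm_mult)
  have cnj_W_cis_int[simp]: "integrable M (\<lambda>\<omega>. cnj (W \<omega>) * cis (t * X \<omega>))" for t
    using integrable_cnj[OF W_cis_int[of "- t"]] by (simp add: cis_cnj)
  have ind_W_int: "integrable M (\<lambda>\<omega>. indicator A (X \<omega>) *\<^sub>R W \<omega>)"
    using order_trans[OF norm_ge_zero bounded] bounded
    by (intro integrable_const_bound[where B=c]) (auto simp: indicator_def)
  have cnj_cis: "(\<integral>\<omega>. cnj (W \<omega>) * cis (t * X \<omega>) \<partial>M) = cnj (\<integral>\<omega>. W \<omega> \<partial>M) * (\<integral>\<omega>. cis (t * X \<omega>) \<partial>M)" for t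
    using arg_cong[OF cis[of "- t"], of cnj]
    by (simp only: complex_cnj_mult Bochner_Integration.integral_cnj[symmetric] cis_cnj mult_minus_left minus_minus)
  have Re_scaleR: "Re z *\<^sub>R y = (1 / 2) * (z * y) + (1 / 2) * (cnj z * y)"
    and Im_scaleR: "Im z *\<^sub>R y = (- \<i> / 2) * (z * y) + (\<i> / 2) * (cnj z * y)" for z y :: complex
    by (simp_all add: complex_eq_iff field_simps)
  have "(\<integral>\<omega>. Re (W \<omega>) *\<^sub>R cis (t * X \<omega>) \<partial>M) = expectation (\<lambda>\<omega>. Re (W \<omega>)) *\<^sub>R (\<integral>\<omega>. cis (t * X \<omega>) \<partial>M)" for t
    unfolding integral_Re[OF W_int] Re_scaleR by (simp add: cis cnj_cis)
  moreover have "(\<integral>\<omega>. Im (W \<omega>) *\<^sub>R cis (t * X \<omega>) \<partial>M) = expectation (\<lambda>\<omega>. Im (W \<omega>)) *\<^sub>R (\<integral>\<omega>. cis (t * X \<omega>) \<partial>M)" for t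
    unfolding integral_Im[OF W_int] Im_scaleR by (simp add: cis cnj_cis)
  moreover have "\<bar>Re (W \<omega>)\<bar> \<le> c" "\<bar>Im (W \<omega>)\<bar> \<le> c" for \<omega>
    using bounded[of \<omega>] abs_Re_le_cmod[of "W \<omega>"] abs_Im_le_cmod[of "W \<omega>"] by linarith+
  ultimately have "expectation (\<lambda>\<omega>. Re (W \<omega>) * indicator A (X \<omega>)) = expectation (\<lambda>\<omega>. Re (W \<omega>)) * prob (X -` A \<inter> space M)"
      and "expectation (\<lambda>\<omega>. Im (W \<omega>) * indicator A (X \<omega>)) = expectation (\<lambda>\<omega>. Im (W \<omega>)) * prob (X -` A \<inter> space M)"
    by (intro expectation_mult_indicator_of_cis_real[where c=c]; simp)+
  then show ?thesis
    using integral_Re[OF ind_W_int] integral_Im[OF ind_W_int] by (simp add: complex_eq_iff mult.commute)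
qed

lemma expectation_prod_indicator_cis:
  fixes X :: "'i \<Rightarrow> 'a \<Rightarrow> real"
  assumes I: "finite I" and X[measurable]: "\<And>i. i \<in> I \<Longrightarrow> X i \<in> borel_measurable M"
    and cis: "\<And>\<theta>. (\<integral>\<omega>. cis (\<Sum>i\<in>I. \<theta> i * X i \<omega>) \<partial>M) = (\<Prod>i\<in>I. \<integral>\<omega>. cis (\<theta> i * X i \<omega>) \<partial>M)"
    and A[measurable]: "\<And>i. i \<in> I \<Longrightarrow> A i \<in> sets borel" and J: "J \<subseteq> I"
  shows "(\<integral>\<omega>. (\<Prod>j\<in>J. indicator (A j) (X j \<omega>)) *\<^sub>R cis (\<Sum>i\<in>I - J. \<theta> i * X i \<omega>) \<partial>M)
    = (\<Prod>j\<in>J. prob (X j -` A j \<inter> space M)) *\<^sub>R (\<Prod>i\<in>I - J. \<integral>\<omega>. cis (\<theta> i * X i \<omega>) \<partial>M)"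
  using finite_subset[OF J I] J
proof (induction J arbitrary: \<theta> rule: finite_subset_induct')
  case empty
  then show ?case by (simp add: cis)
next
  case (insert j J)
  have X_meas[measurable]: "X j \<in> borel_measurable M" and A_meas: "A j \<in> sets borel"
    using X A insert.hyps by auto
  have rest: "I - J = insert j (I - insert j J)" "j \<notin> I - insert j J" "finite (I - insert j J)"
    using insert.hyps I by auto
  define W where "W \<omega> = (\<Prod>j\<in>J. indicator (A j) (X j \<omega>)) *\<^sub>R cis (\<Sum>i\<in>I - insert j J. \<theta> i * X i \<omega>)" for \<omega>
  have W: "W \<in> borel_measurable M"
    unfolding W_def using insert.hyps by (intro borel_measurable_scaleR borel_measurable_prod) auto
  have W_le: "norm (W \<omega>) \<le> 1" for \<omega>
    by (auto simp: W_def abs_prod indicator_def intro!: prod_le_1)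
  have W_cis: "(\<integral>\<omega>. W \<omega> * cis (t * X j \<omega>) \<partial>M) = (\<Prod>j\<in>J. prob (X j -` A j \<inter> space M)) *\<^sub>R
    ((\<integral>\<omega>. cis (t * X j \<omega>) \<partial>M) * (\<Prod>i\<in>I - insert j J. \<integral>\<omega>. cis (\<theta> i * X i \<omega>) \<partial>M))" for t
  proof -
    have "(\<Sum>i\<in>I - insert j J. (\<theta>(j := t)) i * X i \<omega>) = (\<Sum>i\<in>I - insert j J. \<theta> i * X i \<omega>)"
        "(\<Prod>i\<in>I - insert j J. \<integral>\<omega>. cis ((\<theta>(j := t)) i * X i \<omega>) \<partial>M)
          = (\<Prod>i\<in>I - insert j J. \<integral>\<omega>. cis (\<theta> i * X i \<omega>) \<partial>M)" for \<omega>
      by (auto intro!: sum.cong prod.cong)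
    then show ?thesis
      using insert.IH[of "\<theta>(j := t)"] unfolding rest(1) sum.insert[OF rest(3,2)] prod.insert[OF rest(3,2)]
      by (simp add: W_def cis_mult add.commute del: fun_upd_apply) simp
  qed
  have W_expectation: "(\<integral>\<omega>. W \<omega> \<partial>M) = (\<Prod>j\<in>J. prob (X j -` A j \<inter> space M)) *\<^sub>R
    (\<Prod>i\<in>I - insert j J. \<integral>\<omega>. cis (\<theta> i * X i \<omega>) \<partial>M)"
    using W_cis[of 0] by (simp add: prob_space)
  have "(\<integral>\<omega>. indicator (A j) (X j \<omega>) *\<^sub>R W \<omega> \<partial>M) = prob (X j -` A j \<inter> space M) *\<^sub>R (\<integral>\<omega>. W \<omega> \<partial>M)"
    by (rule expectation_mult_indicator_of_cis[OF X_meas W W_le _ A_meas])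
       (simp add: W_cis W_expectation mult.commute)
  then show ?case
    using insert.hyps unfolding W_expectation by (simp add: W_def)
qed

theorem indep_vars_of_cis:
  fixes X :: "'i \<Rightarrow> 'a \<Rightarrow> real"
  assumes I: "finite I" "I \<noteq> {}" and X: "\<And>i. i \<in> I \<Longrightarrow> X i \<in> borel_measurable M"
    and cis: "\<And>\<theta>. (\<integral>\<omega>. cis (\<Sum>i\<in>I. \<theta> i * X i \<omega>) \<partial>M) = (\<Prod>i\<in>I. \<integral>\<omega>. cis (\<theta> i * X i \<omega>) \<partial>M)"
  shows "indep_vars (\<lambda>_. borel) X I"
proof (subst indep_vars_finite[where E = "\<lambda>_. sets borel"])
  show "\<forall>A\<in>\<Pi> i\<in>I. sets borel.
    prob (\<Inter>j\<in>I. X j -` A j \<inter> space M) = (\<Prod>j\<in>I. prob (X j -` A j \<inter> space M))"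
  proof
    fix A assume "A \<in> (\<Pi> i\<in>I. sets (borel :: real measure))"
    then have A: "A i \<in> sets borel" if "i \<in> I" for i using that by auto
    have "indicator (\<Inter>j\<in>I. X j -` A j \<inter> space M) \<omega> = (\<Prod>j\<in>I. indicator (A j) (X j \<omega>) :: real)"
      if "\<omega> \<in> space M" for \<omega>
      using I that by (auto simp: indicator_def prod_zero_iff)
    then have "(\<integral>\<omega>. indicator (\<Inter>j\<in>I. X j -` A j \<inter> space M) \<omega> \<partial>M) = (\<integral>\<omega>. (\<Prod>j\<in>I. indicator (A j) (X j \<omega>) :: real) \<partial>M)"
      by (rule Bochner_Integration.integral_cong[OF refl])
    moreover have "(\<Inter>j\<in>I. X j -` A j \<inter> space M) \<inter> space M = (\<Inter>j\<in>I. X j -` A j \<inter> space M)"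
      using I(2) by auto
    ultimately have "complex_of_real (prob (\<Inter>j\<in>I. X j -` A j \<inter> space M))
        = (\<integral>\<omega>. complex_of_real (\<Prod>j\<in>I. indicator (A j) (X j \<omega>)) \<partial>M)"
      by (simp only: Bochner_Integration.integral_indicator integral_complex_of_real)
    also have "\<dots> = complex_of_real (\<Prod>j\<in>I. prob (X j -` A j \<inter> space M))"
      using expectation_prod_indicator_cis[OF I(1) X cis A order_refl] by (simp add: scaleR_conv_of_real)
    finally show "prob (\<Inter>j\<in>I. X j -` A j \<inter> space M) = (\<Prod>j\<in>I. prob (X j -` A j \<inter> space M))"
      by (simp only: of_real_eq_iff)
  qed
  show "sets (borel :: real measure) = sigma_sets (space borel) (sets borel)"
    by (rule sets.sigma_sets_eq[symmetric])
qed (use I X in \<open>auto simp: Int_stable_def\<close>)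

end

subsection \<open>Gaussian families\<close>

lemma (in prob_space) expectation_cis_centered_gaussian_rv:
  assumes X: "centered_gaussian_rv M X v" and v: "0 \<le> v" and [measurable]: "X \<in> borel_measurable M"
  shows "(\<integral>\<omega>. cis (X \<omega>) \<partial>M) = exp (- v / 2)"
proof (cases "v = 0")
  case True
  then have "AE \<omega> in M. X \<omega> = 0" using X by (simp add: centered_gaussian_rv_def)
  then have "(\<integral>\<omega>. cis (X \<omega>) \<partial>M) = (\<integral>\<omega>. 1 \<partial>M)"
    by (intro integral_cong_AE) auto
  then show ?thesis using True by (simp add: prob_space)
next
  case False
  then have sd: "0 < sqrt v" using v by simp
  have "distributed M lborel X (normal_density 0 (sqrt v))"
    using X False by (simp add: centered_gaussian_rv_def)
  then have std: "distr M lborel (\<lambda>\<omega>. X \<omega> / sqrt v) = std_normal_distribution"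
    using normal_standard_normal_convert[OF sd, of X 0] by (simp add: distributed_def)
  have "(\<integral>\<omega>. cis (X \<omega>) \<partial>M) = (\<integral>\<omega>. cis (sqrt v * (X \<omega> / sqrt v)) \<partial>M)"
    using sd by simp
  also have "\<dots> = (\<integral>x. cis (sqrt v * x) \<partial>distr M lborel (\<lambda>\<omega>. X \<omega> / sqrt v))"
    by (subst integral_distr) auto
  also have "\<dots> = exp (- v / 2)"
    unfolding std cis_conv_exp using char_std_normal_distribution[unfolded char_def] v by (simp add: fun_eq_iff)
  finally show ?thesis .
qed

definition normal_law :: "real \<Rightarrow> real measure" where
  "normal_law v = density lborel (\<lambda>x. ennreal (normal_density 0 (sqrt v) x))"

lemma sets_normal_law[simp, measurable_cong]: "sets (normal_law v) = sets borel"
  and space_normal_law[simp]: "space (normal_law v) = UNIV"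
  by (simp_all add: normal_law_def)

lemma prob_space_normal_law: "0 < v \<Longrightarrow> prob_space (normal_law v)"
  unfolding normal_law_def by (rule prob_space_normal_density) simp

lemma distr_centered_gaussian_rv:
  assumes "centered_gaussian_rv M X v" "0 < v"
  shows "distr M borel X = normal_law v"
proof -
  have "distr M lborel X = normal_law v"
    using assms by (simp add: centered_gaussian_rv_def distributed_def normal_law_def)
  moreover have "distr M lborel X = distr M borel X" by (rule distr_cong) auto
  ultimately show ?thesis by simp
qed

text \<open>Linear combinations are indexed by lists, as in the definition of the Brownian sheet, so that the
  same index may occur several times.\<close>

definition gaussian_family ::
    "'a measure \<Rightarrow> 'i set \<Rightarrow> ('i \<Rightarrow> 'a \<Rightarrow> real) \<Rightarrow> ('i \<Rightarrow> 'i \<Rightarrow> real) \<Rightarrow> bool" where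
  "gaussian_family M I X C \<longleftrightarrow> (\<forall>xs. (\<forall>(i, a)\<in>set xs. i \<in> I) \<longrightarrow>
     centered_gaussian_rv M (\<lambda>\<omega>. \<Sum>(i, a)\<leftarrow>xs. a * X i \<omega>) (\<Sum>(i, a)\<leftarrow>xs. \<Sum>(j, b)\<leftarrow>xs. a * b * C i j))"

lemma gaussian_family_cong:
  assumes X: "gaussian_family M I X C" and C: "\<And>i j. i \<in> I \<Longrightarrow> j \<in> I \<Longrightarrow> C i j = C' i j"
  shows "gaussian_family M I X C'"
  unfolding gaussian_family_def
proof (intro allI impI)
  fix xs :: "('b \<times> real) list" assume xs: "\<forall>(i, a)\<in>set xs. i \<in> I"
  then have "(\<Sum>(i, a)\<leftarrow>xs. \<Sum>(j, b)\<leftarrow>xs. a * b * C i j) = (\<Sum>(i, a)\<leftarrow>xs. \<Sum>(j, b)\<leftarrow>xs. a * b * C' i j)"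
    unfolding case_prod_unfold by (intro arg_cong[where f=sum_list] map_cong refl) (auto simp: C)
  then show "centered_gaussian_rv M (\<lambda>\<omega>. \<Sum>(i, a)\<leftarrow>xs. a * X i \<omega>) (\<Sum>(i, a)\<leftarrow>xs. \<Sum>(j, b)\<leftarrow>xs. a * b * C' i j)"
    using X xs unfolding gaussian_family_def by metis
qed

lemma gaussian_family_two_term_combination:
  assumes X: "gaussian_family M I X C" and fg: "\<And>j. j \<in> J \<Longrightarrow> f j \<in> I" "\<And>j. j \<in> J \<Longrightarrow> g j \<in> I"
  shows "gaussian_family M J (\<lambda>j \<omega>. p j * X (f j) \<omega> + q j * X (g j) \<omega>)
    (\<lambda>j j'. p j * p j' * C (f j) (f j') + p j * q j' * C (f j) (g j')
      + q j * p j' * C (g j) (f j') + q j * q j' * C (g j) (g j'))"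
  unfolding gaussian_family_def
proof (intro allI impI)
  fix xs :: "('c \<times> real) list" assume xs: "\<forall>(j, a)\<in>set xs. j \<in> J"
  define ys where "ys = concat (map (\<lambda>(j, a). [(f j, a * p j), (g j, a * q j)]) xs)"
  have sum_ys: "(\<Sum>(i, a)\<leftarrow>ys. F i a) = (\<Sum>(j, a)\<leftarrow>xs. F (f j) (a * p j) + F (g j) (a * q j))" for F :: "_ \<Rightarrow> _ \<Rightarrow> real"
    unfolding ys_def by (induction xs) (auto simp: add.assoc)
  have "\<forall>(i, a)\<in>set ys. i \<in> I" using xs fg by (auto simp: ys_def)
  then have "centered_gaussian_rv M (\<lambda>\<omega>. \<Sum>(i, a)\<leftarrow>ys. a * X i \<omega>) (\<Sum>(i, a)\<leftarrow>ys. \<Sum>(j, b)\<leftarrow>ys. a * b * C i j)"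
    using X by (auto simp: gaussian_family_def)
  moreover have "(\<Sum>(i, a)\<leftarrow>ys. a * X i \<omega>) = (\<Sum>(j, a)\<leftarrow>xs. a * (p j * X (f j) \<omega> + q j * X (g j) \<omega>))" for \<omega>
    unfolding sum_ys by (intro arg_cong[where f=sum_list] map_cong refl) (auto simp: algebra_simps)
  moreover have "(\<Sum>(i, a)\<leftarrow>ys. \<Sum>(j, b)\<leftarrow>ys. a * b * C i j)
    = (\<Sum>(j, a)\<leftarrow>xs. \<Sum>(j', b)\<leftarrow>xs. a * b * (p j * p j' * C (f j) (f j') + p j * q j' * C (f j) (g j')
      + q j * p j' * C (g j) (f j') + q j * q j' * C (g j) (g j')))"
    unfolding sum_ys unfolding case_prod_unfold sum_list_addf[symmetric]
    by (intro arg_cong[where f=sum_list] map_cong refl) (simp add: algebra_simps)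
  ultimately show "centered_gaussian_rv M (\<lambda>\<omega>. \<Sum>(j, a)\<leftarrow>xs. a * (p j * X (f j) \<omega> + q j * X (g j) \<omega>))
    (\<Sum>(j, a)\<leftarrow>xs. \<Sum>(j', b)\<leftarrow>xs. a * b * (p j * p j' * C (f j) (f j') + p j * q j' * C (f j) (g j')
      + q j * p j' * C (g j) (f j') + q j * q j' * C (g j) (g j')))"
    by simp
qed

lemma gaussian_family_finite_sum:
  assumes X: "gaussian_family M I X (\<lambda>i j. if i = j then v i else 0)" and K: "finite K" "K \<subseteq> I"
  shows "centered_gaussian_rv M (\<lambda>\<omega>. \<Sum>k\<in>K. c k * X k \<omega>) (\<Sum>k\<in>K. (c k)\<^sup>2 * v k)"
proof -
  obtain ks where ks: "distinct ks" "set ks = K" using finite_distinct_list[OF K(1)] by auto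
  have "\<forall>(i, a)\<in>set (map (\<lambda>k. (k, c k)) ks). i \<in> I"
    using K(2) ks(2) by auto
  then have "centered_gaussian_rv M (\<lambda>\<omega>. \<Sum>(i, a)\<leftarrow>map (\<lambda>k. (k, c k)) ks. a * X i \<omega>)
    (\<Sum>(i, a)\<leftarrow>map (\<lambda>k. (k, c k)) ks. \<Sum>(j, b)\<leftarrow>map (\<lambda>k. (k, c k)) ks. a * b * (if i = j then v i else 0))"
    using X unfolding gaussian_family_def by blast
  moreover have "(\<Sum>k'\<in>K. c k * c k' * (if k = k' then v k else 0)) = (c k)\<^sup>2 * v k" if "k \<in> K" for k
  proof -
    have "(\<Sum>k'\<in>K. c k * c k' * (if k = k' then v k else 0)) = (\<Sum>k'\<in>K. if k = k' then (c k)\<^sup>2 * v k else 0)"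
      by (intro sum.cong) (auto simp: power2_eq_square)
    then show ?thesis using K(1) that by simp
  qed
  ultimately show ?thesis
    using ks by (simp add: comp_def sum_list_distinct_conv_sum_set cong: sum.cong)
qed

theorem (in prob_space) distr_PiM_gaussian_family:
  assumes K: "finite K" "K \<noteq> {}" and X: "\<And>k. k \<in> K \<Longrightarrow> X k \<in> borel_measurable M"
    and v: "\<And>k. k \<in> K \<Longrightarrow> 0 < v k"
    and gauss: "gaussian_family M K X (\<lambda>i j. if i = j then v i else 0)"
  shows "distr M (\<Pi>\<^sub>M k\<in>K. borel) (\<lambda>\<omega>. \<lambda>k\<in>K. X k \<omega>) = (\<Pi>\<^sub>M k\<in>K. normal_law (v k))"
proof -
  note gauss_sum = gaussian_family_finite_sum[OF gauss]
  have single: "centered_gaussian_rv M (\<lambda>\<omega>. \<theta> * X k \<omega>) (\<theta>\<^sup>2 * v k)" if "k \<in> K" for \<theta> k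
    using gauss_sum[of "{k}" "\<lambda>_. \<theta>"] that by simp
  have cis_single: "(\<integral>\<omega>. cis (\<theta> * X k \<omega>) \<partial>M) = exp (- (\<theta>\<^sup>2 * v k) / 2)" if "k \<in> K" for \<theta> k
    using v[OF that] X[OF that] by (intro expectation_cis_centered_gaussian_rv single that) auto
  have "indep_vars (\<lambda>_. borel) X K"
  proof (rule indep_vars_of_cis[OF K X])
    fix \<theta>
    have "(\<integral>\<omega>. cis (\<Sum>k\<in>K. \<theta> k * X k \<omega>) \<partial>M) = exp (- (\<Sum>k\<in>K. (\<theta> k)\<^sup>2 * v k) / 2)"
    proof (rule expectation_cis_centered_gaussian_rv)
      show "centered_gaussian_rv M (\<lambda>\<omega>. \<Sum>k\<in>K. \<theta> k * X k \<omega>) (\<Sum>k\<in>K. (\<theta> k)\<^sup>2 * v k)"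
        using K(1) by (rule gauss_sum) simp
    qed (use v X in \<open>auto intro!: sum_nonneg simp: less_imp_le\<close>)
    also have "- (\<Sum>k\<in>K. (\<theta> k)\<^sup>2 * v k) / 2 = (\<Sum>k\<in>K. - ((\<theta> k)\<^sup>2 * v k) / 2)"
      by (simp only: sum_negf[symmetric] sum_divide_distrib)
    also have "complex_of_real (exp \<dots>) = (\<Prod>k\<in>K. \<integral>\<omega>. cis (\<theta> k * X k \<omega>) \<partial>M)"
      unfolding exp_sum[OF K(1)] of_real_prod by (intro prod.cong refl cis_single[symmetric])
    finally show "(\<integral>\<omega>. cis (\<Sum>k\<in>K. \<theta> k * X k \<omega>) \<partial>M) = (\<Prod>k\<in>K. \<integral>\<omega>. cis (\<theta> k * X k \<omega>) \<partial>M)" .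
  qed
  then have "distr M (\<Pi>\<^sub>M k\<in>K. borel) (\<lambda>\<omega>. \<lambda>k\<in>K. X k \<omega>) = (\<Pi>\<^sub>M k\<in>K. distr M borel (X k))"
    using indep_vars_iff_distr_eq_PiM'[OF K(2) X] by simp
  also have "\<dots> = (\<Pi>\<^sub>M k\<in>K. normal_law (v k))"
    using single[of _ 1] v by (intro PiM_cong distr_centered_gaussian_rv refl) simp_all
  finally show ?thesis .
qed

subsection \<open>Resampling the coordinates of a finite product space\<close>

lemma nn_integral_square_sum_finite:
  fixes f :: "'j \<Rightarrow> 'a \<Rightarrow> ennreal"
  assumes [measurable]: "\<And>j. j \<in> J \<Longrightarrow> f j \<in> borel_measurable M"
    and square: "\<And>j. j \<in> J \<Longrightarrow> (\<integral>\<^sup>+x. (f j x)\<^sup>2 \<partial>M) < \<top>"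
  shows "(\<integral>\<^sup>+x. (\<Sum>j\<in>J. f j x)\<^sup>2 \<partial>M) < \<top>"
proof -
  have "(\<integral>\<^sup>+x. f i x * f j x \<partial>M) < \<top>" if ij: "i \<in> J" "j \<in> J" for i j
  proof -
    have "(\<integral>\<^sup>+x. f i x * f j x \<partial>M)\<^sup>2 \<le> (\<integral>\<^sup>+x. (f i x)\<^sup>2 \<partial>M) * (\<integral>\<^sup>+x. (f j x)\<^sup>2 \<partial>M)"
      using ij by (intro Cauchy_Schwarz_nn_integral) auto
    also have "\<dots> < \<top>" using square ij by (simp add: ennreal_mult_less_top)
    finally show ?thesis by (auto simp: power2_eq_square ennreal_mult_less_top)
  qed
  moreover have "(\<integral>\<^sup>+x. (\<Sum>j\<in>J. f j x)\<^sup>2 \<partial>M) = (\<Sum>i\<in>J. \<Sum>j\<in>J. \<integral>\<^sup>+x. f i x * f j x \<partial>M)"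
    unfolding power2_eq_square sum_product by (simp add: nn_integral_sum)
  ultimately show ?thesis
    by (cases "finite J") simp_all
qed

lemma sum_symmetric_le_double_sum_upper:
  fixes f :: "'j::linorder \<Rightarrow> 'j \<Rightarrow> 'a::ordered_comm_monoid_add"
  assumes J: "finite J" and sym: "\<And>i j. f i j = f j i" and nonneg: "\<And>i j. 0 \<le> f i j"
  shows "(\<Sum>i\<in>J. \<Sum>j\<in>J. f i j) \<le> (\<Sum>i\<in>J. \<Sum>j\<in>{j\<in>J. i \<le> j}. f i j) + (\<Sum>i\<in>J. \<Sum>j\<in>{j\<in>J. i \<le> j}. f i j)"
proof -
  have upper: "(\<Sum>i\<in>J. \<Sum>j\<in>{j\<in>J. i \<le> j}. f i j) = (\<Sum>i\<in>J. \<Sum>j\<in>J. if i \<le> j then f i j else 0)"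
    using J by (simp add: sum.inter_filter)
  have lower: "(\<Sum>i\<in>J. \<Sum>j\<in>{j\<in>J. i \<le> j}. f i j) = (\<Sum>i\<in>J. \<Sum>j\<in>J. if j \<le> i then f i j else 0)"
    unfolding upper by (subst sum.swap, intro sum.cong refl) (auto intro: sym)
  have "(\<Sum>i\<in>J. \<Sum>j\<in>J. f i j) \<le> (\<Sum>i\<in>J. \<Sum>j\<in>J. (if i \<le> j then f i j else 0) + (if j \<le> i then f i j else 0))"
    using nonneg by (intro sum_mono) (auto intro: add_increasing)
  also have "\<dots> = (\<Sum>i\<in>J. \<Sum>j\<in>J. if i \<le> j then f i j else 0) + (\<Sum>i\<in>J. \<Sum>j\<in>J. if j \<le> i then f i j else 0)"
    by (simp add: sum.distrib)
  finally show ?thesis unfolding upper[symmetric] lower[symmetric] .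
qed

lemma finite_disjoint_refinement:
  assumes "finite Q" "\<And>q. q \<in> Q \<Longrightarrow> H q \<in> sets M"
  obtains A where "\<And>q. q \<in> Q \<Longrightarrow> A q \<in> sets M" "\<And>q. q \<in> Q \<Longrightarrow> A q \<subseteq> H q"
    "disjoint_family_on A Q" "(\<Union>q\<in>Q. A q) = (\<Union>q\<in>Q. H q)"
  using assms
proof (induction Q arbitrary: thesis rule: finite_induct)
  case empty
  then show ?case by (simp add: disjoint_family_on_def)
next
  case (insert q Q)
  obtain A where A: "\<And>q. q \<in> Q \<Longrightarrow> A q \<in> sets M" "\<And>q. q \<in> Q \<Longrightarrow> A q \<subseteq> H q"
    "disjoint_family_on A Q" "(\<Union>q\<in>Q. A q) = (\<Union>q\<in>Q. H q)"
    by (rule insert.IH) (use insert.prems(2) in auto)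
  show ?case
  proof (rule insert.prems(1)[of "A(q := H q - (\<Union>q\<in>Q. H q))"])
    show "disjoint_family_on (A(q := H q - (\<Union>q\<in>Q. H q))) (insert q Q)"
      using A(3) insert.hyps(2) unfolding disjoint_family_on_def A(4)[symmetric] by auto
  qed (use A insert.hyps insert.prems(2) in \<open>auto intro!: sets.Diff sets.finite_UN\<close>)
qed

locale resampling = finite_product_prob_space M I
  for M :: "'i \<Rightarrow> 'a measure" and I :: "'i set"
begin

abbreviation product_measure :: "('i \<Rightarrow> 'a) measure" where
  "product_measure \<equiv> PiM I M"

definition mix :: "'i set \<Rightarrow> ('i \<Rightarrow> 'a) \<Rightarrow> ('i \<Rightarrow> 'a) \<Rightarrow> 'i \<Rightarrow> 'a" where
  "mix S \<omega> \<omega>' = (\<lambda>k\<in>I. if k \<in> S then \<omega>' k else \<omega> k)"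

definition resample :: "'i set \<Rightarrow> (('i \<Rightarrow> 'a) \<Rightarrow> ennreal) \<Rightarrow> ('i \<Rightarrow> 'a) \<Rightarrow> ennreal" where
  "resample S f \<omega> = (\<integral>\<^sup>+\<omega>'. f (mix S \<omega> \<omega>') \<partial>product_measure)"

lemma measurable_mix_pair[measurable]:
  "(\<lambda>p. mix S (fst p) (snd p)) \<in> product_measure \<Otimes>\<^sub>M product_measure \<rightarrow>\<^sub>M product_measure"
  unfolding mix_def
proof (rule measurable_restrict)
  fix k assume [measurable]: "k \<in> I"
  show "(\<lambda>p. if k \<in> S then snd p k else fst p k) \<in> product_measure \<Otimes>\<^sub>M product_measure \<rightarrow>\<^sub>M M k"
    by (cases "k \<in> S") auto
qed

lemma measurable_mix[measurable]:
  assumes \<omega>: "\<omega> \<in> space product_measure"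
  shows "mix S \<omega> \<in> product_measure \<rightarrow>\<^sub>M product_measure"
  using measurable_compose[OF measurable_Pair1'[OF \<omega>] measurable_mix_pair[of S]] by simp

lemma mix_mix: "mix T (mix S \<omega> \<omega>') \<omega>'' = mix (S \<union> T) \<omega> (mix T \<omega>' \<omega>'')"
  by (auto simp: mix_def restrict_def)

lemma mix_mix_subset: "S \<subseteq> T \<Longrightarrow> mix T (mix S \<omega> \<omega>') \<omega>'' = mix T \<omega> \<omega>''"
  by (auto simp: mix_def restrict_def fun_eq_iff)

lemma distr_mix:
  "distr (product_measure \<Otimes>\<^sub>M product_measure) product_measure (\<lambda>p. mix S (fst p) (snd p)) = product_measure"
proof (rule PiM_eqI[OF finite_index])
  let ?D = "distr (product_measure \<Otimes>\<^sub>M product_measure) product_measure (\<lambda>p. mix S (fst p) (snd p))"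
  show "sets ?D = sets product_measure"
    by (rule sets_distr)
  fix A assume A: "\<And>k. k \<in> I \<Longrightarrow> A k \<in> sets (M k)"
  let ?B = "\<lambda>k. if k \<in> S then space (M k) else A k" and ?C = "\<lambda>k. if k \<in> S then A k else space (M k)"
  have BC: "\<And>k. k \<in> I \<Longrightarrow> ?B k \<in> sets (M k)" "\<And>k. k \<in> I \<Longrightarrow> ?C k \<in> sets (M k)"
    using A by auto
  have "(\<lambda>p. mix S (fst p) (snd p)) -` (Pi\<^sub>E I A) \<inter> space (product_measure \<Otimes>\<^sub>M product_measure) = Pi\<^sub>E I ?B \<times> Pi\<^sub>E I ?C"
    using sets.sets_into_space[OF A]
    by (auto simp: space_pair_measure space_PiM mix_def PiE_iff split: if_splits) blast+
  then have "emeasure ?D (Pi\<^sub>E I A) = emeasure (product_measure \<Otimes>\<^sub>M product_measure) (Pi\<^sub>E I ?B \<times> Pi\<^sub>E I ?C)"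
    using A by (subst emeasure_distr) (auto intro!: sets_PiM_I_finite finite_index)
  also have "\<dots> = emeasure product_measure (Pi\<^sub>E I ?B) * emeasure product_measure (Pi\<^sub>E I ?C)"
    using BC by (intro emeasure_pair_measure_Times sets_PiM_I_finite finite_index) auto
  also have "\<dots> = (\<Prod>k\<in>I. emeasure (M k) (?B k)) * (\<Prod>k\<in>I. emeasure (M k) (?C k))"
    using BC by (simp only: emeasure_PiM finite_index)
  also have "\<dots> = (\<Prod>k\<in>I. emeasure (M k) (A k))"
    unfolding prod.distrib[symmetric] by (intro prod.cong) (auto simp: M.emeasure_space_1)
  finally show "emeasure ?D (Pi\<^sub>E I A) = (\<Prod>k\<in>I. emeasure (M k) (A k))" .
qed

lemma borel_measurable_resample[measurable]:
  assumes [measurable]: "f \<in> borel_measurable product_measure"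
  shows "resample S f \<in> borel_measurable product_measure"
proof -
  have "(\<lambda>\<omega>. \<integral>\<^sup>+\<omega>'. f (mix S (fst (\<omega>, \<omega>')) (snd (\<omega>, \<omega>'))) \<partial>product_measure) \<in> borel_measurable product_measure"
    by measurable
  then show ?thesis by (simp add: resample_def[abs_def])
qed

lemma nn_integral_resample:
  assumes [measurable]: "f \<in> borel_measurable product_measure"
  shows "(\<integral>\<^sup>+\<omega>. resample S f \<omega> \<partial>product_measure) = (\<integral>\<^sup>+\<omega>. f \<omega> \<partial>product_measure)"
proof -
  have "(\<integral>\<^sup>+\<omega>. resample S f \<omega> \<partial>product_measure)
      = (\<integral>\<^sup>+p. f (mix S (fst p) (snd p)) \<partial>(product_measure \<Otimes>\<^sub>M product_measure))"
    by (subst nn_integral_fst[symmetric]) (simp_all add: resample_def[abs_def])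
  also have "\<dots> = (\<integral>\<^sup>+\<omega>. f \<omega> \<partial>distr (product_measure \<Otimes>\<^sub>M product_measure) product_measure (\<lambda>p. mix S (fst p) (snd p)))"
    by (subst nn_integral_distr) simp_all
  finally show ?thesis unfolding distr_mix .
qed

lemma resample_mult:
  assumes [measurable]: "f \<in> borel_measurable product_measure" and \<omega>: "\<omega> \<in> space product_measure"
    and g: "\<And>\<omega>'. \<omega>' \<in> space product_measure \<Longrightarrow> g (mix S \<omega> \<omega>') = g \<omega>"
  shows "resample S (\<lambda>\<omega>. g \<omega> * f \<omega>) \<omega> = g \<omega> * resample S f \<omega>"
proof -
  have [measurable]: "mix S \<omega> \<in> product_measure \<rightarrow>\<^sub>M product_measure" using \<omega> by simp
  have "resample S (\<lambda>\<omega>. g \<omega> * f \<omega>) \<omega> = (\<integral>\<^sup>+\<omega>'. g \<omega> * f (mix S \<omega> \<omega>') \<partial>product_measure)"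
    unfolding resample_def using g by (intro nn_integral_cong) simp
  also have "\<dots> = g \<omega> * resample S f \<omega>"
    unfolding resample_def by (rule nn_integral_cmult) simp
  finally show ?thesis .
qed

lemma resample_cmult:
  assumes "f \<in> borel_measurable product_measure" "\<omega> \<in> space product_measure"
  shows "resample S (\<lambda>\<omega>. c * f \<omega>) \<omega> = c * resample S f \<omega>"
  using resample_mult[OF assms, of "\<lambda>_. c"] by simp

lemma resample_sum:
  assumes f: "\<And>j. j \<in> J \<Longrightarrow> f j \<in> borel_measurable product_measure" and \<omega>: "\<omega> \<in> space product_measure"
  shows "resample S (\<lambda>\<omega>. \<Sum>j\<in>J. f j \<omega>) \<omega> = (\<Sum>j\<in>J. resample S (f j) \<omega>)"
  unfolding resample_def
  by (intro nn_integral_sum) (rule measurable_compose[OF measurable_mix[OF \<omega>] f])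

lemma resample_resample:
  assumes [measurable]: "f \<in> borel_measurable product_measure" and \<omega>: "\<omega> \<in> space product_measure"
  shows "resample S (resample T f) \<omega> = resample (S \<union> T) f \<omega>"
proof -
  have [measurable]: "mix (S \<union> T) \<omega> \<in> product_measure \<rightarrow>\<^sub>M product_measure" using \<omega> by simp
  have "resample S (resample T f) \<omega> = (\<integral>\<^sup>+\<omega>'. resample T (\<lambda>\<omega>''. f (mix (S \<union> T) \<omega> \<omega>'')) \<omega>' \<partial>product_measure)"
    unfolding resample_def by (simp add: mix_mix)
  also have "\<dots> = (\<integral>\<^sup>+\<omega>'. f (mix (S \<union> T) \<omega> \<omega>') \<partial>product_measure)"
    by (intro nn_integral_resample) simp
  finally show ?thesis by (simp add: resample_def)
qed

lemma resample_mix: "S \<subseteq> T \<Longrightarrow> resample T f (mix S \<omega> \<omega>') = resample T f \<omega>"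
  by (simp add: resample_def mix_mix_subset)

lemma power2_resample_le:
  assumes [measurable]: "f \<in> borel_measurable product_measure" and \<omega>: "\<omega> \<in> space product_measure"
  shows "(resample S f \<omega>)\<^sup>2 \<le> resample S (\<lambda>\<omega>. (f \<omega>)\<^sup>2) \<omega>"
proof -
  have [measurable]: "mix S \<omega> \<in> product_measure \<rightarrow>\<^sub>M product_measure" using \<omega> by simp
  show ?thesis
    unfolding resample_def
    using Cauchy_Schwarz_nn_integral[of "\<lambda>\<omega>'. f (mix S \<omega> \<omega>')" product_measure "\<lambda>_. 1"] by (simp add: P.emeasure_space_1)
qed

lemma nn_integral_power2_resample_le:
  assumes [measurable]: "f \<in> borel_measurable product_measure"
  shows "(\<integral>\<^sup>+\<omega>. (resample S f \<omega>)\<^sup>2 \<partial>product_measure) \<le> (\<integral>\<^sup>+\<omega>. (f \<omega>)\<^sup>2 \<partial>product_measure)"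
proof -
  have "(\<integral>\<^sup>+\<omega>. (resample S f \<omega>)\<^sup>2 \<partial>product_measure) \<le> (\<integral>\<^sup>+\<omega>. resample S (\<lambda>\<omega>. (f \<omega>)\<^sup>2) \<omega> \<partial>product_measure)"
    by (intro nn_integral_mono power2_resample_le) auto
  then show ?thesis by (simp add: nn_integral_resample)
qed

lemma nn_integral_resample_mult:
  assumes [measurable]: "f \<in> borel_measurable product_measure" "g \<in> borel_measurable product_measure"
    and g: "\<And>\<omega> \<omega>'. \<omega> \<in> space product_measure \<Longrightarrow> \<omega>' \<in> space product_measure \<Longrightarrow> g (mix S \<omega> \<omega>') = g \<omega>"
  shows "(\<integral>\<^sup>+\<omega>. g \<omega> * resample S f \<omega> \<partial>product_measure) = (\<integral>\<^sup>+\<omega>. g \<omega> * f \<omega> \<partial>product_measure)"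
proof -
  have "(\<integral>\<^sup>+\<omega>. g \<omega> * f \<omega> \<partial>product_measure) = (\<integral>\<^sup>+\<omega>. resample S (\<lambda>\<omega>. g \<omega> * f \<omega>) \<omega> \<partial>product_measure)"
    by (rule nn_integral_resample[symmetric]) simp
  also have "\<dots> = (\<integral>\<^sup>+\<omega>. g \<omega> * resample S f \<omega> \<partial>product_measure)"
    using g by (intro nn_integral_cong resample_mult) auto
  finally show ?thesis by simp
qed

lemma resample_self_adjoint:
  assumes [measurable]: "f \<in> borel_measurable product_measure" "g \<in> borel_measurable product_measure"
  shows "(\<integral>\<^sup>+\<omega>. resample S f \<omega> * g \<omega> \<partial>product_measure) = (\<integral>\<^sup>+\<omega>. f \<omega> * resample S g \<omega> \<partial>product_measure)"
  using nn_integral_resample_mult[of g "resample S f" S] nn_integral_resample_mult[of f "resample S g" S]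
  by (simp add: resample_mix mult.commute)

definition doob_bound :: "ennreal \<Rightarrow> 'q set \<Rightarrow> ('q \<Rightarrow> 'i set) \<Rightarrow> bool" where
  "doob_bound c Q S \<longleftrightarrow> (\<forall>g. (\<forall>q\<in>Q. g q \<in> borel_measurable product_measure) \<longrightarrow>
     (\<integral>\<^sup>+\<omega>. (\<Sum>q\<in>Q. resample (S q) (g q) \<omega>)\<^sup>2 \<partial>product_measure)
       \<le> c * (\<integral>\<^sup>+\<omega>. (\<Sum>q\<in>Q. g q \<omega>)\<^sup>2 \<partial>product_measure))"

lemma doob_bound_cong:
  assumes "doob_bound c Q S" "\<And>q. q \<in> Q \<Longrightarrow> S q = S' q"
  shows "doob_bound c Q S'"
  using assms unfolding doob_bound_def by (simp cong: sum.cong)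

text \<open>Expand the square; in the mixed terms with \<open>i \<le> j\<close> the conditional expectation given the larger
  information can be dropped.\<close>

lemma nn_integral_power2_sum_resample_le:
  fixes S :: "'j::linorder \<Rightarrow> 'i set"
  assumes J: "finite J" and S: "\<And>i j. i \<in> J \<Longrightarrow> j \<in> J \<Longrightarrow> i \<le> j \<Longrightarrow> S j \<subseteq> S i"
    and g[measurable]: "\<And>j. j \<in> J \<Longrightarrow> g j \<in> borel_measurable product_measure"
  shows "(\<integral>\<^sup>+\<omega>. (\<Sum>j\<in>J. resample (S j) (g j) \<omega>)\<^sup>2 \<partial>product_measure)
    \<le> 2 * (\<integral>\<^sup>+\<omega>. (\<Sum>j\<in>J. resample (S j) (g j) \<omega>) * (\<Sum>j\<in>J. g j \<omega>) \<partial>product_measure)"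
proof -
  let ?b = "\<lambda>j. resample (S j) (g j)"
  have [measurable]: "?b j \<in> borel_measurable product_measure" if "j \<in> J" for j using g[OF that] by simp
  have "(\<integral>\<^sup>+\<omega>. (\<Sum>j\<in>J. ?b j \<omega>)\<^sup>2 \<partial>product_measure) = (\<Sum>i\<in>J. \<Sum>j\<in>J. \<integral>\<^sup>+\<omega>. ?b i \<omega> * ?b j \<omega> \<partial>product_measure)"
    unfolding power2_eq_square sum_product by (simp add: nn_integral_sum)
  also have "\<dots> \<le> 2 * (\<Sum>i\<in>J. \<Sum>j\<in>{j\<in>J. i \<le> j}. \<integral>\<^sup>+\<omega>. ?b i \<omega> * ?b j \<omega> \<partial>product_measure)"
    unfolding mult_2 using J by (intro sum_symmetric_le_double_sum_upper) (simp_all add: mult.commute)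
  also have "(\<Sum>i\<in>J. \<Sum>j\<in>{j\<in>J. i \<le> j}. \<integral>\<^sup>+\<omega>. ?b i \<omega> * ?b j \<omega> \<partial>product_measure)
      = (\<Sum>i\<in>J. \<Sum>j\<in>{j\<in>J. i \<le> j}. \<integral>\<^sup>+\<omega>. ?b i \<omega> * g j \<omega> \<partial>product_measure)"
    using S by (intro sum.cong refl nn_integral_resample_mult) (auto simp: resample_mix)
  also have "\<dots> \<le> (\<Sum>i\<in>J. \<Sum>j\<in>J. \<integral>\<^sup>+\<omega>. ?b i \<omega> * g j \<omega> \<partial>product_measure)"
    using J by (intro sum_mono sum_mono2) auto
  also have "\<dots> = (\<integral>\<^sup>+\<omega>. (\<Sum>j\<in>J. ?b j \<omega>) * (\<Sum>j\<in>J. g j \<omega>) \<partial>product_measure)"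
    unfolding sum_product by (simp add: nn_integral_sum)
  finally show ?thesis by (simp add: mult_left_mono)
qed

theorem doob_bound_chain:
  fixes S :: "'j::linorder \<Rightarrow> 'i set"
  assumes J: "finite J" and S: "\<And>i j. i \<in> J \<Longrightarrow> j \<in> J \<Longrightarrow> i \<le> j \<Longrightarrow> S j \<subseteq> S i"
  shows "doob_bound 4 J S"
  unfolding doob_bound_def
proof (intro allI impI)
  fix g :: "'j \<Rightarrow> ('i \<Rightarrow> 'a) \<Rightarrow> ennreal"
  assume "\<forall>j\<in>J. g j \<in> borel_measurable product_measure"
  then have g[measurable]: "\<And>j. j \<in> J \<Longrightarrow> g j \<in> borel_measurable product_measure" by blast
  have [measurable]: "resample (S j) (g j) \<in> borel_measurable product_measure" if "j \<in> J" for j using g[OF that] by simp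
  define A G where "A = (\<integral>\<^sup>+\<omega>. (\<Sum>j\<in>J. resample (S j) (g j) \<omega>)\<^sup>2 \<partial>product_measure)"
    and "G = (\<integral>\<^sup>+\<omega>. (\<Sum>j\<in>J. g j \<omega>)\<^sup>2 \<partial>product_measure)"
  have "A \<le> 4 * G"
  proof (cases "G = \<top> \<or> A = 0")
    case False
    have "(\<integral>\<^sup>+\<omega>. (g j \<omega>)\<^sup>2 \<partial>product_measure) \<le> G" if "j \<in> J" for j
      unfolding G_def using J that by (intro nn_integral_mono power_mono member_le_sum) auto
    then have "(\<integral>\<^sup>+\<omega>. (resample (S j) (g j) \<omega>)\<^sup>2 \<partial>product_measure) < \<top>" if "j \<in> J" for j
      using that False nn_integral_power2_resample_le[OF g[OF that], of "S j"]
      by (metis le_less_trans top.not_eq_extremum)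
    then have finite: "A < \<top>"
      unfolding A_def by (intro nn_integral_square_sum_finite) auto
    have "A\<^sup>2 \<le> (2 * (\<integral>\<^sup>+\<omega>. (\<Sum>j\<in>J. resample (S j) (g j) \<omega>) * (\<Sum>j\<in>J. g j \<omega>) \<partial>product_measure))\<^sup>2"
      unfolding A_def using J S g by (intro power_mono nn_integral_power2_sum_resample_le) auto
    also have "\<dots> \<le> 4 * (A * G)"
      unfolding power_mult_distrib A_def G_def
      by (simp add: mult_left_mono Cauchy_Schwarz_nn_integral)
    finally have "A * A \<le> 4 * G * A"
      by (simp add: power2_eq_square ac_simps)
    then show ?thesis
      using ennreal_mult_strict_right_mono[of "4 * G" A A] False finite
      by (metis leD leI zero_less_iff_neq_zero)
  qed (auto simp: ennreal_mult_top)
  then show "(\<integral>\<^sup>+\<omega>. (\<Sum>j\<in>J. resample (S j) (g j) \<omega>)\<^sup>2 \<partial>product_measure)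
    \<le> 4 * (\<integral>\<^sup>+\<omega>. (\<Sum>j\<in>J. g j \<omega>)\<^sup>2 \<partial>product_measure)"
    unfolding A_def G_def .
qed

text \<open>Cairoli's argument: resampling operators of independent coordinates compose, so the bounds for the
  two directions can be applied one after the other.\<close>

theorem doob_bound_Times:
  assumes bound: "doob_bound c Q S" "doob_bound c' Q' S'"
  shows "doob_bound (c * c') (Q \<times> Q') (\<lambda>(q, q'). S q \<union> S' q')"
  unfolding doob_bound_def
proof (intro allI impI)
  fix g :: "'b \<times> 'c \<Rightarrow> ('i \<Rightarrow> 'a) \<Rightarrow> ennreal"
  assume "\<forall>p\<in>Q \<times> Q'. g p \<in> borel_measurable product_measure"
  then have g: "\<And>q q'. q \<in> Q \<Longrightarrow> q' \<in> Q' \<Longrightarrow> g (q, q') \<in> borel_measurable product_measure" by blast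
  let ?r = "\<lambda>q q'. resample (S' q') (g (q, q'))"
  have split: "(\<Sum>p\<in>Q \<times> Q'. resample (case p of (q, q') \<Rightarrow> S q \<union> S' q') (g p) \<omega>)
      = (\<Sum>q\<in>Q. resample (S q) (\<lambda>\<omega>. \<Sum>q'\<in>Q'. ?r q q' \<omega>) \<omega>)" if \<omega>: "\<omega> \<in> space product_measure" for \<omega>
  proof -
    have "resample (S q) (\<lambda>\<omega>. \<Sum>q'\<in>Q'. ?r q q' \<omega>) \<omega> = (\<Sum>q'\<in>Q'. resample (S q \<union> S' q') (g (q, q')) \<omega>)"
      if q: "q \<in> Q" for q
      using g[OF q] \<omega> by (subst resample_sum) (auto intro!: sum.cong resample_resample)
    then show ?thesis by (simp add: sum.cartesian_product')
  qed
  have merge: "(\<Sum>q\<in>Q. \<Sum>q'\<in>Q'. ?r q q' \<omega>) = (\<Sum>q'\<in>Q'. resample (S' q') (\<lambda>\<omega>. \<Sum>q\<in>Q. g (q, q') \<omega>) \<omega>)"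
    if \<omega>: "\<omega> \<in> space product_measure" for \<omega>
    using g \<omega> by (subst sum.swap) (auto intro!: sum.cong resample_sum[symmetric])
  have "(\<integral>\<^sup>+\<omega>. (\<Sum>p\<in>Q \<times> Q'. resample (case p of (q, q') \<Rightarrow> S q \<union> S' q') (g p) \<omega>)\<^sup>2 \<partial>product_measure)
      = (\<integral>\<^sup>+\<omega>. (\<Sum>q\<in>Q. resample (S q) (\<lambda>\<omega>. \<Sum>q'\<in>Q'. ?r q q' \<omega>) \<omega>)\<^sup>2 \<partial>product_measure)"
    by (intro nn_integral_cong) (simp only: split)
  also have "\<dots> \<le> c * (\<integral>\<^sup>+\<omega>. (\<Sum>q\<in>Q. \<Sum>q'\<in>Q'. ?r q q' \<omega>)\<^sup>2 \<partial>product_measure)"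
    using bound(1) g unfolding doob_bound_def by (auto intro!: borel_measurable_sum)
  also have "(\<integral>\<^sup>+\<omega>. (\<Sum>q\<in>Q. \<Sum>q'\<in>Q'. ?r q q' \<omega>)\<^sup>2 \<partial>product_measure)
      = (\<integral>\<^sup>+\<omega>. (\<Sum>q'\<in>Q'. resample (S' q') (\<lambda>\<omega>. \<Sum>q\<in>Q. g (q, q') \<omega>) \<omega>)\<^sup>2 \<partial>product_measure)"
    by (intro nn_integral_cong) (simp only: merge)
  also have "\<dots> \<le> c' * (\<integral>\<^sup>+\<omega>. (\<Sum>q'\<in>Q'. \<Sum>q\<in>Q. g (q, q') \<omega>)\<^sup>2 \<partial>product_measure)"
    using bound(2) g unfolding doob_bound_def by (auto intro!: borel_measurable_sum)
  also have "(\<lambda>\<omega>. \<Sum>q'\<in>Q'. \<Sum>q\<in>Q. g (q, q') \<omega>) = (\<lambda>\<omega>. \<Sum>p\<in>Q \<times> Q'. g p \<omega>)"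
    by (subst sum.swap) (simp add: sum.cartesian_product)
  finally show "(\<integral>\<^sup>+\<omega>. (\<Sum>p\<in>Q \<times> Q'. resample (case p of (q, q') \<Rightarrow> S q \<union> S' q') (g p) \<omega>)\<^sup>2 \<partial>product_measure)
    \<le> c * c' * (\<integral>\<^sup>+\<omega>. (\<Sum>p\<in>Q \<times> Q'. g p \<omega>)\<^sup>2 \<partial>product_measure)"
    by (simp add: mult_left_mono mult.assoc)
qed

theorem doob_bound_disjoint_events:
  assumes bound: "doob_bound c Q S" and Q: "finite Q"
    and A[measurable]: "\<And>q. q \<in> Q \<Longrightarrow> A q \<in> sets product_measure" and disjoint: "disjoint_family_on A Q"
    and f[measurable]: "f \<in> borel_measurable product_measure"
  shows "(\<Sum>q\<in>Q. \<integral>\<^sup>+\<omega>. indicator (A q) \<omega> * resample (S q) f \<omega> \<partial>product_measure)\<^sup>2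
    \<le> c * emeasure product_measure (\<Union>q\<in>Q. A q) * (\<integral>\<^sup>+\<omega>. (f \<omega>)\<^sup>2 \<partial>product_measure)"
proof -
  let ?r = "\<lambda>q. resample (S q) (indicator (A q))"
  have [measurable]: "?r q \<in> borel_measurable product_measure" if "q \<in> Q" for q
    using A[OF that] by simp
  have "(\<integral>\<^sup>+\<omega>. (\<Sum>q\<in>Q. ?r q \<omega>)\<^sup>2 \<partial>product_measure) \<le> c * (\<integral>\<^sup>+\<omega>. (\<Sum>q\<in>Q. indicator (A q) \<omega>)\<^sup>2 \<partial>product_measure)"
    using bound unfolding doob_bound_def by auto
  also have "(\<integral>\<^sup>+\<omega>. (\<Sum>q\<in>Q. indicator (A q) \<omega>)\<^sup>2 \<partial>product_measure) = (\<integral>\<^sup>+\<omega>. indicator (\<Union>q\<in>Q. A q) \<omega> \<partial>product_measure)"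
    unfolding indicator_UN_disjoint[OF Q disjoint, symmetric]
    by (intro nn_integral_cong) (simp add: indicator_def)
  also have "\<dots> = emeasure product_measure (\<Union>q\<in>Q. A q)"
    using Q by (intro nn_integral_indicator) auto
  finally have square: "(\<integral>\<^sup>+\<omega>. (\<Sum>q\<in>Q. ?r q \<omega>)\<^sup>2 \<partial>product_measure) \<le> c * emeasure product_measure (\<Union>q\<in>Q. A q)" .
  have "(\<Sum>q\<in>Q. \<integral>\<^sup>+\<omega>. indicator (A q) \<omega> * resample (S q) f \<omega> \<partial>product_measure)
      = (\<Sum>q\<in>Q. \<integral>\<^sup>+\<omega>. ?r q \<omega> * f \<omega> \<partial>product_measure)"
    by (intro sum.cong refl resample_self_adjoint[symmetric]) auto
  also have "\<dots> = (\<integral>\<^sup>+\<omega>. (\<Sum>q\<in>Q. ?r q \<omega>) * f \<omega> \<partial>product_measure)"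
    unfolding sum_distrib_right by (intro nn_integral_sum[symmetric]) simp
  also have "\<dots>\<^sup>2 \<le> (\<integral>\<^sup>+\<omega>. (\<Sum>q\<in>Q. ?r q \<omega>)\<^sup>2 \<partial>product_measure) * (\<integral>\<^sup>+\<omega>. (f \<omega>)\<^sup>2 \<partial>product_measure)"
    by (intro Cauchy_Schwarz_nn_integral) auto
  also have "\<dots> \<le> c * emeasure product_measure (\<Union>q\<in>Q. A q) * (\<integral>\<^sup>+\<omega>. (f \<omega>)\<^sup>2 \<partial>product_measure)"
    by (intro mult_right_mono square) simp
  finally show ?thesis .
qed

end

subsection \<open>Gaussian white noise with finitely many cells\<close>

lemma normal_law_interval_le:
  assumes v: "0 < v" and \<epsilon>: "0 \<le> \<epsilon>"
  shows "measure (normal_law v) {y - \<epsilon>..y + \<epsilon>} \<le> \<epsilon> / sqrt v"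
proof -
  interpret prob_space "normal_law v" by (rule prob_space_normal_law[OF v])
  have pi: "4 \<le> 2 * pi" using pi_ge_two by simp
  have dens: "normal_density 0 (sqrt v) x \<le> 1 / (2 * sqrt v)" for x
  proof -
    have "normal_density 0 (sqrt v) x \<le> 1 / sqrt (2 * pi * v) * 1"
      unfolding normal_density_def using v by (intro mult_mono) (auto simp: field_simps)
    also have "\<dots> \<le> 1 / sqrt (4 * v)"
      using v pi by (auto intro!: divide_left_mono mult_pos_pos)
    finally show ?thesis using v by (simp add: real_sqrt_mult)
  qed
  have "emeasure (normal_law v) {y - \<epsilon>..y + \<epsilon>}
      = (\<integral>\<^sup>+x. ennreal (normal_density 0 (sqrt v) x) * indicator {y - \<epsilon>..y + \<epsilon>} x \<partial>lborel)"
    unfolding normal_law_def by (simp add: emeasure_density)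
  also have "\<dots> \<le> (\<integral>\<^sup>+x. ennreal (1 / (2 * sqrt v)) * indicator {y - \<epsilon>..y + \<epsilon>} x \<partial>lborel)"
    by (intro nn_integral_mono mult_right_mono ennreal_leI dens) auto
  also have "\<dots> = ennreal (1 / (2 * sqrt v)) * ennreal (2 * \<epsilon>)"
    using \<epsilon> by (subst nn_integral_cmult_indicator) auto
  also have "\<dots> = ennreal (\<epsilon> / sqrt v)"
    using v \<epsilon> by (subst ennreal_mult[symmetric]) auto
  finally show ?thesis
    unfolding emeasure_eq_measure using v \<epsilon> by (subst (asm) ennreal_le_iff) auto
qed

lemma divide_sqrt_add_power2_le:
  fixes v \<epsilon> :: real
  assumes v: "0 < v" and \<epsilon>: "0 < \<epsilon>"
  shows "\<epsilon> / sqrt (v + \<epsilon>\<^sup>2) \<le> min \<epsilon> (sqrt v) / sqrt v"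
proof (cases "\<epsilon> \<le> sqrt v")
  case True
  then show ?thesis using v \<epsilon> by (auto intro!: divide_left_mono mult_pos_pos add_pos_pos)
next
  case False
  moreover have "\<epsilon> \<le> sqrt (v + \<epsilon>\<^sup>2)" using v \<epsilon> by (intro real_le_rsqrt) auto
  moreover have "0 < v + \<epsilon>\<^sup>2" using v \<epsilon> by (auto intro!: add_pos_pos)
  ultimately show ?thesis using v by simp
qed

lemma normal_law_interval_ge:
  assumes v: "0 < v" and \<epsilon>: "0 < \<epsilon>"
  shows "\<epsilon> / (4 * sqrt (v + \<epsilon>\<^sup>2)) \<le> measure (normal_law v) {- \<epsilon>..\<epsilon>}"
proof -
  interpret prob_space "normal_law v" by (rule prob_space_normal_law[OF v])
  define t where "t = min \<epsilon> (sqrt v)"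
  have t: "0 < t" "t \<le> \<epsilon>" "t \<le> sqrt v" using v \<epsilon> by (auto simp: t_def)
  have dens: "1 / (8 * sqrt v) \<le> normal_density 0 (sqrt v) x" if "x \<in> {- t..t}" for x
  proof -
    have "\<bar>x\<bar> \<le> sqrt v" using that t by auto
    then have "\<bar>x\<bar>\<^sup>2 \<le> (sqrt v)\<^sup>2" by (intro power_mono) auto
    then have "x\<^sup>2 / (2 * v) \<le> 1/2" using v by (simp add: field_simps)
    then have "1/2 \<le> exp (- x\<^sup>2 / (2 * v))"
      using exp_ge_add_one_self[of "- (x\<^sup>2 / (2 * v))"] by simp
    moreover have "1 / sqrt (16 * v) \<le> 1 / sqrt (2 * pi * v)"
      using v pi_less_4 by (intro divide_left_mono) (auto intro!: mult_pos_pos)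
    ultimately have "1 / sqrt (16 * v) * (1/2) \<le> 1 / sqrt (2 * pi * v) * exp (- x\<^sup>2 / (2 * v))"
      using v by (intro mult_mono) auto
    then show ?thesis using v by (simp add: normal_density_def real_sqrt_mult)
  qed
  have "ennreal (t / (4 * sqrt v)) = ennreal (1 / (8 * sqrt v)) * ennreal (2 * t)"
    using v t by (subst ennreal_mult[symmetric]) auto
  also have "\<dots> = (\<integral>\<^sup>+x. ennreal (1 / (8 * sqrt v)) * indicator {- t..t} x \<partial>lborel)"
    using t by (subst nn_integral_cmult_indicator) auto
  also have "\<dots> \<le> (\<integral>\<^sup>+x. ennreal (normal_density 0 (sqrt v) x) * indicator {- \<epsilon>..\<epsilon>} x \<partial>lborel)"
    using dens t by (intro nn_integral_mono) (auto simp: indicator_def intro!: ennreal_leI)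
  also have "\<dots> = emeasure (normal_law v) {- \<epsilon>..\<epsilon>}"
    unfolding normal_law_def by (simp add: emeasure_density)
  finally have "t / (4 * sqrt v) \<le> measure (normal_law v) {- \<epsilon>..\<epsilon>}"
    unfolding emeasure_eq_measure by (subst (asm) ennreal_le_iff) auto
  moreover have "\<epsilon> / sqrt (v + \<epsilon>\<^sup>2) \<le> t / sqrt v"
    unfolding t_def by (rule divide_sqrt_add_power2_le[OF v \<epsilon>])
  ultimately show ?thesis by simp
qed

definition small :: "real \<Rightarrow> ('d \<Rightarrow> real) \<Rightarrow> ennreal" where
  "small \<epsilon> f = (if \<forall>l. \<bar>f l\<bar> \<le> \<epsilon> then 1 else 0)"

lemma small_le_1: "small \<epsilon> f \<le> 1"
  by (simp add: small_def)

lemma small_uminus: "small \<epsilon> (\<lambda>l. - f l) = small \<epsilon> f"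
  by (simp add: small_def)

lemma borel_measurable_small[measurable]:
  fixes f :: "'a \<Rightarrow> 'd::finite \<Rightarrow> real"
  assumes [measurable]: "\<And>l. (\<lambda>\<omega>. f \<omega> l) \<in> borel_measurable M"
  shows "(\<lambda>\<omega>. small \<epsilon> (f \<omega>)) \<in> borel_measurable M"
  unfolding small_def by measurable

lemma (in finite_product_prob_space) indep_vars_coordinates:
  assumes "I \<noteq> {}"
  shows "indep_vars M (\<lambda>i \<omega>. \<omega> i) I"
proof (subst indep_vars_iff_distr_eq_PiM'[OF assms])
  have "distr (PiM I M) (PiM I M) (\<lambda>\<omega>. \<lambda>i\<in>I. \<omega> i) = distr (PiM I M) (PiM I M) (\<lambda>\<omega>. \<omega>)"
    by (rule distr_cong) (auto simp: space_PiM)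
  also have "\<dots> = (\<Pi>\<^sub>M i\<in>I. distr (PiM I M) (M i) (\<lambda>\<omega>. \<omega> i))"
    unfolding distr_id by (intro PiM_cong refl distr_PiM_component[symmetric] M.prob_space_axioms)
  finally show "distr (PiM I M) (PiM I M) (\<lambda>\<omega>. \<lambda>i\<in>I. \<omega> i) = (\<Pi>\<^sub>M i\<in>I. distr (PiM I M) (M i) (\<lambda>\<omega>. \<omega> i))" .
qed simp

locale white_noise =
  fixes C :: "'c set" and w :: "'c \<Rightarrow> real" and dim :: "'d::finite itself"
  assumes finite_cells: "finite C" and w_pos: "\<And>c. 0 < w c"
begin

sublocale resampling "\<lambda>k::'c \<times> 'd. normal_law (w (fst k))" "C \<times> (UNIV::'d set)"
proof -
  interpret N: prob_space "normal_law (w (fst k))" for k :: "'c \<times> 'd"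
    by (rule prob_space_normal_law[OF w_pos])
  show "resampling (\<lambda>k::'c \<times> 'd. normal_law (w (fst k))) (C \<times> (UNIV::'d set))"
    using finite_cells by unfold_locales auto
qed

definition noise :: "'c set \<Rightarrow> ('c \<times> 'd \<Rightarrow> real) \<Rightarrow> 'd \<Rightarrow> real" where
  "noise S \<omega> l = (\<Sum>c\<in>S. \<omega> (c, l))"

lemma measurable_coordinate[measurable]:
  "c \<in> C \<Longrightarrow> (\<lambda>\<omega>. \<omega> (c, l)) \<in> borel_measurable product_measure"
  using measurable_component_singleton[of "(c, l)" "C \<times> UNIV" "\<lambda>k. normal_law (w (fst k))"] by simp

lemma measurable_noise: "S \<subseteq> C \<Longrightarrow> (\<lambda>\<omega>. noise S \<omega> l) \<in> borel_measurable product_measure"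
  unfolding noise_def by (rule borel_measurable_sum) (rule measurable_coordinate, auto)

lemma noise_empty[simp]: "noise {} \<omega> l = 0"
  by (simp add: noise_def)

lemma noise_split:
  assumes "S \<subseteq> R" "R \<subseteq> C"
  shows "noise R \<omega> l = noise S \<omega> l + noise (R - S) \<omega> l"
  unfolding noise_def
  using assms finite_cells by (metis finite_subset sum.subset_diff add.commute)

lemma noise_mix_disjoint:
  assumes "S \<subseteq> C" "S \<inter> T = {}"
  shows "noise S (mix (T \<times> UNIV) \<omega> \<omega>') = noise S \<omega>"
  using assms unfolding noise_def mix_def by (intro ext sum.cong) auto

lemma noise_mix_subset:
  assumes "S \<subseteq> C" "S \<subseteq> T"
  shows "noise S (mix (T \<times> UNIV) \<omega> \<omega>') = noise S \<omega>'"
  using assms unfolding noise_def mix_def by (intro ext sum.cong) auto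

lemma distr_coordinate:
  assumes "c \<in> C"
  shows "distr product_measure borel (\<lambda>\<omega>. \<omega> (c, l)) = normal_law (w c)"
proof -
  have "distr product_measure borel (\<lambda>\<omega>. \<omega> (c, l)) = distr product_measure (normal_law (w (fst (c, l)))) (\<lambda>\<omega>. \<omega> (c, l))"
    by (rule distr_cong) auto
  also have "\<dots> = normal_law (w (fst (c, l)))"
    using assms by (intro distr_PiM_component) (auto simp: prob_space_normal_law w_pos)
  finally show ?thesis by simp
qed

lemma indep_vars_noise_coordinates:
  assumes "C \<noteq> {}"
  shows "indep_vars (\<lambda>_. borel) (\<lambda>k \<omega>. \<omega> k) (C \<times> (UNIV::'d set))"
  using indep_vars_coordinates assms unfolding indep_vars_def2 by simp

lemma distr_noise:
  assumes S: "S \<subseteq> C" "S \<noteq> {}"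
  shows "distr product_measure borel (\<lambda>\<omega>. noise S \<omega> l) = normal_law (sum w S)"
proof -
  have fin: "finite S" and "C \<noteq> {}" using S finite_cells by (auto intro: finite_subset)
  have reindex: "(\<Sum>k\<in>S \<times> {l}. f k) = (\<Sum>c\<in>S. f (c, l))" for f :: "'c \<times> 'd \<Rightarrow> real"
    by (simp add: sum.cartesian_product')
  have sum_w: "0 < sum w S" by (rule sum_pos[OF fin S(2) w_pos])
  have "distributed product_measure lborel (\<lambda>\<omega>. \<Sum>k\<in>S \<times> {l}. \<omega> k)
    (normal_density (\<Sum>k\<in>S \<times> {l}. 0) (sqrt (\<Sum>k\<in>S \<times> {l}. (sqrt (w (fst k)))\<^sup>2)))"
  proof (rule sum_indep_normal)
    show "indep_vars (\<lambda>_. borel) (\<lambda>k \<omega>. \<omega> k) (S \<times> {l})"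
      by (rule indep_vars_subset[OF indep_vars_noise_coordinates[OF \<open>C \<noteq> {}\<close>]]) (use S in auto)
    fix k assume "k \<in> S \<times> {l}"
    then have "fst k \<in> C" "k = (fst k, l)" using S by auto
    moreover have "distr product_measure lborel (\<lambda>\<omega>. \<omega> k) = distr product_measure borel (\<lambda>\<omega>. \<omega> k)"
      by (rule distr_cong) auto
    ultimately show "distributed product_measure lborel (\<lambda>\<omega>. \<omega> k) (normal_density 0 (sqrt (w (fst k))))"
      using distr_coordinate[of "fst k" l] measurable_coordinate[of "fst k" l]
      unfolding distributed_def normal_law_def by simp
  qed (use S fin w_pos in auto)
  then have "centered_gaussian_rv product_measure (\<lambda>\<omega>. noise S \<omega> l) (sum w S)"
    using sum_w w_pos by (simp add: reindex noise_def centered_gaussian_rv_def less_imp_le)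
  then show ?thesis
    using sum_w by (rule distr_centered_gaussian_rv)
qed

lemma indep_vars_noise:
  assumes "S \<subseteq> C" "C \<noteq> {}"
  shows "indep_vars (\<lambda>_. borel) (\<lambda>l \<omega>. noise S \<omega> l) (UNIV::'d set)"
proof -
  have "indep_vars (\<lambda>l. PiM (S \<times> {l}) (\<lambda>_. borel)) (\<lambda>l \<omega>. restrict (\<lambda>k. \<omega> k) (S \<times> {l})) (UNIV::'d set)"
    using assms by (intro indep_vars_restrict[OF indep_vars_noise_coordinates]) (auto simp: disjoint_family_on_def)
  then have "indep_vars (\<lambda>l. borel) (\<lambda>l \<omega>. (\<lambda>f. \<Sum>c\<in>S. f (c, l)) (restrict (\<lambda>k. \<omega> k) (S \<times> {l}))) (UNIV::'d set)"
    by (rule indep_vars_compose2) simp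
  then show ?thesis
    by (simp add: noise_def cong: sum.cong)
qed

lemma prob_noise:
  assumes S: "S \<subseteq> C" "S \<noteq> {}" and A: "\<And>l. A l \<in> sets borel"
  shows "measure product_measure {\<omega>\<in>space product_measure. \<forall>l. noise S \<omega> l \<in> A l}
    = (\<Prod>l\<in>UNIV. measure (normal_law (sum w S)) (A l))"
proof -
  have C: "C \<noteq> {}" using S by auto
  have "measure (normal_law (sum w S)) (A l) = measure product_measure ((\<lambda>\<omega>. noise S \<omega> l) -` A l \<inter> space product_measure)" for l
    unfolding distr_noise[OF S, of l, symmetric] using measurable_noise[OF S(1)] A by (intro measure_distr) auto
  moreover have "{\<omega>\<in>space product_measure. \<forall>l. noise S \<omega> l \<in> A l}
      = (\<Inter>l\<in>UNIV. (\<lambda>\<omega>. noise S \<omega> l) -` A l \<inter> space product_measure)"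
    by auto
  ultimately show ?thesis
    using indep_varsD_finite[OF indep_vars_noise[OF S(1)], of A] C A by simp
qed

lemma nn_integral_small_noise_eq:
  assumes S: "S \<subseteq> C" "S \<noteq> {}"
  shows "(\<integral>\<^sup>+\<omega>. small \<epsilon> (\<lambda>l. noise S \<omega> l + y l) \<partial>product_measure)
    = ennreal (\<Prod>l\<in>UNIV. measure (normal_law (sum w S)) {- y l - \<epsilon>..- y l + \<epsilon>})"
proof -
  let ?A = "\<lambda>l. {- y l - \<epsilon>..- y l + \<epsilon>}"
  have [measurable]: "(\<lambda>\<omega>. noise S \<omega> l) \<in> borel_measurable product_measure" for l by (rule measurable_noise[OF S(1)])
  have "\<bar>noise S \<omega> l + y l\<bar> \<le> \<epsilon> \<longleftrightarrow> noise S \<omega> l \<in> ?A l" for \<omega> l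
    by auto
  then have "(\<integral>\<^sup>+\<omega>. small \<epsilon> (\<lambda>l. noise S \<omega> l + y l) \<partial>product_measure)
      = (\<integral>\<^sup>+\<omega>. indicator {\<omega>\<in>space product_measure. \<forall>l. noise S \<omega> l \<in> ?A l} \<omega> \<partial>product_measure)"
    by (intro nn_integral_cong) (simp add: small_def indicator_def)
  also have "\<dots> = emeasure product_measure {\<omega>\<in>space product_measure. \<forall>l. noise S \<omega> l \<in> ?A l}"
    by (rule nn_integral_indicator) measurable
  finally show ?thesis
    unfolding emeasure_eq_measure using S by (subst (asm) prob_noise) auto
qed

lemma nn_integral_small_noise_le:
  assumes S: "S \<subseteq> C" and v: "0 < v" "v \<le> sum w S" and \<epsilon>: "0 \<le> \<epsilon>"
  shows "(\<integral>\<^sup>+\<omega>. small \<epsilon> (\<lambda>l. noise S \<omega> l + y l) \<partial>product_measure) \<le> ennreal ((\<epsilon> / sqrt v) ^ CARD('d))"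
proof -
  have "S \<noteq> {}" using v by auto
  then have "(\<integral>\<^sup>+\<omega>. small \<epsilon> (\<lambda>l. noise S \<omega> l + y l) \<partial>product_measure)
      = ennreal (\<Prod>l\<in>UNIV. measure (normal_law (sum w S)) {- y l - \<epsilon>..- y l + \<epsilon>})"
    by (rule nn_integral_small_noise_eq[OF S])
  also have "\<dots> \<le> ennreal (\<Prod>l\<in>(UNIV::'d set). \<epsilon> / sqrt v)"
  proof (intro ennreal_leI prod_mono conjI)
    fix l
    have "measure (normal_law (sum w S)) {- y l - \<epsilon>..- y l + \<epsilon>} \<le> \<epsilon> / sqrt (sum w S)"
      using v \<epsilon> by (intro normal_law_interval_le) auto
    also have "\<dots> \<le> \<epsilon> / sqrt v" using v \<epsilon> by (intro divide_left_mono) (auto intro!: mult_pos_pos)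
    finally show "measure (normal_law (sum w S)) {- y l - \<epsilon>..- y l + \<epsilon>} \<le> \<epsilon> / sqrt v" .
  qed auto
  finally show ?thesis by simp
qed

lemma nn_integral_small_noise_ge:
  assumes S: "S \<subseteq> C" and v: "sum w S \<le> v" and \<epsilon>: "0 < \<epsilon>"
  shows "ennreal ((\<epsilon> / (4 * sqrt (v + \<epsilon>\<^sup>2))) ^ CARD('d)) \<le> (\<integral>\<^sup>+\<omega>. small \<epsilon> (noise S \<omega>) \<partial>product_measure)"
proof (cases "S = {}")
  case True
  have "\<epsilon> \<le> sqrt (v + \<epsilon>\<^sup>2)" using v True \<epsilon> by (intro real_le_rsqrt) auto
  then have "\<epsilon> / (4 * sqrt (v + \<epsilon>\<^sup>2)) \<le> 1" using \<epsilon> by (subst divide_le_eq_1) linarith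
  then have "(\<epsilon> / (4 * sqrt (v + \<epsilon>\<^sup>2))) ^ CARD('d) \<le> 1"
    using \<epsilon> v True by (intro power_le_one) auto
  moreover have "(\<integral>\<^sup>+\<omega>. small \<epsilon> (noise S \<omega>) \<partial>product_measure) = 1"
    using \<epsilon> True emeasure_space_1 by (simp add: small_def)
  ultimately show ?thesis by (simp add: ennreal_le_1)
next
  case False
  have sum_w: "0 < sum w S" using False S finite_cells w_pos by (intro sum_pos) (auto intro: finite_subset)
  have "ennreal (\<Prod>l\<in>(UNIV::'d set). \<epsilon> / (4 * sqrt (v + \<epsilon>\<^sup>2)))
      \<le> ennreal (\<Prod>l\<in>(UNIV::'d set). measure (normal_law (sum w S)) {- \<epsilon>..\<epsilon>})"
  proof (intro ennreal_leI prod_mono conjI)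
    have "\<epsilon> / (4 * sqrt (v + \<epsilon>\<^sup>2)) \<le> \<epsilon> / (4 * sqrt (sum w S + \<epsilon>\<^sup>2))"
      using v \<epsilon> sum_w by (intro divide_left_mono) (auto intro!: mult_pos_pos add_pos_pos)
    also have "\<dots> \<le> measure (normal_law (sum w S)) {- \<epsilon>..\<epsilon>}"
      by (rule normal_law_interval_ge[OF sum_w \<epsilon>])
    finally show "\<epsilon> / (4 * sqrt (v + \<epsilon>\<^sup>2)) \<le> measure (normal_law (sum w S)) {- \<epsilon>..\<epsilon>}" .
  qed (use \<epsilon> v sum_w in auto)
  also have "\<dots> = (\<integral>\<^sup>+\<omega>. small \<epsilon> (noise S \<omega>) \<partial>product_measure)"
    using nn_integral_small_noise_eq[OF S False, of \<epsilon> "\<lambda>_. 0"] by simp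
  finally show ?thesis by simp
qed

lemma nn_integral_mult_small_noise_le:
  assumes S: "S \<subseteq> C" and v: "0 < v" "v \<le> sum w S" and \<epsilon>: "0 \<le> \<epsilon>"
    and [measurable]: "g \<in> borel_measurable product_measure" "\<And>l. (\<lambda>\<omega>. y \<omega> l) \<in> borel_measurable product_measure"
    and indep: "\<And>\<omega> \<omega>'. g (mix (S \<times> UNIV) \<omega> \<omega>') = g \<omega>" "\<And>\<omega> \<omega>'. y (mix (S \<times> UNIV) \<omega> \<omega>') = y \<omega>"
  shows "(\<integral>\<^sup>+\<omega>. g \<omega> * small \<epsilon> (\<lambda>l. noise S \<omega> l + y \<omega> l) \<partial>product_measure)
    \<le> ennreal ((\<epsilon> / sqrt v) ^ CARD('d)) * (\<integral>\<^sup>+\<omega>. g \<omega> \<partial>product_measure)"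
proof -
  have [measurable]: "(\<lambda>\<omega>. noise S \<omega> l) \<in> borel_measurable product_measure" for l by (rule measurable_noise[OF S])
  let ?f = "\<lambda>\<omega>. small \<epsilon> (\<lambda>l. noise S \<omega> l + y \<omega> l)"
  have "(\<integral>\<^sup>+\<omega>. g \<omega> * ?f \<omega> \<partial>product_measure) = (\<integral>\<^sup>+\<omega>. g \<omega> * resample (S \<times> UNIV) ?f \<omega> \<partial>product_measure)"
    using indep(1) by (intro nn_integral_resample_mult[symmetric]) auto
  also have "\<dots> \<le> (\<integral>\<^sup>+\<omega>. g \<omega> * ennreal ((\<epsilon> / sqrt v) ^ CARD('d)) \<partial>product_measure)"
    unfolding resample_def noise_mix_subset[OF S order_refl] indep(2)
    by (intro nn_integral_mono mult_left_mono nn_integral_small_noise_le[OF S v \<epsilon>]) simp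
  also have "\<dots> = ennreal ((\<epsilon> / sqrt v) ^ CARD('d)) * (\<integral>\<^sup>+\<omega>. g \<omega> \<partial>product_measure)"
    by (subst nn_integral_multc) (simp_all add: mult.commute)
  finally show ?thesis .
qed

lemma nn_integral_small_noise_diff_le:
  assumes S: "S \<subseteq> C" "T \<subseteq> C" "S \<inter> T = {}" and \<epsilon>: "0 < \<epsilon>"
    and \<kappa>: "0 \<le> \<kappa>" "\<kappa> \<le> sum w S"
  shows "(\<integral>\<^sup>+\<omega>. small (2 * \<epsilon>) (\<lambda>l. noise S \<omega> l - noise T \<omega> l) \<partial>product_measure)
    \<le> ennreal ((4 * \<epsilon> / sqrt (\<kappa> + \<epsilon>\<^sup>2)) ^ CARD('d))"
proof (cases "\<kappa> \<le> \<epsilon>\<^sup>2")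
  case True
  have "sqrt (\<kappa> + \<epsilon>\<^sup>2) \<le> 4 * \<epsilon>"
    using True \<epsilon> by (intro real_le_lsqrt) (auto simp: power_mult_distrib intro: order_trans[of _ "\<epsilon>\<^sup>2"])
  then have "1 \<le> (4 * \<epsilon> / sqrt (\<kappa> + \<epsilon>\<^sup>2)) ^ CARD('d)"
    using \<epsilon> \<kappa>(1) by (intro one_le_power) (simp add: add_nonneg_pos le_divide_eq_1_pos)
  then have "1 \<le> ennreal ((4 * \<epsilon> / sqrt (\<kappa> + \<epsilon>\<^sup>2)) ^ CARD('d))"
    by (simp add: ennreal_ge_1)
  moreover have "(\<integral>\<^sup>+\<omega>. small (2 * \<epsilon>) (\<lambda>l. noise S \<omega> l - noise T \<omega> l) \<partial>product_measure) \<le> (\<integral>\<^sup>+\<omega>. 1 \<partial>product_measure)"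
    by (intro nn_integral_mono small_le_1)
  ultimately show ?thesis using emeasure_space_1 by (auto intro: order_trans)
next
  case False
  then have \<kappa>_pos: "0 < \<kappa>" using \<epsilon> by (smt (verit) zero_le_power2)
  have "(\<integral>\<^sup>+\<omega>. 1 * small (2 * \<epsilon>) (\<lambda>l. noise S \<omega> l + - noise T \<omega> l) \<partial>product_measure)
      \<le> ennreal ((2 * \<epsilon> / sqrt \<kappa>) ^ CARD('d)) * (\<integral>\<^sup>+\<omega>. 1 \<partial>product_measure)"
    using \<epsilon> \<kappa>(2) \<kappa>_pos S by (intro nn_integral_mult_small_noise_le) (auto simp: noise_mix_disjoint Int_commute measurable_noise)
  also have "\<dots> \<le> ennreal ((4 * \<epsilon> / sqrt (\<kappa> + \<epsilon>\<^sup>2)) ^ CARD('d))"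
  proof -
    have "sqrt (\<kappa> + \<epsilon>\<^sup>2) \<le> 2 * sqrt \<kappa>"
      using False \<kappa>_pos by (intro real_le_lsqrt) (auto simp: power_mult_distrib)
    then have "4 * \<epsilon> / (2 * sqrt \<kappa>) \<le> 4 * \<epsilon> / sqrt (\<kappa> + \<epsilon>\<^sup>2)"
      using \<kappa>_pos \<epsilon> by (intro divide_left_mono) (auto intro!: mult_pos_pos add_pos_pos)
    then show ?thesis
      using \<epsilon> \<kappa>_pos emeasure_space_1 by (auto intro!: ennreal_leI power_mono)
  qed
  finally show ?thesis by simp
qed

lemma nn_integral_small_noise_diff_le_either:
  assumes S: "S \<subseteq> C" "T \<subseteq> C" "S \<inter> T = {}" and \<epsilon>: "0 < \<epsilon>"
    and \<kappa>: "0 \<le> \<kappa>" "\<kappa> \<le> sum w S \<or> \<kappa> \<le> sum w T"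
  shows "(\<integral>\<^sup>+\<omega>. small (2 * \<epsilon>) (\<lambda>l. noise S \<omega> l - noise T \<omega> l) \<partial>product_measure)
    \<le> ennreal ((4 * \<epsilon> / sqrt (\<kappa> + \<epsilon>\<^sup>2)) ^ CARD('d))"
  using \<kappa>(2)
proof
  assume "\<kappa> \<le> sum w S"
  with S \<epsilon> \<kappa>(1) show ?thesis by (rule nn_integral_small_noise_diff_le)
next
  assume "\<kappa> \<le> sum w T"
  moreover have "small (2 * \<epsilon>) (\<lambda>l. noise S \<omega> l - noise T \<omega> l) = small (2 * \<epsilon>) (\<lambda>l. noise T \<omega> l - noise S \<omega> l)" for \<omega>
    using small_uminus[of "2 * \<epsilon>" "\<lambda>l. noise T \<omega> l - noise S \<omega> l"] by simp
  ultimately show ?thesis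
    using S \<epsilon> \<kappa>(1) by (simp only:) (intro nn_integral_small_noise_diff_le, auto)
qed

text \<open>Average first over the common part of the two regions, then over the larger one of the two differences.\<close>

theorem nn_integral_small_noise_pair_le:
  assumes R: "R \<subseteq> C" "R' \<subseteq> C" and \<alpha>: "0 < \<alpha>" "\<alpha> \<le> sum w (R \<inter> R')" and \<epsilon>: "0 < \<epsilon>"
    and \<kappa>: "0 \<le> \<kappa>" "\<kappa> \<le> sum w (R - R') \<or> \<kappa> \<le> sum w (R' - R)"
  shows "(\<integral>\<^sup>+\<omega>. small \<epsilon> (noise R \<omega>) * small \<epsilon> (noise R' \<omega>) \<partial>product_measure)
    \<le> ennreal ((\<epsilon> / sqrt \<alpha>) ^ CARD('d) * (4 * \<epsilon> / sqrt (\<kappa> + \<epsilon>\<^sup>2)) ^ CARD('d))"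
proof -
  let ?D = "\<lambda>\<omega>. small (2 * \<epsilon>) (\<lambda>l. noise (R - R') \<omega> l - noise (R' - R) \<omega> l)"
  have sub: "R \<inter> R' \<subseteq> C" "R - R' \<subseteq> C" "R' - R \<subseteq> C" using R by auto
  have [measurable]: "(\<lambda>\<omega>. noise (R - R') \<omega> l) \<in> borel_measurable product_measure"
      "(\<lambda>\<omega>. noise (R' - R) \<omega> l) \<in> borel_measurable product_measure" for l
    using measurable_noise sub by auto
  have split: "noise R \<omega> l = noise (R \<inter> R') \<omega> l + noise (R - R') \<omega> l"
      "noise R' \<omega> l = noise (R \<inter> R') \<omega> l + noise (R' - R) \<omega> l" for \<omega> l
    using noise_split[of "R \<inter> R'" R \<omega> l] noise_split[of "R \<inter> R'" R' \<omega> l] R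
    by (simp_all add: Diff_Int)
  have D: "(\<integral>\<^sup>+\<omega>. ?D \<omega> \<partial>product_measure) \<le> ennreal ((4 * \<epsilon> / sqrt (\<kappa> + \<epsilon>\<^sup>2)) ^ CARD('d))"
    by (rule nn_integral_small_noise_diff_le_either[OF sub(2,3) _ \<epsilon> \<kappa>]) auto
  have "small \<epsilon> (noise R \<omega>) * small \<epsilon> (noise R' \<omega>)
      \<le> ?D \<omega> * small \<epsilon> (\<lambda>l. noise (R \<inter> R') \<omega> l + noise (R - R') \<omega> l)" for \<omega>
  proof -
    have "\<bar>noise (R - R') \<omega> l - noise (R' - R) \<omega> l\<bar> \<le> 2 * \<epsilon>" if "\<bar>noise R \<omega> l\<bar> \<le> \<epsilon>" "\<bar>noise R' \<omega> l\<bar> \<le> \<epsilon>" for l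
      using that split[of \<omega> l] by (simp add: abs_le_iff)
    then show ?thesis by (auto simp: small_def split(1)[symmetric])
  qed
  then have "(\<integral>\<^sup>+\<omega>. small \<epsilon> (noise R \<omega>) * small \<epsilon> (noise R' \<omega>) \<partial>product_measure)
      \<le> (\<integral>\<^sup>+\<omega>. ?D \<omega> * small \<epsilon> (\<lambda>l. noise (R \<inter> R') \<omega> l + noise (R - R') \<omega> l) \<partial>product_measure)"
    by (intro nn_integral_mono)
  also have "\<dots> \<le> ennreal ((\<epsilon> / sqrt \<alpha>) ^ CARD('d)) * (\<integral>\<^sup>+\<omega>. ?D \<omega> \<partial>product_measure)"
  proof (rule nn_integral_mult_small_noise_le[OF sub(1) \<alpha>])
    have "noise (R - R') (mix ((R \<inter> R') \<times> UNIV) \<omega> \<omega>') = noise (R - R') \<omega>"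
        "noise (R' - R) (mix ((R \<inter> R') \<times> UNIV) \<omega> \<omega>') = noise (R' - R) \<omega>" for \<omega> \<omega>'
      by (intro noise_mix_disjoint sub; auto)+
    then show "?D (mix ((R \<inter> R') \<times> UNIV) \<omega> \<omega>') = ?D \<omega>"
        "noise (R - R') (mix ((R \<inter> R') \<times> UNIV) \<omega> \<omega>') = noise (R - R') \<omega>" for \<omega> \<omega>'
      by simp_all
  qed (use \<epsilon> in auto)
  also have "\<dots> \<le> ennreal ((\<epsilon> / sqrt \<alpha>) ^ CARD('d)) * ennreal ((4 * \<epsilon> / sqrt (\<kappa> + \<epsilon>\<^sup>2)) ^ CARD('d))"
    by (intro mult_left_mono D) simp
  also have "\<dots> = ennreal ((\<epsilon> / sqrt \<alpha>) ^ CARD('d) * (4 * \<epsilon> / sqrt (\<kappa> + \<epsilon>\<^sup>2)) ^ CARD('d))"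
    using \<epsilon> \<alpha> \<kappa> by (subst ennreal_mult[symmetric]) auto
  finally show ?thesis .
qed

end

subsection \<open>Lattice sums and the Riesz kernel\<close>

text \<open>The value at 0 is junk, unlike that of \<^const>\<open>riesz_kernel\<close>.\<close>

definition riesz_fun :: "real \<Rightarrow> real \<Rightarrow> real" where
  "riesz_fun \<beta> a = (if \<beta> < 0 then 1 else if \<beta> = 0 then max 0 (ln (1 / a)) else a powr (- \<beta>))"

lemma riesz_fun_nonneg: "0 \<le> riesz_fun \<beta> a"
  by (simp add: riesz_fun_def)

lemma riesz_kernel_eq:
  "riesz_kernel \<beta> r = (if 0 \<le> \<beta> \<and> r = 0 then \<top> else ennreal (riesz_fun \<beta> \<bar>r\<bar>))"
  by (auto simp: riesz_kernel_def riesz_fun_def)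

lemma borel_measurable_riesz_fun[measurable]: "riesz_fun \<beta> \<in> borel_measurable borel"
  unfolding riesz_fun_def[abs_def] by measurable

lemma borel_measurable_riesz_kernel[measurable]: "riesz_kernel \<beta> \<in> borel_measurable borel"
  unfolding riesz_kernel_def[abs_def] by measurable

lemma riesz_fun_antimono: "0 < a \<Longrightarrow> a \<le> a' \<Longrightarrow> riesz_fun \<beta> a' \<le> riesz_fun \<beta> a"
  using ln_mono[of a a'] by (auto simp: riesz_fun_def ln_div max_def intro!: powr_mono2')

lemma riesz_fun_divide_le:
  assumes c: "1 \<le> c"
  obtains C where "0 \<le> C" "\<And>a. 0 < a \<Longrightarrow> riesz_fun \<beta> (a / c) \<le> C * (1 + riesz_fun \<beta> a)"
proof
  define C where "C = 1 + ln c + c powr \<beta>"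
  have ln_c: "0 \<le> ln c" using c by simp
  then have C: "1 \<le> C" "ln c \<le> C" "c powr \<beta> \<le> C" by (simp_all add: C_def)
  show "0 \<le> C" using C(1) by simp
  fix a :: real assume a: "0 < a"
  note nonneg = riesz_fun_nonneg[of \<beta> a]
  consider "\<beta> < 0" | "\<beta> = 0" | "0 < \<beta>" by linarith
  then show "riesz_fun \<beta> (a / c) \<le> C * (1 + riesz_fun \<beta> a)"
  proof cases
    case 1
    then show ?thesis using C(1) by (simp add: riesz_fun_def)
  next
    case 2
    then have "riesz_fun \<beta> (a / c) \<le> ln c + riesz_fun \<beta> a"
      using a c ln_c by (auto simp: riesz_fun_def ln_div max_def)
    also have "\<dots> \<le> C + C * riesz_fun \<beta> a"
      using C nonneg mult_right_mono[of 1 C "riesz_fun \<beta> a"] by (intro add_mono) auto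
    finally show ?thesis by (simp add: distrib_left)
  next
    case 3
    then have "riesz_fun \<beta> (a / c) = c powr \<beta> * riesz_fun \<beta> a"
      using a c by (simp add: riesz_fun_def powr_divide powr_minus field_simps)
    also have "\<dots> \<le> C * (1 + riesz_fun \<beta> a)"
      using C nonneg by (intro mult_mono) auto
    finally show ?thesis .
  qed
qed

definition power_primitive :: "real \<Rightarrow> real \<Rightarrow> real" where
  "power_primitive p y = (if p = 1 then ln y else y powr (1 - p) / (1 - p))"

lemma DERIV_power_primitive:
  assumes "0 < y"
  shows "(power_primitive p has_real_derivative y powr (- p)) (at y)"
proof (cases "p = 1")
  case True
  then show ?thesis
    using assms unfolding power_primitive_def[abs_def]
    by (auto intro!: derivative_eq_intros simp: powr_minus divide_inverse)
next
  case False
  have "((\<lambda>y. y powr (1 - p) / (1 - p)) has_real_derivative y powr (- p)) (at y)"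
    using DERIV_cdivide[OF has_real_derivative_powr[OF assms, of "1 - p"], of "1 - p"] False by simp
  then show ?thesis using False unfolding power_primitive_def[abs_def] by simp
qed

lemma power_primitive_step:
  assumes y: "0 < y" and h: "0 < h" and p: "0 \<le> p"
  shows "power_primitive p (y + h) - power_primitive p y \<le> h * y powr (- p)"
    and "h * (y + h) powr (- p) \<le> power_primitive p (y + h) - power_primitive p y"
proof -
  have "\<exists>z>y. z < y + h \<and> power_primitive p (y + h) - power_primitive p y = (y + h - y) * z powr (- p)"
    using y h by (intro MVT2 DERIV_power_primitive) auto
  then obtain z where z: "y < z" "z < y + h" "power_primitive p (y + h) - power_primitive p y = h * z powr (- p)" by auto
  show "power_primitive p (y + h) - power_primitive p y \<le> h * y powr (- p)"
    unfolding z(3) using y h p z by (intro mult_left_mono powr_mono2') auto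
  show "h * (y + h) powr (- p) \<le> power_primitive p (y + h) - power_primitive p y"
    unfolding z(3) using y h p z by (intro mult_left_mono powr_mono2') auto
qed

lemma sum_powr_ge:
  assumes a: "0 < a" and h: "0 < h" and p: "0 \<le> p"
  shows "power_primitive p (a + real N * h) - power_primitive p a \<le> (\<Sum>k<N. h * (a + real k * h) powr (- p))"
proof (induction N)
  case (Suc N)
  have "0 < a + real N * h" using a h by (simp add: add_pos_nonneg)
  from power_primitive_step(1)[OF this h p] Suc show ?case by (simp add: algebra_simps)
qed simp

lemma sum_powr_le:
  assumes a: "0 < a" and h: "0 < h" "h \<le> a" and p: "0 \<le> p"
  shows "(\<Sum>k<N. h * (a + real k * h) powr (- p)) \<le> 2 powr p * (power_primitive p (a + real N * h) - power_primitive p a)"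
proof (induction N)
  case (Suc N)
  let ?y = "a + real N * h"
  have y: "0 < ?y" "h \<le> ?y" using a h by (auto simp: add_pos_nonneg add_increasing2)
  have "?y + h \<le> ?y + ?y" using y(2) by (rule add_left_mono)
  then have "(2 * ?y) powr (- p) \<le> (?y + h) powr (- p)"
    using y h p by (intro powr_mono2') (simp_all only: mult_2 neg_le_0_iff_le add_pos_pos)
  then have "2 powr p * (2 * ?y) powr (- p) \<le> 2 powr p * (?y + h) powr (- p)" by (intro mult_left_mono) auto
  moreover have zz: "2 powr p * (2 * z) powr (- p) = z powr (- p)" if "0 < z" for z :: real
    using that by (simp add: powr_mult powr_minus)
  ultimately have "?y powr (- p) \<le> 2 powr p * (?y + h) powr (- p)" by (simp only: zz[OF y(1)])
  then have "h * ?y powr (- p) \<le> h * (2 powr p * (?y + h) powr (- p))" using h by (intro mult_left_mono) auto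
  also have "\<dots> = 2 powr p * (h * (?y + h) powr (- p))" by (rule mult.left_commute)
  also have "\<dots> \<le> 2 powr p * (power_primitive p (?y + h) - power_primitive p ?y)"
    using power_primitive_step(2)[OF y(1) h(1) p] by (intro mult_left_mono) auto
  finally show ?case using Suc by (simp add: algebra_simps)
qed simp

definition primitive_increment :: "real \<Rightarrow> real \<Rightarrow> real \<Rightarrow> real" where
  "primitive_increment p U a = power_primitive p (a + U) - power_primitive p a"

lemma primitive_increment_nonneg:
  assumes "0 < a" "0 < U" "0 \<le> p"
  shows "0 \<le> primitive_increment p U a"
proof -
  have "0 \<le> U * (a + U) powr (- p)" using assms by simp
  then show ?thesis
    using power_primitive_step(2)[OF assms] unfolding primitive_increment_def by linarith
qed

lemma primitive_increment_gt_1: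
  assumes "1 < p"
  shows "primitive_increment p U a = (a powr (1 - p) - (a + U) powr (1 - p)) / (p - 1)"
proof -
  have "y / (1 - p) = - (y / (p - 1))" for y
    by (metis divide_minus_right minus_diff_eq)
  then show ?thesis
    using assms by (simp add: primitive_increment_def power_primitive_def diff_divide_distrib)
qed

definition lattice_kernel :: "real \<Rightarrow> real \<Rightarrow> nat \<Rightarrow> real \<Rightarrow> real" where
  "lattice_kernel p U N a = (\<Sum>j<N. \<Sum>k<N. (a + (real j + real k) * (U / real N)) powr (- p)) / (real N)\<^sup>2"

lemma lattice_kernel_nonneg: "0 \<le> lattice_kernel p U N a"
  unfolding lattice_kernel_def by (intro divide_nonneg_nonneg sum_nonneg) auto

lemma lattice_kernel_eq_iterated_sum:
  assumes "0 < N" "h = U / real N"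
  shows "U\<^sup>2 * lattice_kernel p U N a = (\<Sum>j<N. h * (\<Sum>k<N. h * ((a + real j * h) + real k * h) powr (- p)))"
proof -
  have "U\<^sup>2 * lattice_kernel p U N a = h\<^sup>2 * (\<Sum>j<N. \<Sum>k<N. (a + (real j + real k) * h) powr (- p))"
    using assms by (simp add: lattice_kernel_def power_divide)
  also have "\<dots> = (\<Sum>j<N. \<Sum>k<N. h * (h * (a + (real j + real k) * h) powr (- p)))"
    by (simp add: sum_distrib_left power2_eq_square mult.assoc)
  finally show ?thesis
    by (simp add: sum_distrib_left algebra_simps)
qed

text \<open>Summing out one index turns the exponent \<open>p\<close> into \<open>p - 1\<close>, up to the contribution of the far end \<open>U\<close>.\<close>

lemma primitive_increment_le_lattice_kernel:
  assumes p: "1 < p" and U: "0 < U" and N: "0 < N" and a: "0 < a"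
  shows "primitive_increment (p - 1) U a \<le> (p - 1) * U\<^sup>2 * lattice_kernel p U N a + U powr (2 - p)"
proof -
  define h where "h = U / real N"
  have h: "0 < h" "real N * h = U" using U N by (auto simp: h_def)
  have row: "((a + real j * h) powr (1 - p) - U powr (1 - p)) / (p - 1)
      \<le> (\<Sum>k<N. h * ((a + real j * h) + real k * h) powr (- p))" for j :: nat
  proof -
    have pos: "0 < a + real j * h" using a h by (simp add: add_pos_nonneg)
    have "(a + real j * h + U) powr (1 - p) \<le> U powr (1 - p)" using pos U p by (intro powr_mono2') auto
    then have "((a + real j * h) powr (1 - p) - U powr (1 - p)) / (p - 1) \<le> primitive_increment p U (a + real j * h)"
      unfolding primitive_increment_gt_1[OF p] using p by (intro divide_right_mono) auto
    also have "\<dots> \<le> (\<Sum>k<N. h * ((a + real j * h) + real k * h) powr (- p))"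
      using sum_powr_ge[OF pos h(1), of p N] p h(2) by (simp add: primitive_increment_def)
    finally show ?thesis .
  qed
  have "primitive_increment (p - 1) U a \<le> (\<Sum>j<N. h * (a + real j * h) powr (- (p - 1)))"
    using sum_powr_ge[OF a h(1), of "p - 1" N] p h(2) by (simp add: primitive_increment_def)
  also have "\<dots> = (\<Sum>j<N. h * ((a + real j * h) powr (1 - p) - U powr (1 - p))) + real N * h * U powr (1 - p)"
    by (simp add: sum_distrib_left sum_subtractf right_diff_distrib)
  also have "real N * h * U powr (1 - p) = U powr (2 - p)"
    unfolding h(2) using U powr_add[of U 1 "1 - p"] by simp
  also have "(\<Sum>j<N. h * ((a + real j * h) powr (1 - p) - U powr (1 - p)))
      = (p - 1) * (\<Sum>j<N. h * (((a + real j * h) powr (1 - p) - U powr (1 - p)) / (p - 1)))"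
    using p by (simp add: sum_distrib_left)
  also have "\<dots> \<le> (p - 1) * (\<Sum>j<N. h * (\<Sum>k<N. h * ((a + real j * h) + real k * h) powr (- p)))"
    using p h row by (intro mult_left_mono sum_mono) auto
  also have "\<dots> = (p - 1) * U\<^sup>2 * lattice_kernel p U N a"
    using lattice_kernel_eq_iterated_sum[OF N h_def] by simp
  finally show ?thesis by simp
qed

lemma lattice_kernel_le_primitive_increment:
  assumes p: "1 < p" and U: "0 < U" and N: "0 < N" and a: "0 < a" "U / real N \<le> a"
  shows "U\<^sup>2 * lattice_kernel p U N a \<le> 2 powr p / (p - 1) * 2 powr (p - 1) * primitive_increment (p - 1) U a"
proof -
  define h where "h = U / real N"
  have h: "0 < h" "real N * h = U" "h \<le> a" using U N a by (auto simp: h_def)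
  have row: "(\<Sum>k<N. h * ((a + real j * h) + real k * h) powr (- p))
      \<le> 2 powr p / (p - 1) * (a + real j * h) powr (- (p - 1))" for j :: nat
  proof -
    have pos: "0 < a + real j * h" "h \<le> a + real j * h" using a h by (auto simp: add_pos_nonneg add_increasing2)
    have "(\<Sum>k<N. h * ((a + real j * h) + real k * h) powr (- p)) \<le> 2 powr p * primitive_increment p U (a + real j * h)"
      using sum_powr_le[OF pos(1) h(1) pos(2), of p N] p h(2) by (simp add: primitive_increment_def)
    also have "\<dots> \<le> 2 powr p * ((a + real j * h) powr (1 - p) / (p - 1))"
      using p unfolding primitive_increment_gt_1[OF p] by (intro mult_left_mono divide_right_mono) auto
    finally show ?thesis by simp
  qed
  have "U\<^sup>2 * lattice_kernel p U N a \<le> (\<Sum>j<N. h * (2 powr p / (p - 1) * (a + real j * h) powr (- (p - 1))))"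
    unfolding lattice_kernel_eq_iterated_sum[OF N h_def] using h row by (intro sum_mono mult_left_mono) auto
  also have "\<dots> = 2 powr p / (p - 1) * (\<Sum>j<N. h * (a + real j * h) powr (- (p - 1)))"
    by (simp add: sum_distrib_left mult.left_commute)
  also have "\<dots> \<le> 2 powr p / (p - 1) * (2 powr (p - 1) * primitive_increment (p - 1) U a)"
    using sum_powr_le[OF a(1) h(1,3), of "p - 1" N] p h(2) by (intro mult_left_mono) (auto simp: primitive_increment_def)
  finally show ?thesis by (simp only: mult.assoc)
qed

lemma riesz_fun_le_primitive_increment:
  assumes \<beta>: "0 \<le> \<beta>" and U: "0 < U"
  obtains C where "0 \<le> C" "\<And>a. 0 < a \<Longrightarrow> riesz_fun \<beta> a \<le> C * (1 + primitive_increment (\<beta> + 1) U a)"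
proof (cases "\<beta> = 0")
  case True
  show ?thesis
  proof (rule that[of "1 + \<bar>ln U\<bar>"])
    fix a :: real assume a: "0 < a"
    let ?V = "primitive_increment (\<beta> + 1) U a"
    have V: "0 \<le> ?V" "?V = ln (a + U) - ln a"
      using primitive_increment_nonneg[OF a U, of "\<beta> + 1"] True
      by (simp_all add: primitive_increment_def power_primitive_def)
    have "ln U \<le> ln (a + U)" using a U by simp
    then have "riesz_fun \<beta> a \<le> ?V + \<bar>ln U\<bar>"
      using True V a by (simp add: riesz_fun_def ln_div)
    also have "\<dots> \<le> (1 + \<bar>ln U\<bar>) * (1 + ?V)"
      using V(1) by (simp add: distrib_left distrib_right)
    finally show "riesz_fun \<beta> a \<le> (1 + \<bar>ln U\<bar>) * (1 + ?V)" .
  qed simp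
next
  case False
  then have \<beta>_pos: "0 < \<beta>" using \<beta> by simp
  show ?thesis
  proof (rule that[of "\<beta> + U powr (- \<beta>)"])
    fix a :: real assume a: "0 < a"
    let ?V = "primitive_increment (\<beta> + 1) U a"
    have V: "0 \<le> ?V" "?V = (a powr (- \<beta>) - (a + U) powr (- \<beta>)) / \<beta>"
      using primitive_increment_nonneg[OF a U, of "\<beta> + 1"] \<beta>_pos by (simp_all add: primitive_increment_gt_1)
    have "riesz_fun \<beta> a = \<beta> * ?V + (a + U) powr (- \<beta>)"
      unfolding V(2) using \<beta>_pos by (simp add: riesz_fun_def)
    also have "\<dots> \<le> \<beta> * ?V + U powr (- \<beta>)"
      using a U \<beta>_pos by (intro add_left_mono powr_mono2') auto
    also have "\<dots> \<le> (\<beta> + U powr (- \<beta>)) * (1 + ?V)"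
      using V(1) \<beta>_pos by (simp add: distrib_left distrib_right)
    finally show "riesz_fun \<beta> a \<le> (\<beta> + U powr (- \<beta>)) * (1 + ?V)" .
  qed (use \<beta>_pos in simp)
qed

lemma primitive_increment_le_riesz_fun_of_neg:
  assumes \<beta>: "\<beta> < 0" and U: "0 < U"
  obtains C where "0 \<le> C" "\<And>a. 0 < a \<Longrightarrow> a \<le> A \<Longrightarrow> primitive_increment (\<beta> + 1) U a \<le> C * (1 + riesz_fun \<beta> a)"
proof -
  define C where "C = (\<bar>A\<bar> + U) powr (- \<beta>) / (- \<beta>)"
  have C: "0 \<le> C" using \<beta> by (simp add: C_def divide_nonneg_nonpos)
  show ?thesis
  proof (rule that[OF C])
    fix a :: real assume a: "0 < a" "a \<le> A"
    have "primitive_increment (\<beta> + 1) U a \<le> (a + U) powr (- \<beta>) / (- \<beta>)"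
      using \<beta> by (simp add: primitive_increment_def power_primitive_def divide_nonneg_nonpos)
    also have "\<dots> \<le> C" unfolding C_def using \<beta> a U by (intro divide_right_mono powr_mono2) auto
    also have "\<dots> \<le> C * (1 + riesz_fun \<beta> a)"
      using C riesz_fun_nonneg by (simp add: distrib_left)
    finally show "primitive_increment (\<beta> + 1) U a \<le> C * (1 + riesz_fun \<beta> a)" .
  qed
qed

lemma primitive_increment_le_riesz_fun:
  assumes \<beta>: "-1 < \<beta>" and U: "0 < U"
  obtains C where "0 \<le> C" "\<And>a. 0 < a \<Longrightarrow> a \<le> A \<Longrightarrow> primitive_increment (\<beta> + 1) U a \<le> C * (1 + riesz_fun \<beta> a)"
proof -
  consider "\<beta> < 0" | "\<beta> = 0" | "0 < \<beta>" by linarith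
  then show ?thesis
  proof cases
    case 1
    then show ?thesis by (rule primitive_increment_le_riesz_fun_of_neg[OF _ U]) (rule that)
  next
    case 2
    let ?C = "1 + \<bar>ln (\<bar>A\<bar> + U)\<bar>"
    show ?thesis
    proof (rule that[of ?C])
      fix a :: real assume a: "0 < a" "a \<le> A"
      have "ln (a + U) \<le> ln (\<bar>A\<bar> + U)" using a U by simp
      moreover have "- ln a \<le> riesz_fun \<beta> a" using a 2 by (simp add: riesz_fun_def ln_div)
      ultimately have "primitive_increment (\<beta> + 1) U a \<le> \<bar>ln (\<bar>A\<bar> + U)\<bar> + riesz_fun \<beta> a"
        using 2 by (simp add: primitive_increment_def power_primitive_def)
      also have "\<dots> \<le> ?C * (1 + riesz_fun \<beta> a)"
        using riesz_fun_nonneg[of \<beta> a] by (simp add: distrib_left distrib_right)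
      finally show "primitive_increment (\<beta> + 1) U a \<le> ?C * (1 + riesz_fun \<beta> a)" .
    qed simp
  next
    case 3
    show ?thesis
    proof (rule that[of "1 / \<beta>"])
      fix a :: real
      have "primitive_increment (\<beta> + 1) U a \<le> 1 / \<beta> * riesz_fun \<beta> a"
        using 3 by (simp add: primitive_increment_gt_1 riesz_fun_def divide_right_mono)
      also have "\<dots> \<le> 1 / \<beta> * (1 + riesz_fun \<beta> a)" using 3 by (intro mult_left_mono) auto
      finally show "primitive_increment (\<beta> + 1) U a \<le> 1 / \<beta> * (1 + riesz_fun \<beta> a)" .
    qed (use 3 in simp)
  qed
qed

theorem riesz_fun_le_lattice_kernel:
  assumes U: "0 < U"
  obtains C where "0 \<le> C" "\<And>N a. 0 < N \<Longrightarrow> 0 < a \<Longrightarrow> riesz_fun (p - 2) a \<le> C * (1 + lattice_kernel p U N a)"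
proof (cases "p < 2")
  case True
  then show ?thesis
    using that[of 1] lattice_kernel_nonneg by (simp add: riesz_fun_def)
next
  case False
  define D where "D = 1 + (p - 1) * U\<^sup>2 + U powr (2 - p)"
  have "0 \<le> p - 2" using False by simp
  then obtain C where C: "0 \<le> C"
    "\<And>a. 0 < a \<Longrightarrow> riesz_fun (p - 2) a \<le> C * (1 + primitive_increment (p - 2 + 1) U a)"
    by (rule riesz_fun_le_primitive_increment[OF _ U]) (rule that)
  show ?thesis
  proof (rule that[of "C * D"])
    show "0 \<le> C * D" using C(1) False by (simp add: D_def)
    fix N :: nat and a :: real assume N: "0 < N" and a: "0 < a"
    have "riesz_fun (p - 2) a \<le> C * (1 + primitive_increment (p - 1) U a)"
      using C(2)[OF a] by simp
    also have "\<dots> \<le> C * (1 + ((p - 1) * U\<^sup>2 * lattice_kernel p U N a + U powr (2 - p)))"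
      using False U N a C(1) by (intro mult_left_mono add_left_mono primitive_increment_le_lattice_kernel) auto
    also have "\<dots> \<le> C * (D * (1 + lattice_kernel p U N a))"
      using C(1) False lattice_kernel_nonneg[of p U N a]
      by (intro mult_left_mono) (simp_all add: D_def distrib_left distrib_right)
    finally show "riesz_fun (p - 2) a \<le> C * D * (1 + lattice_kernel p U N a)" by (simp only: mult.assoc)
  qed
qed

lemma lattice_kernel_exponent_mono:
  assumes p: "p \<le> q" and U: "0 < U" and a: "0 < a" "a \<le> A"
  shows "lattice_kernel p U N a \<le> (A + 2 * U) powr (q - p) * lattice_kernel q U N a"
proof -
  have "y powr (- p) \<le> (A + 2 * U) powr (q - p) * y powr (- q)" if y: "0 < y" "y \<le> A + 2 * U" for y
  proof -
    have "y powr (- p) = y powr (q - p) * y powr (- q)" by (simp flip: powr_add)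
    also have "\<dots> \<le> (A + 2 * U) powr (q - p) * y powr (- q)"
      using y p by (intro mult_right_mono powr_mono2) auto
    finally show ?thesis .
  qed
  moreover have "0 < a + (real j + real k) * (U / real N)" "a + (real j + real k) * (U / real N) \<le> A + 2 * U"
    if "j < N" "k < N" for j k
  proof -
    show "0 < a + (real j + real k) * (U / real N)" using a U by (intro add_pos_nonneg mult_nonneg_nonneg) auto
    have "(real j + real k) * (U / real N) \<le> (2 * real N) * (U / real N)"
      using that U by (intro mult_right_mono) auto
    also have "\<dots> = 2 * U" using that by simp
    finally show "a + (real j + real k) * (U / real N) \<le> A + 2 * U" using a by linarith
  qed
  ultimately show ?thesis
    unfolding lattice_kernel_def times_divide_eq_right sum_distrib_left
    by (intro divide_right_mono sum_mono) auto
qed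

lemma lattice_kernel_le_riesz_fun_of_gt_1:
  assumes p: "1 < p" and U: "0 < U"
  obtains C where "0 \<le> C" "\<And>N a. 0 < N \<Longrightarrow> 0 < a \<Longrightarrow> U / real N \<le> a \<Longrightarrow> a \<le> A \<Longrightarrow>
    lattice_kernel p U N a \<le> C * (1 + riesz_fun (p - 2) a)"
proof -
  have "-1 < p - 2" using p by simp
  then obtain C where C: "0 \<le> C"
    "\<And>a. 0 < a \<Longrightarrow> a \<le> A \<Longrightarrow> primitive_increment (p - 2 + 1) U a \<le> C * (1 + riesz_fun (p - 2) a)"
    by (rule primitive_increment_le_riesz_fun[OF _ U]) (rule that)
  define D where "D = 2 powr p / (p - 1) * 2 powr (p - 1)"
  have D: "0 \<le> D" using p by (simp add: D_def)
  show ?thesis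
  proof (rule that[of "D / U\<^sup>2 * C"])
    show "0 \<le> D / U\<^sup>2 * C" using C(1) D by simp
    fix N :: nat and a :: real assume N: "0 < N" and a: "0 < a" "U / real N \<le> a" "a \<le> A"
    have "U\<^sup>2 * lattice_kernel p U N a \<le> D * primitive_increment (p - 1) U a"
      unfolding D_def using p U N a by (intro lattice_kernel_le_primitive_increment)
    also have "\<dots> \<le> D * (C * (1 + riesz_fun (p - 2) a))"
      using C(2)[OF a(1,3)] D by (intro mult_left_mono) auto
    finally show "lattice_kernel p U N a \<le> D / U\<^sup>2 * C * (1 + riesz_fun (p - 2) a)"
      using U by (simp add: field_simps)
  qed
qed

theorem lattice_kernel_le_riesz_fun:
  assumes U: "0 < U"
  obtains C where "0 \<le> C" "\<And>N a. 0 < N \<Longrightarrow> 0 < a \<Longrightarrow> U / real N \<le> a \<Longrightarrow> a \<le> A \<Longrightarrow>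
    lattice_kernel p U N a \<le> C * (1 + riesz_fun (p - 2) a)"
proof (cases "1 < p")
  case True
  then show ?thesis by (rule lattice_kernel_le_riesz_fun_of_gt_1[OF _ U]) (rule that)
next
  case False
  obtain C where C: "0 \<le> C" "\<And>N a. 0 < N \<Longrightarrow> 0 < a \<Longrightarrow> U / real N \<le> a \<Longrightarrow> a \<le> A \<Longrightarrow>
      lattice_kernel (3 / 2) U N a \<le> C * (1 + riesz_fun (3 / 2 - 2) a)"
    by (rule lattice_kernel_le_riesz_fun_of_gt_1[of "3 / 2", OF _ U]) (simp, rule that)
  let ?Y = "(A + 2 * U) powr (3 / 2 - p)"
  show ?thesis
  proof (rule that[of "?Y * C"])
    show "0 \<le> ?Y * C" using C(1) by simp
    fix N :: nat and a :: real assume N: "0 < N" and a: "0 < a" "U / real N \<le> a" "a \<le> A"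
    have "lattice_kernel p U N a \<le> ?Y * lattice_kernel (3 / 2) U N a"
      using False U a by (intro lattice_kernel_exponent_mono) auto
    also have "\<dots> \<le> ?Y * (C * (1 + riesz_fun (3 / 2 - 2) a))"
      using C(2)[OF N a] by (intro mult_left_mono) auto
    also have "riesz_fun (3 / 2 - 2) a = riesz_fun (p - 2) a"
      using False by (simp add: riesz_fun_def)
    finally show "lattice_kernel p U N a \<le> ?Y * C * (1 + riesz_fun (p - 2) a)" by (simp only: mult.assoc)
  qed
qed

subsection \<open>Rectangles in a grid\<close>

lemma sum_int_telescope:
  fixes f :: "int \<Rightarrow> 'a::ab_group_add"
  assumes "a \<le> b + 1"
  shows "(\<Sum>m\<in>{a..b}. f m - f (m - 1)) = f b - f (a - 1)"
  using assms
proof (induction "nat (b + 1 - a)" arbitrary: b)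
  case 0
  then have "b = a - 1" by simp
  then show ?case by simp
next
  case (Suc m)
  then have "a \<le> b" by simp
  then have "{a..b} = insert b {a..b - 1}" by auto
  then show ?case using Suc.hyps(1)[of "b - 1"] Suc.hyps(2) \<open>a \<le> b\<close> by simp
qed

lemma sum_abs_diff_le:
  fixes f :: "real \<Rightarrow> real"
  assumes antimono: "\<And>a b. 0 \<le> a \<Longrightarrow> a \<le> b \<Longrightarrow> f b \<le> f a" and nonneg: "\<And>a. 0 \<le> f a" and j: "j < 2 * N"
  shows "(\<Sum>j'<2 * N. f \<bar>real j - real j'\<bar>) \<le> 4 * (\<Sum>m<N. f (real m))"
proof -
  have doubled: "(\<Sum>m<2 * N. f (real m)) \<le> 2 * (\<Sum>m<N. f (real m))"
  proof -
    have "(\<Sum>m<2 * N. f (real m)) = (\<Sum>m<N. f (real m)) + (\<Sum>m\<in>{N..<2 * N}. f (real m))"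
      unfolding lessThan_atLeast0 by (rule sum.atLeastLessThan_concat[symmetric]) auto
    also have "(\<Sum>m\<in>{N..<2 * N}. f (real m)) = (\<Sum>m<N. f (real (m + N)))"
      by (rule sum.reindex_bij_witness[of _ "\<lambda>m. m + N" "\<lambda>m. m - N"]) auto
    also have "\<dots> \<le> (\<Sum>m<N. f (real m))" by (intro sum_mono antimono) auto
    finally show ?thesis by simp
  qed
  have "(\<Sum>j'<2 * N. f \<bar>real j - real j'\<bar>)
      = (\<Sum>j'<j. f \<bar>real j - real j'\<bar>) + (\<Sum>j'\<in>{j..<2 * N}. f \<bar>real j - real j'\<bar>)"
    unfolding lessThan_atLeast0 using j by (intro sum.atLeastLessThan_concat[symmetric]) auto
  also have "(\<Sum>j'<j. f \<bar>real j - real j'\<bar>) = (\<Sum>m\<in>{1..j}. f (real m))"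
    by (rule sum.reindex_bij_witness[of _ "\<lambda>m. j - m" "\<lambda>m. j - m"]) (auto simp: of_nat_diff)
  also have "\<dots> \<le> (\<Sum>m<2 * N. f (real m))"
    using j nonneg by (intro sum_mono2) auto
  also have "(\<Sum>j'\<in>{j..<2 * N}. f \<bar>real j - real j'\<bar>) = (\<Sum>m<2 * N - j. f (real m))"
    by (rule sum.reindex_bij_witness[of _ "\<lambda>m. m + j" "\<lambda>m. m - j"]) (auto simp: of_nat_diff)
  also have "\<dots> \<le> (\<Sum>m<2 * N. f (real m))"
    using nonneg by (intro sum_mono2) auto
  finally show ?thesis using doubled by simp
qed

lemma double_sum_abs_diff_le:
  fixes f :: "real \<Rightarrow> real \<Rightarrow> real"
  assumes antimono: "\<And>a a' b. 0 \<le> a \<Longrightarrow> a \<le> a' \<Longrightarrow> f a' b \<le> f a b" "\<And>a b b'. 0 \<le> b \<Longrightarrow> b \<le> b' \<Longrightarrow> f a b' \<le> f a b"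
    and nonneg: "\<And>a b. 0 \<le> f a b" and jk: "j < 2 * N" "k < 2 * N"
  shows "(\<Sum>j'<2 * N. \<Sum>k'<2 * N. f \<bar>real j - real j'\<bar> \<bar>real k - real k'\<bar>)
    \<le> 16 * (\<Sum>m<N. \<Sum>m'<N. f (real m) (real m'))"
proof -
  have "(\<Sum>j'<2 * N. \<Sum>k'<2 * N. f \<bar>real j - real j'\<bar> \<bar>real k - real k'\<bar>)
      \<le> (\<Sum>j'<2 * N. 4 * (\<Sum>m'<N. f \<bar>real j - real j'\<bar> (real m')))"
    using antimono nonneg jk by (intro sum_mono sum_abs_diff_le) auto
  also have "\<dots> = 4 * (\<Sum>j'<2 * N. (\<lambda>a. \<Sum>m'<N. f a (real m')) \<bar>real j - real j'\<bar>)"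
    by (simp add: sum_distrib_left)
  also have "\<dots> \<le> 4 * (4 * (\<Sum>m<N. \<Sum>m'<N. f (real m) (real m')))"
    using antimono nonneg jk by (intro mult_left_mono sum_abs_diff_le) (auto intro!: sum_mono sum_nonneg)
  finally show ?thesis by simp
qed

locale grid_noise =
  fixes n N :: nat and x :: "nat \<Rightarrow> real" and g U s0 s1 \<epsilon> :: real and dim :: "'d::finite itself"
  assumes n_pos: "0 < n" and N_pos: "0 < N"
    and x_0: "x 0 = 0" and x_strict: "\<And>i j. i < j \<Longrightarrow> j \<le> n \<Longrightarrow> x i < x j"
    and g_pos: "0 < g" and U_pos: "0 < U" and \<epsilon>_pos: "0 < \<epsilon>"
    and s0_pos: "0 < s0" and x_ge: "\<And>i. 1 \<le> i \<Longrightarrow> i \<le> n \<Longrightarrow> s0 \<le> x i" and x_le: "\<And>i. 1 \<le> i \<Longrightarrow> i \<le> n \<Longrightarrow> x i \<le> s1"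
begin

definition h :: real where
  "h = U / real N"

lemma h_pos: "0 < h" and N_times_h: "real N * h = U"
  using N_pos U_pos by (simp_all add: h_def)

lemma times_h_le: "real a \<le> b * real N \<Longrightarrow> real a * h \<le> b * U"
  using mult_right_mono[of "real a" "b * real N" h] h_pos by (simp add: N_times_h mult.assoc)

lemma s1_pos: "0 < s1"
  using s0_pos x_ge[of 1] x_le[of 1] n_pos by simp

text \<open>Cell \<open>(i, m)\<close> stands for a rectangle whose first coordinates run from \<open>x (i - 1)\<close> to \<open>x i\<close>. In the
  second coordinate, cell 0 is the gap between the two time ranges and has height \<open>g\<close>; the cells of height \<open>h\<close>
  with negative and positive index lie below and above it.\<close>

definition cells :: "(nat \<times> int) set" where
  "cells = {1..n} \<times> {- int (2 * N)..int (2 * N)}"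

definition height :: "int \<Rightarrow> real" where
  "height m = (if m = 0 then g else h)"

definition area :: "nat \<times> int \<Rightarrow> real" where
  "area c = (if c \<in> cells then (x (fst c) - x (fst c - 1)) * height (snd c) else 1)"

lemma height_pos: "0 < height m"
  using g_pos h_pos by (simp add: height_def)

sublocale white_noise cells area dim
proof
  show "finite cells" by (simp add: cells_def)
  fix c
  have "x (fst c - 1) < x (fst c)" if "c \<in> cells"
    using that by (intro x_strict) (auto simp: cells_def)
  then show "0 < area c" using height_pos by (simp add: area_def)
qed

abbreviation slots :: "nat \<Rightarrow> (nat \<times> nat \<times> nat) set" where
  "slots m \<equiv> {1..n} \<times> {..<m} \<times> {..<m}"

definition region :: "nat \<times> nat \<times> nat \<Rightarrow> (nat \<times> int) set" where
  "region = (\<lambda>(i, j, k). {1..i} \<times> {- int j..int k})"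

lemma finite_region: "finite (region q)"
  by (simp add: region_def split: prod.split)

lemma region_subset: "q \<in> slots (2 * N) \<Longrightarrow> region q \<subseteq> cells"
  by (auto simp: region_def cells_def)

lemma region_Int: "region (i, j, k) \<inter> region (i', j', k') = region (min i i', min j j', min k k')"
  by (auto simp: region_def)

lemma region_mono: "i \<le> i' \<Longrightarrow> j \<le> j' \<Longrightarrow> k \<le> k' \<Longrightarrow> region (i, j, k) \<subseteq> region (i', j', k')"
  by (auto simp: region_def)

lemma x_mono: "i \<le> j \<Longrightarrow> j \<le> n \<Longrightarrow> x i \<le> x j"
  using x_strict[of i j] by (cases "i = j") auto

lemma x_nonneg: "i \<le> n \<Longrightarrow> 0 \<le> x i"
  using x_mono[of 0 i] x_0 by simp

lemma sum_area_rect: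
  assumes "a \<le> b" "b \<le> n" "T \<subseteq> {- int (2 * N)..int (2 * N)}"
  shows "sum area ({Suc a..b} \<times> T) = (x b - x a) * sum height T"
proof -
  have "sum area ({Suc a..b} \<times> T) = (\<Sum>(i, m)\<in>{Suc a..b} \<times> T. (x i - x (i - 1)) * height m)"
    using assms by (intro sum.cong) (auto simp: area_def cells_def)
  also have "\<dots> = (\<Sum>i\<in>{Suc a..b}. x i - x (i - 1)) * sum height T"
    by (simp add: sum.cartesian_product[symmetric] sum_product)
  finally show ?thesis unfolding sum_telescope''[OF assms(1)] .
qed

lemma sum_height_eq: "0 \<notin> T \<Longrightarrow> sum height T = real (card T) * h"
  by (subst sum.cong[of T T height "\<lambda>_. h"]) (auto simp: height_def)

lemma sum_height_interval: "sum height {- int j..int k} = g + (real j + real k) * h"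
proof -
  have "sum height {- int j..int k} = height 0 + sum height ({- int j..int k} - {0})"
    by (rule sum.remove) auto
  also have "sum height ({- int j..int k} - {0}) = (real j + real k) * h"
    by (subst sum_height_eq) (auto simp: card_Diff_singleton_if)
  finally show ?thesis by (simp add: height_def)
qed

lemma sum_area_region:
  assumes "(i, j, k) \<in> slots (2 * N)"
  shows "sum area (region (i, j, k)) = x i * (g + (real j + real k) * h)"
  using assms sum_area_rect[of 0 i "{- int j..int k}"] x_0
  by (auto simp: region_def sum_height_interval)

lemma sum_area_mono: "S \<subseteq> T \<Longrightarrow> T \<subseteq> cells \<Longrightarrow> sum area S \<le> sum area T"
  using finite_cells w_pos by (intro sum_mono2) (auto intro: finite_subset less_imp_le)

lemma sum_area_nonneg: "0 \<le> sum area S"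
  using w_pos by (intro sum_nonneg) (auto intro: less_imp_le)

lemma area_diff_ge_space:
  assumes q: "(i, j, k) \<in> slots (2 * N)" and i': "i' \<le> n"
  shows "g * (x i - x i') \<le> sum area (region (i, j, k) - region (i', j', k'))"
proof (cases "i' \<le> i")
  case True
  have "g * (x i - x i') \<le> (x i - x i') * sum height {- int j..int k}"
    unfolding sum_height_interval using q True g_pos h_pos x_mono[of i' i]
    by (subst mult.commute, intro mult_left_mono) auto
  also have "\<dots> = sum area ({Suc i'..i} \<times> {- int j..int k})"
    using q True by (intro sum_area_rect[symmetric]) auto
  also have "\<dots> \<le> sum area (region (i, j, k) - region (i', j', k'))"
    using q by (intro sum_area_mono) (auto simp: region_def cells_def)
  finally show ?thesis .
next
  case False
  then have "g * (x i - x i') \<le> 0"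
    using x_mono[of i i'] i' g_pos by (intro mult_nonneg_nonpos) auto
  then show ?thesis using sum_area_nonneg order_trans by blast
qed

lemma area_ge_time:
  assumes i: "1 \<le> i" "i \<le> n" and T: "T \<subseteq> {- int (2 * N)..int (2 * N)} - {0}"
    and S: "{1..i} \<times> T \<subseteq> S" "S \<subseteq> cells" and a: "a \<le> real (card T)"
  shows "s0 * (a * h) \<le> sum area S"
proof -
  have "s0 * (a * h) \<le> s0 * (real (card T) * h)"
    using a s0_pos h_pos by (intro mult_left_mono mult_right_mono) auto
  also have "\<dots> \<le> x i * (real (card T) * h)"
    using x_ge[OF i] h_pos by (intro mult_right_mono) auto
  also have "\<dots> = sum area ({Suc 0..i} \<times> T)"
  proof -
    have "T \<subseteq> {- int (2 * N)..int (2 * N)}" "0 \<notin> T" using T by auto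
    then show ?thesis using sum_area_rect[of 0 i T] sum_height_eq[of T] i x_0 by simp
  qed
  also have "\<dots> \<le> sum area S"
    using S by (intro sum_area_mono) auto
  finally show ?thesis .
qed

lemma area_diff_ge_below:
  assumes "(i, j, k) \<in> slots (2 * N)"
  shows "s0 * ((real j - real j') * h) \<le> sum area (region (i, j, k) - region (i', j', k'))"
  using assms by (intro area_ge_time[of i "{- int j..- int j' - 1}"]) (auto simp: region_def cells_def)

lemma area_diff_ge_above:
  assumes "(i, j, k) \<in> slots (2 * N)"
  shows "s0 * ((real k - real k') * h) \<le> sum area (region (i, j, k) - region (i', j', k'))"
  using assms by (intro area_ge_time[of i "{int k' + 1..int k}"]) (auto simp: region_def cells_def)

definition gap :: "nat \<times> nat \<times> nat \<Rightarrow> nat \<times> nat \<times> nat \<Rightarrow> real" where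
  "gap = (\<lambda>(i, j, k) (i', j', k'). \<bar>x i - x i'\<bar> + (\<bar>real j - real j'\<bar> + \<bar>real k - real k'\<bar>) * h)"

lemma gap_nonneg: "0 \<le> gap q q'"
  using h_pos by (auto simp: gap_def split: prod.split)

lemma gap_le_area_diff:
  assumes q: "q \<in> slots (2 * N)" "q' \<in> slots (2 * N)"
  shows "min g s0 / 3 * gap q q' \<le> sum area (region q - region q')
    \<or> min g s0 / 3 * gap q q' \<le> sum area (region q' - region q)"
proof -
  obtain i j k i' j' k' where q_eq: "q = (i, j, k)" "q' = (i', j', k')" by (metis prod.exhaust)
  define m where "m = min g s0"
  define D where "D = max (sum area (region q - region q')) (sum area (region q' - region q))"
  have m: "0 < m" "m \<le> g" "m \<le> s0" using g_pos s0_pos by (auto simp: m_def)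
  have abs_le: "m * \<bar>a\<bar> \<le> D" if "c * a \<le> D" "c * (- a) \<le> D" "m \<le> c" for a c
  proof -
    have "m * \<bar>a\<bar> \<le> c * \<bar>a\<bar>" using that(3) by (rule mult_right_mono) simp
    also have "\<dots> \<le> D" using that by (simp add: abs_if)
    finally show ?thesis .
  qed
  have "m * \<bar>x i - x i'\<bar> \<le> D"
    using area_diff_ge_space[of i j k i' j' k'] area_diff_ge_space[of i' j' k' i j k] q m
    by (intro abs_le[of g]) (auto simp: D_def q_eq)
  moreover have "m * \<bar>(real j - real j') * h\<bar> \<le> D"
    using area_diff_ge_below[of i j k j' i' k'] area_diff_ge_below[of i' j' k' j i k] q m
    by (intro abs_le[of s0]) (auto simp: D_def q_eq left_diff_distrib)
  moreover have "m * \<bar>(real k - real k') * h\<bar> \<le> D"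
    using area_diff_ge_above[of i j k k' i' j'] area_diff_ge_above[of i' j' k' k i j] q m
    by (intro abs_le[of s0]) (auto simp: D_def q_eq left_diff_distrib)
  ultimately have "m * gap q q' \<le> 3 * D"
    using h_pos by (simp add: gap_def q_eq abs_mult distrib_left distrib_right)
  then have "m / 3 * gap q q' \<le> D" by simp
  then show ?thesis unfolding m_def D_def le_max_iff_disj .
qed

definition size_bound :: real where
  "size_bound = max 1 (max s1 (g + 4 * U))"

lemma area_diff_le_gap:
  assumes le: "i \<le> i'" "j \<le> j'" "k \<le> k'" and q: "(i, j, k) \<in> slots (2 * N)" "(i', j', k') \<in> slots (2 * N)"
  shows "sum area (region (i', j', k') - region (i, j, k)) \<le> size_bound * gap (i, j, k) (i', j', k')"
proof -
  have "sum area (region (i', j', k') - region (i, j, k)) = sum area (region (i', j', k')) - sum area (region (i, j, k))"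
    using region_mono[OF le] by (intro sum_diff finite_region)
  also have "\<dots> = (x i' - x i) * (g + (real j' + real k') * h) + x i * ((real j' - real j) * h + (real k' - real k) * h)"
    unfolding sum_area_region[OF q(1)] sum_area_region[OF q(2)] by (simp add: algebra_simps)
  also have "\<dots> \<le> (x i' - x i) * size_bound + size_bound * ((real j' - real j) * h + (real k' - real k) * h)"
  proof (intro add_mono mult_left_mono mult_right_mono)
    have "real (j' + k') * h \<le> 4 * U" using q by (intro times_h_le) auto
    then show "g + (real j' + real k') * h \<le> size_bound" by (simp add: size_bound_def)
    show "x i \<le> size_bound" using x_le[of i] q by (simp add: size_bound_def)
  qed (use x_mono[of i i'] le q h_pos in auto)
  also have "\<dots> = size_bound * gap (i, j, k) (i', j', k')"
    using x_mono[of i i'] le q by (simp add: gap_def algebra_simps)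
  finally show ?thesis .
qed

end

subsection \<open>Occupation of a small ball\<close>

lemma inverse_sqrt_power:
  assumes "0 < y"
  shows "(1 / sqrt y) ^ d = y powr (- (real d / 2))"
proof -
  have "1 / sqrt y = y powr (- (1/2))" using assms by (simp add: powr_minus_divide powr_half_sqrt)
  then have "(1 / sqrt y) ^ d = (y powr (- (1/2))) powr real d" using assms by (simp only: powr_realpow powr_gt_zero)
  then show ?thesis unfolding powr_powr by simp
qed

context grid_noise
begin

definition grid_kernel :: "nat \<Rightarrow> nat \<Rightarrow> real" where
  "grid_kernel i i' = lattice_kernel (real CARD('d) / 2) U N (\<bar>x i - x i'\<bar> + \<epsilon>\<^sup>2)"

lemma grid_kernel_nonneg: "0 \<le> grid_kernel i i'"
  unfolding grid_kernel_def by (rule lattice_kernel_nonneg)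

lemma grid_kernel_commute: "grid_kernel i i' = grid_kernel i' i"
  by (simp add: grid_kernel_def abs_minus_commute)

definition grid_energy :: "(nat \<Rightarrow> real) \<Rightarrow> real" where
  "grid_energy p = (\<Sum>i\<in>{1..n}. \<Sum>i'\<in>{1..n}. p i * p i' * grid_kernel i i')"

lemma grid_energy_nonneg: "(\<And>i. 0 \<le> p i) \<Longrightarrow> 0 \<le> grid_energy p"
  unfolding grid_energy_def by (intro sum_nonneg mult_nonneg_nonneg grid_kernel_nonneg) auto

lemma grid_energy_le_double_sum_upper:
  assumes p: "\<And>i. 0 \<le> p i"
  shows "grid_energy p \<le> 2 * (\<Sum>i\<in>{1..n}. p i * (\<Sum>i'\<in>{i..n}. p i' * grid_kernel i i'))"
proof -
  have "grid_energy p \<le> 2 * (\<Sum>i\<in>{1..n}. \<Sum>i'\<in>{i'\<in>{1..n}. i \<le> i'}. p i * p i' * grid_kernel i i')"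
    unfolding grid_energy_def mult_2 using p grid_kernel_nonneg
    by (intro sum_symmetric_le_double_sum_upper) (simp_all add: grid_kernel_commute mult.commute)
  also have "(\<Sum>i\<in>{1..n}. \<Sum>i'\<in>{i'\<in>{1..n}. i \<le> i'}. p i * p i' * grid_kernel i i')
      = (\<Sum>i\<in>{1..n}. p i * (\<Sum>i'\<in>{i..n}. p i' * grid_kernel i i'))"
    unfolding sum_distrib_left by (intro sum.cong) auto
  finally show ?thesis .
qed

definition pair_kernel :: "nat \<times> nat \<times> nat \<Rightarrow> nat \<times> nat \<times> nat \<Rightarrow> real" where
  "pair_kernel q q' = (gap q q' + \<epsilon>\<^sup>2) powr (- (real CARD('d) / 2))"

lemma gap_plus_pos: "0 < gap q q' + \<epsilon>\<^sup>2"
  using gap_nonneg \<epsilon>_pos by (simp add: add_nonneg_pos)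

lemma sum_powr_eq_grid_kernel:
  "(\<Sum>m<N. \<Sum>m'<N. (\<bar>x i - x i'\<bar> + (real m + real m') * h + \<epsilon>\<^sup>2) powr (- (real CARD('d) / 2)))
    = (real N)\<^sup>2 * grid_kernel i i'"
  using N_pos by (simp add: grid_kernel_def lattice_kernel_def h_def add.commute add.left_commute)

lemma sum_pair_kernel_le:
  assumes "j < 2 * N" "k < 2 * N"
  shows "(\<Sum>j'<2 * N. \<Sum>k'<2 * N. pair_kernel (i, j, k) (i', j', k')) \<le> 16 * ((real N)\<^sup>2 * grid_kernel i i')"
proof -
  let ?f = "\<lambda>a b. (\<bar>x i - x i'\<bar> + (\<bar>a\<bar> + \<bar>b\<bar>) * h + \<epsilon>\<^sup>2) powr (- (real CARD('d) / 2))"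
  have pos: "0 < \<bar>x i - x i'\<bar> + (\<bar>a\<bar> + \<bar>b\<bar>) * h + \<epsilon>\<^sup>2" for a b
    using h_pos \<epsilon>_pos by (intro add_nonneg_pos add_nonneg_nonneg mult_nonneg_nonneg) auto
  have mono: "?f a' b' \<le> ?f a b" if "\<bar>a\<bar> \<le> \<bar>a'\<bar>" "\<bar>b\<bar> \<le> \<bar>b'\<bar>" for a a' b b'
    using that h_pos pos by (intro powr_mono2' add_mono mult_right_mono) auto
  have "(\<Sum>j'<2 * N. \<Sum>k'<2 * N. ?f \<bar>real j - real j'\<bar> \<bar>real k - real k'\<bar>) \<le> 16 * (\<Sum>m<N. \<Sum>m'<N. ?f (real m) (real m'))"
    using assms by (intro double_sum_abs_diff_le mono) auto
  then show ?thesis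
    using sum_powr_eq_grid_kernel[of i i'] by (simp add: pair_kernel_def gap_def)
qed

lemma sum_pair_kernel_shift:
  "(\<Sum>j'\<in>{j..<j + N}. \<Sum>k'\<in>{k..<k + N}. pair_kernel (i, j, k) (i', j', k')) = (real N)\<^sup>2 * grid_kernel i i'"
proof -
  have "(\<Sum>j'\<in>{j..<j + N}. f j') = (\<Sum>m<N. f (m + j))" for f :: "nat \<Rightarrow> real" and j
    using sum.shift_bounds_nat_ivl[of f 0 j N] by (simp add: lessThan_atLeast0 add.commute)
  then show ?thesis
    unfolding sum_powr_eq_grid_kernel[of i i', symmetric] by (simp add: pair_kernel_def gap_def)
qed

lemma pair_kernel_energy_le:
  assumes p: "\<And>i. 0 \<le> p i"
  shows "(\<Sum>q\<in>slots (2 * N). \<Sum>q'\<in>slots (2 * N). p (fst q) * p (fst q') * pair_kernel q q') \<le> 64 * (real N) ^ 4 * grid_energy p"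
proof -
  have "(\<Sum>q\<in>slots (2 * N). \<Sum>q'\<in>slots (2 * N). p (fst q) * p (fst q') * pair_kernel q q')
    = (\<Sum>i\<in>{1..n}. \<Sum>j<2 * N. \<Sum>k<2 * N. \<Sum>i'\<in>{1..n}. p i * p i' * (\<Sum>j'<2 * N. \<Sum>k'<2 * N. pair_kernel (i, j, k) (i', j', k')))"
    by (simp add: sum.cartesian_product' sum_distrib_left)
  also have "\<dots> \<le> (\<Sum>i\<in>{1..n}. \<Sum>j<2 * N. \<Sum>k<2 * N. \<Sum>i'\<in>{1..n}. p i * p i' * (16 * ((real N)\<^sup>2 * grid_kernel i i')))"
    using p by (intro sum_mono mult_left_mono sum_pair_kernel_le) auto
  also have "\<dots> = (\<Sum>i\<in>{1..n}. \<Sum>j<2 * N. \<Sum>k<2 * N. 16 * (real N)\<^sup>2 * (\<Sum>i'\<in>{1..n}. p i * p i' * grid_kernel i i'))"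
    by (simp add: sum_distrib_left ac_simps)
  also have "\<dots> = 64 * (real N) ^ 4 * grid_energy p"
    by (simp add: grid_energy_def sum_distrib_left power2_eq_square power4_eq_xxxx mult.assoc)
  finally show ?thesis .
qed

definition hit :: "real \<Rightarrow> nat \<times> nat \<times> nat \<Rightarrow> (((nat \<times> int) \<times> 'd) \<Rightarrow> real) \<Rightarrow> ennreal" where
  "hit r q \<omega> = small r (noise (region q) \<omega>)"

lemma measurable_hit: "q \<in> slots (2 * N) \<Longrightarrow> hit r q \<in> borel_measurable product_measure"
  unfolding hit_def[abs_def] by (intro borel_measurable_small measurable_noise region_subset)

definition hit_event :: "real \<Rightarrow> nat \<Rightarrow> (((nat \<times> int) \<times> 'd) \<Rightarrow> real) set" where
  "hit_event r m = (\<Union>q\<in>slots m. {\<omega>\<in>space product_measure. hit r q \<omega> \<noteq> 0})"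

lemma sets_hit_nonzero:
  assumes "q \<in> slots (2 * N)"
  shows "{\<omega>\<in>space product_measure. hit r q \<omega> \<noteq> 0} \<in> sets product_measure"
  using measurable_hit[OF assms, measurable] by measurable

lemma sets_hit_event: "m \<le> 2 * N \<Longrightarrow> hit_event r m \<in> sets product_measure"
  unfolding hit_event_def by (intro sets.finite_UN sets_hit_nonzero) auto

definition weight :: "(nat \<Rightarrow> real) \<Rightarrow> nat \<times> nat \<times> nat \<Rightarrow> real" where
  "weight p q = p (fst q) / ((real N)\<^sup>2 * \<epsilon> ^ CARD('d))"

lemma weight_nonneg: "(\<And>i. 0 \<le> p i) \<Longrightarrow> 0 \<le> weight p q"
  using \<epsilon>_pos by (simp add: weight_def)

definition occupation :: "(nat \<Rightarrow> real) \<Rightarrow> (((nat \<times> int) \<times> 'd) \<Rightarrow> real) \<Rightarrow> ennreal" where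
  "occupation p \<omega> = (\<Sum>q\<in>slots (2 * N). ennreal (weight p q) * hit (2 * \<epsilon>) q \<omega>)"

lemma measurable_occupation[measurable]: "occupation p \<in> borel_measurable product_measure"
  unfolding occupation_def[abs_def]
  by (intro borel_measurable_sum borel_measurable_times_ennreal measurable_hit borel_measurable_const)

subsection \<open>Moments of the occupation measure\<close>

definition pair_const :: real where
  "pair_const = 16 / sqrt (s0 * g * min 1 (min g s0 / 3))"

lemma pair_const_pos: "0 < pair_const"
  unfolding pair_const_def using s0_pos g_pos by auto

lemma common_area_ge:
  assumes q: "q \<in> slots (2 * N)" "q' \<in> slots (2 * N)"
  shows "s0 * g \<le> sum area (region q \<inter> region q')"
proof -
  obtain i j k i' j' k' where q_eq: "q = (i, j, k)" "q' = (i', j', k')" by (metis prod.exhaust)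
  have "s0 * g \<le> x (min i i') * (g + (real (min j j') + real (min k k')) * h)"
    using q x_ge[of "min i i'"] g_pos h_pos s0_pos x_nonneg[of "min i i'"]
    by (intro mult_mono) (auto simp: q_eq)
  also have "\<dots> = sum area (region q \<inter> region q')"
    unfolding q_eq region_Int using q by (intro sum_area_region[symmetric]) (auto simp: q_eq min_def)
  finally show ?thesis .
qed

lemma nn_integral_hit_pair_le:
  assumes q: "q \<in> slots (2 * N)" "q' \<in> slots (2 * N)"
  shows "(\<integral>\<^sup>+\<omega>. hit (2 * \<epsilon>) q \<omega> * hit (2 * \<epsilon>) q' \<omega> \<partial>product_measure)
    \<le> ennreal ((pair_const * \<epsilon>\<^sup>2) ^ CARD('d) * pair_kernel q q')"
proof -
  let ?\<delta> = "gap q q'" and ?m = "min g s0 / 3"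
  define m' where "m' = min 1 ?m"
  have m: "0 < ?m" and m': "0 < m'" "m' \<le> 1" "m' \<le> ?m" using g_pos s0_pos by (auto simp: m'_def)
  define a b where "a = 2 * \<epsilon> / sqrt (s0 * g)" and "b = 4 * (2 * \<epsilon>) / sqrt (?m * ?\<delta> + (2 * \<epsilon>)\<^sup>2)"
  have "(\<integral>\<^sup>+\<omega>. hit (2 * \<epsilon>) q \<omega> * hit (2 * \<epsilon>) q' \<omega> \<partial>product_measure) \<le> ennreal (a ^ CARD('d) * b ^ CARD('d))"
    unfolding hit_def a_def b_def
    using q \<epsilon>_pos s0_pos g_pos m gap_nonneg[of q q'] common_area_ge[OF q] gap_le_area_diff[OF q]
    by (intro nn_integral_small_noise_pair_le region_subset) auto
  also have "\<dots> \<le> ennreal ((pair_const * \<epsilon>\<^sup>2) ^ CARD('d) * pair_kernel q q')"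
  proof (rule ennreal_leI)
    have pos: "0 < sqrt m' * sqrt (?\<delta> + \<epsilon>\<^sup>2)" using m' gap_plus_pos by simp
    have "m' * (?\<delta> + \<epsilon>\<^sup>2) \<le> ?m * ?\<delta> + 1 * \<epsilon>\<^sup>2"
      unfolding distrib_left using m' gap_nonneg by (intro add_mono mult_right_mono) auto
    also have "\<dots> \<le> ?m * ?\<delta> + (2 * \<epsilon>)\<^sup>2"
      by (simp add: power_mult_distrib)
    finally have "sqrt m' * sqrt (?\<delta> + \<epsilon>\<^sup>2) \<le> sqrt (?m * ?\<delta> + (2 * \<epsilon>)\<^sup>2)"
      unfolding real_sqrt_mult[symmetric] by (rule real_sqrt_le_mono)
    then have "b \<le> 4 * (2 * \<epsilon>) / (sqrt m' * sqrt (?\<delta> + \<epsilon>\<^sup>2))"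
      unfolding b_def using pos \<epsilon>_pos by (intro divide_left_mono) (auto intro: mult_pos_pos less_le_trans)
    moreover have "0 \<le> a" "0 \<le> b"
      using \<epsilon>_pos s0_pos g_pos m gap_nonneg by (auto simp: a_def b_def)
    ultimately have "a ^ CARD('d) * b ^ CARD('d) \<le> (a * (4 * (2 * \<epsilon>) / (sqrt m' * sqrt (?\<delta> + \<epsilon>\<^sup>2)))) ^ CARD('d)"
      unfolding power_mult_distrib[symmetric] by (intro power_mono mult_left_mono) auto
    also have "a * (4 * (2 * \<epsilon>) / (sqrt m' * sqrt (?\<delta> + \<epsilon>\<^sup>2))) = pair_const * \<epsilon>\<^sup>2 * (1 / sqrt (?\<delta> + \<epsilon>\<^sup>2))"
      by (simp add: a_def pair_const_def m'_def[symmetric] real_sqrt_mult power2_eq_square)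
    finally show "a ^ CARD('d) * b ^ CARD('d) \<le> (pair_const * \<epsilon>\<^sup>2) ^ CARD('d) * pair_kernel q q'"
      unfolding pair_kernel_def power_mult_distrib inverse_sqrt_power[OF gap_plus_pos] .
  qed
  finally show ?thesis .
qed

lemma nn_integral_power2_occupation_le:
  assumes p: "\<And>i. 0 \<le> p i"
  shows "(\<integral>\<^sup>+\<omega>. (occupation p \<omega>)\<^sup>2 \<partial>product_measure) \<le> ennreal (64 * pair_const ^ CARD('d) * grid_energy p)"
proof -
  let ?d = "CARD('d)" and ?Q = "slots (2 * N)"
  have [measurable]: "hit (2 * \<epsilon>) q \<in> borel_measurable product_measure" if "q \<in> ?Q" for q
    using that by (rule measurable_hit)
  have square: "(occupation p \<omega>)\<^sup>2
      = (\<Sum>q\<in>?Q. \<Sum>q'\<in>?Q. ennreal (weight p q * weight p q') * (hit (2 * \<epsilon>) q \<omega> * hit (2 * \<epsilon>) q' \<omega>))" for \<omega>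
    unfolding occupation_def power2_eq_square sum_product
    using weight_nonneg[of p, OF p] by (intro sum.cong refl) (simp add: ennreal_mult ac_simps)
  have "(\<integral>\<^sup>+\<omega>. (occupation p \<omega>)\<^sup>2 \<partial>product_measure)
      = (\<Sum>q\<in>?Q. \<Sum>q'\<in>?Q. ennreal (weight p q * weight p q') * (\<integral>\<^sup>+\<omega>. hit (2 * \<epsilon>) q \<omega> * hit (2 * \<epsilon>) q' \<omega> \<partial>product_measure))"
    unfolding square by (simp add: nn_integral_sum nn_integral_cmult del: sum_ennreal)
  also have "\<dots> \<le> (\<Sum>q\<in>?Q. \<Sum>q'\<in>?Q. ennreal (weight p q * weight p q') * ennreal ((pair_const * \<epsilon>\<^sup>2) ^ ?d * pair_kernel q q'))"
    by (intro sum_mono mult_left_mono nn_integral_hit_pair_le) auto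
  also have "\<dots> = ennreal (\<Sum>q\<in>?Q. \<Sum>q'\<in>?Q. weight p q * weight p q' * ((pair_const * \<epsilon>\<^sup>2) ^ ?d * pair_kernel q q'))"
    using weight_nonneg[of p, OF p] pair_const_pos
    by (simp add: ennreal_mult[symmetric] sum_nonneg pair_kernel_def flip: sum_ennreal)
  also have "\<dots> = ennreal (pair_const ^ ?d / (real N) ^ 4 * (\<Sum>q\<in>?Q. \<Sum>q'\<in>?Q. p (fst q) * p (fst q') * pair_kernel q q'))"
  proof -
    have "weight p q * weight p q' * ((pair_const * \<epsilon>\<^sup>2) ^ ?d * pair_kernel q q')
        = pair_const ^ ?d / (real N) ^ 4 * (p (fst q) * p (fst q') * pair_kernel q q')" for q q'
      using \<epsilon>_pos N_pos
      by (simp add: weight_def power_mult_distrib power2_eq_square power4_eq_xxxx field_simps flip: power_mult)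
    then show ?thesis by (simp add: sum_distrib_left)
  qed
  also have "\<dots> \<le> ennreal (pair_const ^ ?d / (real N) ^ 4 * (64 * (real N) ^ 4 * grid_energy p))"
    using pair_const_pos by (intro ennreal_leI mult_left_mono pair_kernel_energy_le p) simp
  finally show ?thesis using N_pos by (simp add: mult.assoc mult.left_commute)
qed

definition density_const :: real where
  "density_const = 1 / (2 * sqrt (s1 * (g + 4 * U) + 4))"

lemma density_const_pos: "0 < density_const"
  unfolding density_const_def using s1_pos g_pos U_pos by (auto intro!: add_nonneg_pos mult_nonneg_nonneg)

lemma nn_integral_hit_ge:
  assumes q: "q \<in> slots (2 * N)" and \<epsilon>: "\<epsilon> \<le> 1"
  shows "ennreal ((\<epsilon> * density_const) ^ CARD('d)) \<le> (\<integral>\<^sup>+\<omega>. hit (2 * \<epsilon>) q \<omega> \<partial>product_measure)"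
proof -
  obtain i j k where q_eq: "q = (i, j, k)" by (metis prod.exhaust)
  let ?v = "s1 * (g + 4 * U)"
  have v: "0 \<le> ?v" using s1_pos g_pos U_pos by simp
  have "real (j + k) * h \<le> 4 * U" using q by (intro times_h_le) (auto simp: q_eq)
  then have "x i * (g + (real j + real k) * h) \<le> ?v"
    using q x_le[of i] g_pos h_pos s1_pos by (intro mult_mono) (auto simp: q_eq)
  then have "sum area (region q) \<le> ?v"
    using q by (simp add: q_eq sum_area_region)
  then have "ennreal ((2 * \<epsilon> / (4 * sqrt (?v + (2 * \<epsilon>)\<^sup>2))) ^ CARD('d)) \<le> (\<integral>\<^sup>+\<omega>. hit (2 * \<epsilon>) q \<omega> \<partial>product_measure)"
    unfolding hit_def using q \<epsilon>_pos by (intro nn_integral_small_noise_ge region_subset) auto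
  moreover have "\<epsilon> * density_const \<le> 2 * \<epsilon> / (4 * sqrt (?v + (2 * \<epsilon>)\<^sup>2))"
  proof -
    have "(2 * \<epsilon>)\<^sup>2 \<le> 4" using power_le_one[of \<epsilon> 2] \<epsilon> \<epsilon>_pos by (simp add: power_mult_distrib)
    then have "sqrt (?v + (2 * \<epsilon>)\<^sup>2) \<le> sqrt (?v + 4)" by simp
    then have "\<epsilon> / (2 * sqrt (?v + 4)) \<le> \<epsilon> / (2 * sqrt (?v + (2 * \<epsilon>)\<^sup>2))"
      using \<epsilon>_pos v by (intro divide_left_mono) (auto intro!: mult_pos_pos add_nonneg_pos)
    then show ?thesis by (simp add: density_const_def)
  qed
  then have "ennreal ((\<epsilon> * density_const) ^ CARD('d)) \<le> ennreal ((2 * \<epsilon> / (4 * sqrt (?v + (2 * \<epsilon>)\<^sup>2))) ^ CARD('d))"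
    using \<epsilon>_pos density_const_pos by (intro ennreal_leI power_mono) auto
  ultimately show ?thesis by (rule order_trans[rotated])
qed

lemma nn_integral_occupation_ge:
  assumes p: "\<And>i. 0 \<le> p i" "(\<Sum>i\<in>{1..n}. p i) = 1" and \<epsilon>: "\<epsilon> \<le> 1"
  shows "ennreal (density_const ^ CARD('d)) \<le> (\<integral>\<^sup>+\<omega>. occupation p \<omega> \<partial>product_measure)"
proof -
  let ?d = "CARD('d)" and ?Q = "slots (2 * N)"
  have "(\<Sum>q\<in>?Q. weight p q) = 4 / \<epsilon> ^ ?d"
    using N_pos \<epsilon>_pos p(2)
    by (simp add: sum.cartesian_product' weight_def power2_eq_square flip: sum_divide_distrib sum_distrib_left)
  then have "(\<Sum>q\<in>?Q. weight p q * (\<epsilon> * density_const) ^ ?d) = 4 * density_const ^ ?d"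
    using \<epsilon>_pos by (simp add: power_mult_distrib flip: sum_distrib_right)
  moreover have "0 < density_const ^ ?d" using density_const_pos by simp
  ultimately have "ennreal (density_const ^ ?d) \<le> ennreal (\<Sum>q\<in>?Q. weight p q * (\<epsilon> * density_const) ^ ?d)"
    by (intro ennreal_leI) linarith
  also have "\<dots> = (\<Sum>q\<in>?Q. ennreal (weight p q) * ennreal ((\<epsilon> * density_const) ^ ?d))"
    using weight_nonneg[of p, OF p(1)] \<epsilon>_pos density_const_pos by (simp add: ennreal_mult flip: sum_ennreal)
  also have "\<dots> \<le> (\<Sum>q\<in>?Q. ennreal (weight p q) * (\<integral>\<^sup>+\<omega>. hit (2 * \<epsilon>) q \<omega> \<partial>product_measure))"
    by (intro sum_mono mult_left_mono nn_integral_hit_ge \<epsilon>) auto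
  also have "\<dots> = (\<integral>\<^sup>+\<omega>. occupation p \<omega> \<partial>product_measure)"
    unfolding occupation_def
    by (subst nn_integral_sum, (intro borel_measurable_times_ennreal measurable_hit borel_measurable_const; assumption),
        intro sum.cong refl nn_integral_cmult[symmetric] measurable_hit)
  finally show ?thesis .
qed

theorem prob_hit_event_ge:
  assumes p: "\<And>i. 0 \<le> p i" "(\<Sum>i\<in>{1..n}. p i) = 1" and \<epsilon>: "\<epsilon> \<le> 1"
  shows "(density_const ^ CARD('d))\<^sup>2
      \<le> measure product_measure (hit_event (2 * \<epsilon>) (2 * N)) * (64 * pair_const ^ CARD('d) * grid_energy p)"
proof -
  define H where "H = hit_event (2 * \<epsilon>) (2 * N)"
  define e where "e = 64 * pair_const ^ CARD('d) * grid_energy p"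
  have e: "0 \<le> e" using pair_const_pos grid_energy_nonneg[of p, OF p(1)] by (simp add: e_def)
  have H[measurable]: "H \<in> sets product_measure" unfolding H_def by (rule sets_hit_event) simp
  have "occupation p \<omega> = occupation p \<omega> * indicator H \<omega>" if "\<omega> \<in> space product_measure" for \<omega>
    using that by (auto simp: H_def hit_event_def occupation_def indicator_def intro!: sum.neutral)
  then have "(\<integral>\<^sup>+\<omega>. occupation p \<omega> \<partial>product_measure)\<^sup>2 = (\<integral>\<^sup>+\<omega>. occupation p \<omega> * indicator H \<omega> \<partial>product_measure)\<^sup>2"
    by (intro arg_cong[where f="\<lambda>a. a\<^sup>2"] nn_integral_cong)
  also have "\<dots> \<le> (\<integral>\<^sup>+\<omega>. (occupation p \<omega>)\<^sup>2 \<partial>product_measure) * (\<integral>\<^sup>+\<omega>. (indicator H \<omega>)\<^sup>2 \<partial>product_measure)"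
    by (intro Cauchy_Schwarz_nn_integral) auto
  also have "(\<integral>\<^sup>+\<omega>. (indicator H \<omega>)\<^sup>2 \<partial>product_measure) = emeasure product_measure H"
    by (simp add: power2_eq_square indicator_inter_arith[symmetric])
  also have "(\<integral>\<^sup>+\<omega>. (occupation p \<omega>)\<^sup>2 \<partial>product_measure) * emeasure product_measure H \<le> ennreal e * emeasure product_measure H"
    unfolding e_def by (intro mult_right_mono nn_integral_power2_occupation_le p(1)) auto
  also have "\<dots> = ennreal (measure product_measure H * e)"
    using e by (simp add: emeasure_eq_measure ennreal_mult mult.commute)
  finally have "(ennreal (density_const ^ CARD('d)))\<^sup>2 \<le> ennreal (measure product_measure H * e)"
    using power_mono[OF nn_integral_occupation_ge[OF p \<epsilon>], of 2] by (meson order_trans zero_le)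
  then show ?thesis
    unfolding H_def[symmetric] e_def[symmetric] using e density_const_pos by (simp add: ennreal_power)
qed

subsection \<open>The future of a hitting time\<close>

definition future :: "nat \<times> nat \<times> nat \<Rightarrow> ((nat \<times> int) \<times> 'd) set" where
  "future q = (cells - region q) \<times> UNIV"

lemma doob_bound_future: "doob_bound 64 (slots N) future"
proof -
  have "doob_bound 4 {1..n} (\<lambda>i. {c\<in>cells. i < fst c} \<times> UNIV)"
      "doob_bound 4 {..<N} (\<lambda>j. {c\<in>cells. snd c < - int j} \<times> UNIV)"
      "doob_bound 4 {..<N} (\<lambda>k. {c\<in>cells. int k < snd c} \<times> UNIV)"
    by (rule doob_bound_chain; auto)+
  note doob_bound_Times[OF this(1) doob_bound_Times[OF this(2,3)]]
  then have "doob_bound (4 * (4 * 4)) (slots N) future"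
    by (rule doob_bound_cong) (auto simp: future_def cells_def region_def)
  then show ?thesis by simp
qed

lemma pair_kernel_le_power:
  "(\<epsilon> / (4 * sqrt size_bound)) ^ CARD('d) * pair_kernel q q'
    \<le> (\<epsilon> / (4 * sqrt (size_bound * gap q q' + \<epsilon>\<^sup>2))) ^ CARD('d)"
proof -
  have K: "1 \<le> size_bound" by (simp add: size_bound_def)
  have "(\<epsilon> / (4 * sqrt size_bound)) ^ CARD('d) * pair_kernel q q'
      = (\<epsilon> / (4 * (sqrt size_bound * sqrt (gap q q' + \<epsilon>\<^sup>2)))) ^ CARD('d)"
    unfolding pair_kernel_def inverse_sqrt_power[OF gap_plus_pos, symmetric] power_mult_distrib[symmetric]
    by (simp add: mult.assoc)
  also have "\<dots> \<le> (\<epsilon> / (4 * sqrt (size_bound * gap q q' + \<epsilon>\<^sup>2))) ^ CARD('d)"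
  proof (intro power_mono divide_left_mono mult_left_mono mult_pos_pos)
    have "size_bound * gap q q' + \<epsilon>\<^sup>2 \<le> size_bound * (gap q q' + \<epsilon>\<^sup>2)"
      using K mult_right_mono[of 1 size_bound "\<epsilon>\<^sup>2"] by (simp add: distrib_left)
    then show "sqrt (size_bound * gap q q' + \<epsilon>\<^sup>2) \<le> sqrt size_bound * sqrt (gap q q' + \<epsilon>\<^sup>2)"
      unfolding real_sqrt_mult[symmetric] by (rule real_sqrt_le_mono)
  qed (use K gap_plus_pos[of q q'] gap_nonneg[of q q'] \<epsilon>_pos in \<open>auto intro!: add_nonneg_pos mult_nonneg_nonneg\<close>)
  finally show ?thesis .
qed

text \<open>The increments from a hitting time to later times are independent of its past.\<close>

lemma resample_future_hit_ge:
  assumes q: "(i, j, k) \<in> slots N" and hit: "hit \<epsilon> (i, j, k) \<omega> \<noteq> 0"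
    and q': "(i', j', k') \<in> {i..n} \<times> {j..<j + N} \<times> {k..<k + N}"
  shows "ennreal ((\<epsilon> / (4 * sqrt size_bound)) ^ CARD('d) * pair_kernel (i, j, k) (i', j', k'))
    \<le> resample (future (i, j, k)) (hit (2 * \<epsilon>) (i', j', k')) \<omega>"
proof -
  let ?q = "(i, j, k)" and ?q' = "(i', j', k')"
  let ?R = "region ?q" and ?R' = "region ?q'"
  have slots: "?q \<in> slots (2 * N)" "?q' \<in> slots (2 * N)" using q q' by auto
  have sub: "?R \<subseteq> ?R'" "?R' \<subseteq> cells" "?R \<subseteq> cells"
    using q' by (intro region_mono region_subset slots; auto)+
  have "ennreal ((\<epsilon> / (4 * sqrt size_bound)) ^ CARD('d) * pair_kernel ?q ?q')
      \<le> ennreal ((\<epsilon> / (4 * sqrt (size_bound * gap ?q ?q' + \<epsilon>\<^sup>2))) ^ CARD('d))"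
    by (rule ennreal_leI[OF pair_kernel_le_power])
  also have "\<dots> \<le> (\<integral>\<^sup>+\<omega>'. small \<epsilon> (noise (?R' - ?R) \<omega>') \<partial>product_measure)"
    using sub slots q' \<epsilon>_pos by (intro nn_integral_small_noise_ge area_diff_le_gap) auto
  also have "\<dots> \<le> (\<integral>\<^sup>+\<omega>'. hit (2 * \<epsilon>) ?q' (mix (future ?q) \<omega> \<omega>') \<partial>product_measure)"
  proof (rule nn_integral_mono)
    fix \<omega>'
    have "noise ?R' (mix (future ?q) \<omega> \<omega>') l = noise ?R \<omega> l + noise (?R' - ?R) \<omega>' l" for l
    proof -
      have "noise ?R (mix (future ?q) \<omega> \<omega>') = noise ?R \<omega>"
        unfolding future_def using sub by (intro noise_mix_disjoint) auto
      moreover have "noise (?R' - ?R) (mix (future ?q) \<omega> \<omega>') = noise (?R' - ?R) \<omega>'"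
        unfolding future_def using sub by (intro noise_mix_subset) auto
      ultimately show ?thesis
        using noise_split[OF sub(1,2), of "mix (future ?q) \<omega> \<omega>'" l] by simp
    qed
    moreover have "\<bar>noise ?R \<omega> l\<bar> \<le> \<epsilon>" for l
      using hit by (auto simp: hit_def small_def split: if_splits)
    then have "\<bar>noise ?R \<omega> l + noise (?R' - ?R) \<omega>' l\<bar> \<le> 2 * \<epsilon>" if "\<bar>noise (?R' - ?R) \<omega>' l\<bar> \<le> \<epsilon>" for l
      using that by (smt (verit))
    ultimately show "small \<epsilon> (noise (?R' - ?R) \<omega>') \<le> hit (2 * \<epsilon>) ?q' (mix (future ?q) \<omega> \<omega>')"
      by (auto simp: hit_def small_def)
  qed
  finally show ?thesis by (simp add: resample_def)
qed

lemma resample_occupation: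
  assumes \<omega>: "\<omega> \<in> space product_measure"
  shows "resample S (occupation p) \<omega> = (\<Sum>q\<in>slots (2 * N). ennreal (weight p q) * resample S (hit (2 * \<epsilon>) q) \<omega>)"
proof -
  have "resample S (occupation p) \<omega>
      = (\<Sum>q\<in>slots (2 * N). resample S (\<lambda>\<omega>. ennreal (weight p q) * hit (2 * \<epsilon>) q \<omega>) \<omega>)"
    unfolding occupation_def[abs_def]
    by (intro resample_sum borel_measurable_times_ennreal measurable_hit borel_measurable_const \<omega>)
  then show ?thesis
    by (simp add: resample_cmult measurable_hit \<omega> cong: sum.cong)
qed

lemma resample_future_occupation_ge:
  assumes p: "\<And>i. 0 \<le> p i" and q: "(i, j, k) \<in> slots N" and hit: "hit \<epsilon> (i, j, k) \<omega> \<noteq> 0"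
    and \<omega>: "\<omega> \<in> space product_measure"
  shows "ennreal ((1 / (4 * sqrt size_bound)) ^ CARD('d) * (\<Sum>i'\<in>{i..n}. p i' * grid_kernel i i'))
    \<le> resample (future (i, j, k)) (occupation p) \<omega>"
proof -
  let ?d = "CARD('d)" and ?K = size_bound
  define Q where "Q = {i..n} \<times> {j..<j + N} \<times> {k..<k + N}"
  have Q: "Q \<subseteq> slots (2 * N)" using q by (auto simp: Q_def)
  have "(1 / (4 * sqrt ?K)) ^ ?d * (\<Sum>i'\<in>{i..n}. p i' * grid_kernel i i')
      = (\<Sum>i'\<in>{i..n}. p i' / ((real N)\<^sup>2 * \<epsilon> ^ ?d) * (\<epsilon> / (4 * sqrt ?K)) ^ ?d * ((real N)\<^sup>2 * grid_kernel i i'))"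
    unfolding sum_distrib_left using N_pos \<epsilon>_pos by (intro sum.cong refl) (simp add: power_divide)
  also have "\<dots> = (\<Sum>q'\<in>Q. weight p q' * ((\<epsilon> / (4 * sqrt ?K)) ^ ?d * pair_kernel (i, j, k) q'))"
    unfolding sum_pair_kernel_shift[of i j k, symmetric] Q_def
    by (simp add: sum.cartesian_product' sum_distrib_left weight_def mult.assoc)
  finally have "ennreal ((1 / (4 * sqrt ?K)) ^ ?d * (\<Sum>i'\<in>{i..n}. p i' * grid_kernel i i'))
      = (\<Sum>q'\<in>Q. ennreal (weight p q') * ennreal ((\<epsilon> / (4 * sqrt ?K)) ^ ?d * pair_kernel (i, j, k) q'))"
    using weight_nonneg[of p, OF p] \<epsilon>_pos
    by (simp add: ennreal_mult[symmetric] pair_kernel_def size_bound_def flip: sum_ennreal)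
  also have "\<dots> \<le> (\<Sum>q'\<in>Q. ennreal (weight p q') * resample (future (i, j, k)) (hit (2 * \<epsilon>) q') \<omega>)"
    using resample_future_hit_ge[OF q hit] by (intro sum_mono mult_left_mono) (auto simp: Q_def)
  also have "\<dots> \<le> resample (future (i, j, k)) (occupation p) \<omega>"
    unfolding resample_occupation[OF \<omega>] using Q by (intro sum_mono2) auto
  finally show ?thesis .
qed

lemma sum_potential_le_resample_occupation:
  assumes A[measurable]: "\<And>q. q \<in> slots N \<Longrightarrow> A q \<in> sets product_measure"
    and hit: "\<And>q \<omega>. q \<in> slots N \<Longrightarrow> \<omega> \<in> A q \<Longrightarrow> hit \<epsilon> q \<omega> \<noteq> 0" and p: "\<And>i. 0 \<le> p i"
  shows "ennreal (\<Sum>q\<in>slots N. measure product_measure (A q) *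
      ((1 / (4 * sqrt size_bound)) ^ CARD('d) * (\<Sum>i'\<in>{fst q..n}. p i' * grid_kernel (fst q) i')))
    \<le> (\<Sum>q\<in>slots N. \<integral>\<^sup>+\<omega>. indicator (A q) \<omega> * resample (future q) (occupation p) \<omega> \<partial>product_measure)"
proof -
  define L where "L i = (1 / (4 * sqrt size_bound)) ^ CARD('d) * (\<Sum>i'\<in>{i..n}. p i' * grid_kernel i i')" for i
  have L: "0 \<le> L i" for i
    unfolding L_def by (intro sum_nonneg mult_nonneg_nonneg p grid_kernel_nonneg) (simp add: size_bound_def)
  have "ennreal (\<Sum>q\<in>slots N. measure product_measure (A q) * L (fst q))
      = (\<Sum>q\<in>slots N. ennreal (measure product_measure (A q)) * ennreal (L (fst q)))"
    using L by (simp add: ennreal_mult[symmetric] flip: sum_ennreal)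
  also have "\<dots> = (\<Sum>q\<in>slots N. \<integral>\<^sup>+\<omega>. indicator (A q) \<omega> * ennreal (L (fst q)) \<partial>product_measure)"
    by (intro sum.cong refl) (simp add: nn_integral_multc emeasure_eq_measure)
  also have "\<dots> \<le> (\<Sum>q\<in>slots N. \<integral>\<^sup>+\<omega>. indicator (A q) \<omega> * resample (future q) (occupation p) \<omega> \<partial>product_measure)"
  proof (intro sum_mono nn_integral_mono)
    fix q \<omega> assume "q \<in> slots N" "\<omega> \<in> space product_measure"
    then show "indicator (A q) \<omega> * ennreal (L (fst q)) \<le> indicator (A q) \<omega> * resample (future q) (occupation p) \<omega>"
      using resample_future_occupation_ge[of p "fst q" "fst (snd q)" "snd (snd q)" \<omega>, OF p] hit[of q \<omega>]
      by (auto simp: indicator_def L_def)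
  qed
  finally show ?thesis unfolding L_def .
qed

text \<open>The factors of 16384: 64 from \<^const>\<open>doob_bound\<close>, 64 from the second moment of \<^const>\<open>occupation\<close>,
  and 4 from passing to the indices above the diagonal.\<close>
definition energy_const :: "nat \<Rightarrow> real" where
  "energy_const d = 16384 * pair_const ^ d * ((4 * sqrt size_bound) ^ d)\<^sup>2"

lemma energy_le_of_disjoint_hits:
  assumes A[measurable]: "\<And>q. q \<in> slots N \<Longrightarrow> A q \<in> sets product_measure" and disjoint: "disjoint_family_on A (slots N)"
    and hit: "\<And>q \<omega>. q \<in> slots N \<Longrightarrow> \<omega> \<in> A q \<Longrightarrow> hit \<epsilon> q \<omega> \<noteq> 0"
    and p: "\<And>i. 0 \<le> p i"
      "\<And>i. measure product_measure (\<Union>q\<in>slots N. A q) * p i = (\<Sum>j<N. \<Sum>k<N. measure product_measure (A (i, j, k)))"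
    and P_pos: "0 < measure product_measure (\<Union>q\<in>slots N. A q)"
  shows "measure product_measure (\<Union>q\<in>slots N. A q) * grid_energy p
    \<le> energy_const CARD('d)"
proof -
  let ?d = "CARD('d)"
  define P where "P = measure product_measure (\<Union>q\<in>slots N. A q)"
  define D where "D = (4 * sqrt size_bound) ^ ?d"
  define E where "E = grid_energy p"
  define L where "L i = (\<Sum>i'\<in>{i..n}. p i' * grid_kernel i i')" for i
  define S where "S = (\<Sum>i\<in>{1..n}. p i * L i)"
  have P: "0 < P" and D: "0 < D" and E: "0 \<le> E"
    using P_pos grid_energy_nonneg[of p] p(1) by (simp_all add: P_def D_def E_def size_bound_def)
  have S: "0 \<le> S" unfolding S_def L_def by (intro sum_nonneg mult_nonneg_nonneg p grid_kernel_nonneg)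
  have "P * S / D = (\<Sum>i\<in>{1..n}. (P * p i) * (L i / D))"
    by (simp add: S_def sum_distrib_left sum_divide_distrib mult.assoc)
  also have "\<dots> = (\<Sum>q\<in>slots N. measure product_measure (A q) * (L (fst q) / D))"
    by (simp add: p(2)[folded P_def] sum.cartesian_product' sum_distrib_right sum_divide_distrib)
  finally have potential: "ennreal (P * S / D)
      \<le> (\<Sum>q\<in>slots N. \<integral>\<^sup>+\<omega>. indicator (A q) \<omega> * resample (future q) (occupation p) \<omega> \<partial>product_measure)"
    using sum_potential_le_resample_occupation[of A p, OF A hit p(1)] by (simp add: L_def D_def power_divide)
  have "(ennreal (P * S / D))\<^sup>2
      \<le> (\<Sum>q\<in>slots N. \<integral>\<^sup>+\<omega>. indicator (A q) \<omega> * resample (future q) (occupation p) \<omega> \<partial>product_measure)\<^sup>2"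
    using potential by (intro power_mono) auto
  also have "\<dots> \<le> 64 * emeasure product_measure (\<Union>q\<in>slots N. A q) * (\<integral>\<^sup>+\<omega>. (occupation p \<omega>)\<^sup>2 \<partial>product_measure)"
    by (intro doob_bound_disjoint_events doob_bound_future disjoint) auto
  also have "\<dots> \<le> 64 * ennreal P * ennreal (64 * pair_const ^ ?d * E)"
    unfolding E_def P_def emeasure_eq_measure by (intro mult_left_mono nn_integral_power2_occupation_le p) auto
  also have "\<dots> = ennreal (4096 * (P * (pair_const ^ ?d * E)))"
    using P E pair_const_pos by (simp add: ennreal_mult mult.assoc mult.left_commute)
  finally have "(P * S / D)\<^sup>2 \<le> 4096 * (P * (pair_const ^ ?d * E))"
    using P D S E pair_const_pos by (simp add: ennreal_power ennreal_le_iff)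
  moreover have "(P * E / (2 * D))\<^sup>2 \<le> (P * S / D)\<^sup>2"
  proof (intro power_mono)
    have "P * E \<le> P * (2 * S)"
      using P grid_energy_le_double_sum_upper[of p, OF p(1)] by (intro mult_left_mono) (auto simp: E_def S_def L_def)
    then show "P * E / (2 * D) \<le> P * S / D"
      using D by (simp add: field_simps)
  qed (use P E D in simp)
  ultimately have "(P * E) * (P * E) \<le> (P * E) * (16384 * pair_const ^ ?d * D\<^sup>2)"
    using D by (simp add: power2_eq_square field_simps)
  then have "P * E \<le> 16384 * pair_const ^ ?d * D\<^sup>2"
    using P E D pair_const_pos by (cases "E = 0") (auto simp: mult_le_cancel_left)
  then show ?thesis by (simp add: P_def E_def D_def energy_const_def)
qed

theorem exists_energy_of_hit_event:
  assumes pos: "0 < measure product_measure (hit_event \<epsilon> N)"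
  obtains p where "\<And>i. 0 \<le> p i" "(\<Sum>i\<in>{1..n}. p i) = 1"
    "measure product_measure (hit_event \<epsilon> N) * grid_energy p \<le> energy_const CARD('d)"
proof -
  have sets: "{\<omega>\<in>space product_measure. hit \<epsilon> q \<omega> \<noteq> 0} \<in> sets product_measure" if "q \<in> slots N" for q
    using that by (intro sets_hit_nonzero) auto
  have finite_slots: "finite (slots N)" by simp
  obtain A where A: "\<And>q. q \<in> slots N \<Longrightarrow> A q \<in> sets product_measure"
    "\<And>q. q \<in> slots N \<Longrightarrow> A q \<subseteq> {\<omega>\<in>space product_measure. hit \<epsilon> q \<omega> \<noteq> 0}"
    and disjoint: "disjoint_family_on A (slots N)"
    and "(\<Union>q\<in>slots N. A q) = (\<Union>q\<in>slots N. {\<omega>\<in>space product_measure. hit \<epsilon> q \<omega> \<noteq> 0})"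
    by (rule finite_disjoint_refinement[OF finite_slots sets]) (assumption, rule that)
  then have union: "(\<Union>q\<in>slots N. A q) = hit_event \<epsilon> N" by (simp only: hit_event_def)
  define P where "P = measure product_measure (hit_event \<epsilon> N)"
  define p where "p i = (\<Sum>j<N. \<Sum>k<N. measure product_measure (A (i, j, k))) / P" for i
  have nonneg: "0 \<le> p i" for i
    unfolding p_def using pos by (auto simp: P_def intro!: divide_nonneg_pos sum_nonneg)
  moreover have "(\<Sum>i\<in>{1..n}. p i) = 1"
  proof -
    have "P = (\<Sum>q\<in>slots N. measure product_measure (A q))"
      unfolding P_def union[symmetric] using A(1) disjoint by (intro finite_measure_finite_Union) auto
    then show ?thesis
      using pos by (simp add: p_def P_def sum.cartesian_product' flip: sum_divide_distrib)
  qed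
  moreover have "measure product_measure (hit_event \<epsilon> N) * grid_energy p
      \<le> energy_const CARD('d)"
    unfolding union[symmetric]
  proof (rule energy_le_of_disjoint_hits[OF A(1) disjoint _ nonneg])
    show "hit \<epsilon> q \<omega> \<noteq> 0" if "q \<in> slots N" "\<omega> \<in> A q" for q \<omega>
      using A(2)[OF that(1)] that(2) by blast
    show "measure product_measure (\<Union>q\<in>slots N. A q) * p i = (\<Sum>j<N. \<Sum>k<N. measure product_measure (A (i, j, k)))" for i
      unfolding union using pos by (simp add: p_def P_def)
    show "0 < measure product_measure (\<Union>q\<in>slots N. A q)"
      unfolding union by (rule pos)
  qed
  ultimately show ?thesis by (rule that)
qed

end

subsection \<open>The increments of the sheet on a grid\<close>

lemma gaussian_family_brownian_sheet:
  fixes B :: "real \<times> real \<Rightarrow> 'a \<Rightarrow> real ^ 'd"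
  assumes B: "brownian_sheet M B"
  shows "gaussian_family M {(s, t, i). 0 \<le> s \<and> 0 \<le> t} (\<lambda>(s, t, i) \<omega>. B (s, t) \<omega> $ i)
    (\<lambda>(s, t, i) (u, v, j). min s u * min t v * (if i = j then 1 else 0))"
  unfolding gaussian_family_def
proof (intro allI impI)
  fix xs :: "((real \<times> real \<times> 'd) \<times> real) list"
  assume "\<forall>(k, a)\<in>set xs. k \<in> {(s, t, i). 0 \<le> s \<and> 0 \<le> t}"
  then have nonneg: "\<forall>(s, t, i, a)\<in>set (map (\<lambda>((s, t, i), a). (s, t, i, a)) xs). 0 \<le> s \<and> 0 \<le> t"
    by auto
  have "centered_gaussian_rv M (\<lambda>\<omega>. \<Sum>(s, t, i, a)\<leftarrow>ys. a * (B (s, t) \<omega> $ i))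
      (\<Sum>(s, t, i, a)\<leftarrow>ys. \<Sum>(u, v, j, e)\<leftarrow>ys. a * e * (min s u * min t v * (if i = j then 1 else 0)))"
    if "\<forall>(s, t, i, a)\<in>set ys. 0 \<le> s \<and> 0 \<le> t" for ys :: "(real \<times> real \<times> 'd \<times> real) list"
    using B that unfolding brownian_sheet_def by blast
  from this[OF nonneg]
  show "centered_gaussian_rv M (\<lambda>\<omega>. \<Sum>(k, a)\<leftarrow>xs. a * (case k of (s, t, i) \<Rightarrow> \<lambda>\<omega>. B (s, t) \<omega> $ i) \<omega>)
    (\<Sum>(k, a)\<leftarrow>xs. \<Sum>(k', b)\<leftarrow>xs. a * b * (case k of (s, t, i) \<Rightarrow> \<lambda>(u, v, j). min s u * min t v * (if i = j then 1 else 0)) k')"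
    by (simp add: comp_def case_prod_unfold)
qed

lemma min_increment_disjoint:
  fixes a b a' b' :: real
  assumes "a \<le> b" "a' \<le> b'" "b \<le> a' \<or> b' \<le> a"
  shows "min b b' - min b a' - min a b' + min a a' = 0"
  using assms by (auto simp: min_def)

locale sheet_grid = grid_noise n N x "c - b" U s0 s1 \<epsilon> dim
  for n N x b c U s0 s1 \<epsilon> and dim :: "'d::finite itself" +
  fixes M :: "'a measure" and B :: "real \<times> real \<Rightarrow> 'a \<Rightarrow> real ^ 'd"
  assumes sheet: "brownian_sheet M B" and b_ge: "2 * U \<le> b"
begin

sublocale MP: prob_space M
  using sheet by (simp add: brownian_sheet_def)

definition mesh :: "int \<Rightarrow> real" where
  "mesh m = (if 0 \<le> m then c + real_of_int m * h else b + real_of_int (m + 1) * h)"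

lemma mesh_diff: "mesh m - mesh (m - 1) = height m"
  by (auto simp: mesh_def height_def algebra_simps)

lemma mesh_mono: "m \<le> m' \<Longrightarrow> mesh m \<le> mesh m'"
proof (induction m' rule: int_ge_induct)
  case (step m')
  then show ?case using mesh_diff[of "m' + 1"] height_pos[of "m' + 1"] by simp
qed simp

lemma mesh_nonneg:
  assumes "- int (2 * N) - 1 \<le> m"
  shows "0 \<le> mesh m"
proof -
  have "real (2 * N) * h \<le> 2 * U" by (rule times_h_le) simp
  then have "0 \<le> mesh (- int (2 * N) - 1)"
    using b_ge by (simp add: mesh_def)
  also have "\<dots> \<le> mesh m" using assms by (rule mesh_mono)
  finally show ?thesis .
qed

text \<open>On the axis the sheet vanishes only almost surely; setting it to 0 there does not change the covariances,
  because \<open>x 0 = 0\<close>.\<close>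

definition path :: "nat \<times> int \<times> 'd \<Rightarrow> 'a \<Rightarrow> real" where
  "path = (\<lambda>(i, m, l) \<omega>. if i = 0 then 0 else B (x i, mesh m) \<omega> $ l)"

definition strip_incr :: "nat \<times> int \<times> 'd \<Rightarrow> 'a \<Rightarrow> real" where
  "strip_incr = (\<lambda>(i, m, l) \<omega>. path (i, m, l) \<omega> - path (i, m - 1, l) \<omega>)"

definition cell_incr :: "(nat \<times> int) \<times> 'd \<Rightarrow> 'a \<Rightarrow> real" where
  "cell_incr = (\<lambda>((i, m), l) \<omega>. strip_incr (i, m, l) \<omega> - strip_incr (i - 1, m, l) \<omega>)"

lemma measurable_path:
  assumes "i \<le> n" "- int (2 * N) - 1 \<le> m"
  shows "path (i, m, l) \<in> borel_measurable M"
proof -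
  have [measurable]: "B (x i, mesh m) \<in> borel_measurable M"
    using sheet x_nonneg[OF assms(1)] mesh_nonneg[OF assms(2)] by (auto simp: brownian_sheet_def)
  show ?thesis unfolding path_def by (cases "i = 0") (auto intro: measurable_compose[OF _ borel_measurable_nth])
qed

lemma measurable_cell_incr: "k \<in> cells \<times> UNIV \<Longrightarrow> cell_incr k \<in> borel_measurable M"
  unfolding cell_incr_def strip_incr_def
  by (cases k) (auto simp: cells_def intro!: borel_measurable_diff measurable_path)

lemma gaussian_family_path:
  "gaussian_family M ({..n} \<times> {- int (2 * N) - 1..} \<times> UNIV) path
    (\<lambda>(i, m, l) (i', m', l'). min (x i) (x i') * min (mesh m) (mesh m') * (if l = l' then 1 else 0))"
proof -
  let ?f = "\<lambda>(i, m, l). (x i, mesh m, l)" and ?p = "\<lambda>(i, m, l). if i = (0::nat) then 0 else 1 :: real"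
  have in_quadrant: "?f k \<in> {(s, t, l). 0 \<le> s \<and> 0 \<le> t}" if "k \<in> {..n} \<times> {- int (2 * N) - 1..} \<times> UNIV" for k :: "nat \<times> int \<times> 'd"
    using that by (auto intro!: x_nonneg mesh_nonneg)
  have path_eq: "path = (\<lambda>k \<omega>. ?p k * (case ?f k of (s, t, l) \<Rightarrow> \<lambda>\<omega>. B (s, t) \<omega> $ l) \<omega>
      + 0 * (case ?f k of (s, t, l) \<Rightarrow> \<lambda>\<omega>. B (s, t) \<omega> $ l) \<omega>)"
    by (auto simp: path_def fun_eq_iff)
  show ?thesis
    unfolding path_eq
  proof (rule gaussian_family_cong
      [OF gaussian_family_two_term_combination[OF gaussian_family_brownian_sheet[OF sheet] in_quadrant in_quadrant]])
    fix k k' :: "nat \<times> int \<times> 'd"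
    assume "k \<in> {..n} \<times> {- int (2 * N) - 1..} \<times> UNIV" "k' \<in> {..n} \<times> {- int (2 * N) - 1..} \<times> UNIV"
    then have "0 \<le> x (fst k)" "0 \<le> x (fst k')" by (auto intro!: x_nonneg)
    then show "?p k * ?p k' * (case ?f k of (s, t, i) \<Rightarrow> \<lambda>(u, v, j). min s u * min t v * (if i = j then 1 else 0)) (?f k') +
        ?p k * 0 * (case ?f k of (s, t, i) \<Rightarrow> \<lambda>(u, v, j). min s u * min t v * (if i = j then 1 else 0)) (?f k') +
        0 * ?p k' * (case ?f k of (s, t, i) \<Rightarrow> \<lambda>(u, v, j). min s u * min t v * (if i = j then 1 else 0)) (?f k') +
        0 * 0 * (case ?f k of (s, t, i) \<Rightarrow> \<lambda>(u, v, j). min s u * min t v * (if i = j then 1 else 0)) (?f k')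
      = (case k of (i, m, l) \<Rightarrow> \<lambda>(i', m', l'). min (x i) (x i') * min (mesh m) (mesh m') * (if l = l' then 1 else 0)) k'"
      using x_0 by (auto split: prod.split)
  qed
qed

lemma gaussian_family_strip_incr:
  "gaussian_family M ({..n} \<times> {- int (2 * N)..} \<times> UNIV) strip_incr
    (\<lambda>(i, m, l) (i', m', l'). min (x i) (x i') * (if (m, l) = (m', l') then height m else 0))"
proof -
  let ?f = "\<lambda>(i, m, l). (i, m, l) :: nat \<times> int \<times> 'd" and ?g = "\<lambda>(i, m, l). (i, m - 1, l) :: nat \<times> int \<times> 'd"
  have strip_incr_eq: "strip_incr = (\<lambda>k \<omega>. 1 * path (?f k) \<omega> + -1 * path (?g k) \<omega>)"
    by (auto simp: strip_incr_def fun_eq_iff)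
  have overlap: "min (mesh m) (mesh m') - min (mesh m) (mesh (m' - 1)) - min (mesh (m - 1)) (mesh m')
      + min (mesh (m - 1)) (mesh (m' - 1))
      = (if m = m' then height m else 0)" for m m'
  proof (cases "m = m'")
    case True
    then show ?thesis using mesh_mono[of "m - 1" m] mesh_diff[of m] by simp
  next
    case False
    then have "mesh m \<le> mesh (m' - 1) \<or> mesh m' \<le> mesh (m - 1)"
      using mesh_mono[of m "m' - 1"] mesh_mono[of m' "m - 1"] by linarith
    then show ?thesis using False by (simp add: min_increment_disjoint mesh_mono)
  qed
  have "gaussian_family M ({..n} \<times> {- int (2 * N)..} \<times> UNIV) (\<lambda>k \<omega>. 1 * path (?f k) \<omega> + -1 * path (?g k) \<omega>)
      (\<lambda>(i, m, l) (i', m', l'). min (x i) (x i') *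
        (min (mesh m) (mesh m') - min (mesh m) (mesh (m' - 1)) - min (mesh (m - 1)) (mesh m') + min (mesh (m - 1)) (mesh (m' - 1)))
        * (if l = l' then 1 else 0))"
    by (rule gaussian_family_cong
        [OF gaussian_family_two_term_combination[OF gaussian_family_path, of _ ?f ?g "\<lambda>_. 1" "\<lambda>_. -1"]])
       (auto simp: algebra_simps)
  then show ?thesis
    unfolding strip_incr_eq[symmetric] overlap by (rule gaussian_family_cong) auto
qed

lemma gaussian_family_cell_incr:
  "gaussian_family M (cells \<times> UNIV) cell_incr (\<lambda>k k'. if k = k' then area (fst k) else 0)"
proof -
  let ?C = "\<lambda>((i, m), l) ((i', m'), l').
    (min (x i) (x i') - min (x i) (x (i' - 1)) - min (x (i - 1)) (x i') + min (x (i - 1)) (x (i' - 1)))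
    * (if (m, l) = (m', l') then height m else 0)"
  let ?f = "\<lambda>((i, m), l). (i, m, l) :: nat \<times> int \<times> 'd" and ?g = "\<lambda>((i, m), l). (i - 1, m, l) :: nat \<times> int \<times> 'd"
  have cell_incr_eq: "cell_incr = (\<lambda>k \<omega>. 1 * strip_incr (?f k) \<omega> + -1 * strip_incr (?g k) \<omega>)"
    by (auto simp: cell_incr_def fun_eq_iff)
  have overlap: "min (x i) (x i') - min (x i) (x (i' - 1)) - min (x (i - 1)) (x i') + min (x (i - 1)) (x (i' - 1))
      = (if i = i' then x i - x (i - 1) else 0)" if "i \<in> {1..n}" "i' \<in> {1..n}" for i i'
  proof (cases "i = i'")
    case True
    then show ?thesis using x_mono[of "i - 1" i] that by simp
  next
    case False
    then have "x i \<le> x (i' - 1) \<or> x i' \<le> x (i - 1)"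
      using x_mono[of i "i' - 1"] x_mono[of i' "i - 1"] that by (cases "i < i'") auto
    then show ?thesis using False that by (simp add: min_increment_disjoint x_mono)
  qed
  have "gaussian_family M (cells \<times> UNIV) (\<lambda>k \<omega>. 1 * strip_incr (?f k) \<omega> + -1 * strip_incr (?g k) \<omega>)
      ?C"
    by (rule gaussian_family_cong
        [OF gaussian_family_two_term_combination[OF gaussian_family_strip_incr, of _ ?f ?g "\<lambda>_. 1" "\<lambda>_. -1"]])
       (auto simp: cells_def algebra_simps)
  then show ?thesis
    unfolding cell_incr_eq[symmetric]
  proof (rule gaussian_family_cong)
    fix k k' :: "(nat \<times> int) \<times> 'd" assume k: "k \<in> cells \<times> UNIV" "k' \<in> cells \<times> UNIV"
    obtain i m l i' m' l' where k_eq: "k = ((i, m), l)" "k' = ((i', m'), l')" by (metis prod.exhaust)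
    have "i \<in> {1..n}" "i' \<in> {1..n}" using k by (auto simp: k_eq cells_def)
    then show "?C k k' = (if k = k' then area (fst k) else 0)"
      using k by (simp only: k_eq prod.case overlap) (simp add: area_def)
  qed
qed

definition cell_incrs :: "'a \<Rightarrow> (nat \<times> int) \<times> 'd \<Rightarrow> real" where
  "cell_incrs = (\<lambda>\<omega>. \<lambda>k\<in>cells \<times> UNIV. cell_incr k \<omega>)"

lemma measurable_cell_incrs: "cell_incrs \<in> M \<rightarrow>\<^sub>M product_measure"
  unfolding cell_incrs_def
  using measurable_cell_incr by (intro measurable_restrict) (auto simp: measurable_def)

lemma distr_cell_incrs: "distr M product_measure cell_incrs = product_measure"
proof -
  have "cells \<times> (UNIV :: 'd set) \<noteq> {}" using n_pos by (auto simp: cells_def)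
  then have "distr M (\<Pi>\<^sub>M k\<in>cells \<times> UNIV. borel) (\<lambda>\<omega>. \<lambda>k\<in>cells \<times> UNIV. cell_incr k \<omega>) = product_measure"
    using finite_cells w_pos
    by (intro MP.distr_PiM_gaussian_family gaussian_family_cell_incr measurable_cell_incr) auto
  moreover have "sets (\<Pi>\<^sub>M k\<in>cells \<times> (UNIV::'d set). borel :: real measure) = sets product_measure"
    by (intro sets_PiM_cong) auto
  ultimately show ?thesis
    unfolding cell_incrs_def by (metis (no_types, lifting) distr_cong)
qed

lemma noise_cell_incrs:
  assumes q: "(i, j, k) \<in> slots (2 * N)"
  shows "noise (region (i, j, k)) (cell_incrs \<omega>) l
    = B (x i, c + real k * h) \<omega> $ l - B (x i, b - real j * h) \<omega> $ l"
proof -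
  have "noise (region (i, j, k)) (cell_incrs \<omega>) l = (\<Sum>c\<in>region (i, j, k). cell_incr (c, l) \<omega>)"
    unfolding noise_def cell_incrs_def using region_subset[OF q] by (intro sum.cong) auto
  also have "\<dots> = (\<Sum>m\<in>{- int j..int k}. \<Sum>i'\<in>{Suc 0..i}. strip_incr (i', m, l) \<omega> - strip_incr (i' - 1, m, l) \<omega>)"
    by (subst sum.swap) (simp add: region_def sum.cartesian_product' cell_incr_def)
  also have "\<dots> = (\<Sum>m\<in>{- int j..int k}. strip_incr (i, m, l) \<omega> - strip_incr (0, m, l) \<omega>)"
    by (intro sum.cong refl sum_telescope'') simp
  also have "\<dots> = (\<Sum>m\<in>{- int j..int k}. path (i, m, l) \<omega> - path (i, m - 1, l) \<omega>)"
    by (simp add: strip_incr_def path_def)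
  also have "\<dots> = path (i, int k, l) \<omega> - path (i, - int j - 1, l) \<omega>"
    by (rule sum_int_telescope) simp
  finally show ?thesis
    using q by (simp add: path_def mesh_def)
qed

definition sheet_hit_event :: "real \<Rightarrow> nat \<Rightarrow> 'a set" where
  "sheet_hit_event r m = {\<omega>\<in>space M. \<exists>(i, j, k)\<in>slots m.
    \<forall>l. \<bar>B (x i, c + real k * h) \<omega> $ l - B (x i, b - real j * h) \<omega> $ l\<bar> \<le> r}"

lemma vimage_hit_event:
  assumes m: "m \<le> 2 * N"
  shows "cell_incrs -` hit_event r m \<inter> space M = sheet_hit_event r m"
proof -
  have "hit r (i, j, k) (cell_incrs \<omega>) = 0
      \<longleftrightarrow> \<not> (\<forall>l. \<bar>B (x i, c + real k * h) \<omega> $ l - B (x i, b - real j * h) \<omega> $ l\<bar> \<le> r)"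
    if "(i, j, k) \<in> slots m" for i j k \<omega>
    using that m by (simp add: hit_def small_def noise_cell_incrs)
  then have "{\<omega>\<in>space M. \<exists>q\<in>slots m. hit r q (cell_incrs \<omega>) \<noteq> 0} = sheet_hit_event r m"
    unfolding sheet_hit_event_def by (intro Collect_cong conj_cong bex_cong refl) auto
  moreover have "cell_incrs -` hit_event r m \<inter> space M = {\<omega>\<in>space M. \<exists>q\<in>slots m. hit r q (cell_incrs \<omega>) \<noteq> 0}"
    using measurable_space[OF measurable_cell_incrs] by (auto simp: hit_event_def)
  ultimately show ?thesis by simp
qed

lemma sets_sheet_hit_event: "m \<le> 2 * N \<Longrightarrow> sheet_hit_event r m \<in> sets M"
  unfolding vimage_hit_event[symmetric] by (intro measurable_sets[OF measurable_cell_incrs] sets_hit_event)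

lemma prob_hit_event_eq:
  assumes m: "m \<le> 2 * N"
  shows "measure product_measure (hit_event r m) = measure M (sheet_hit_event r m)"
proof -
  have "measure product_measure (hit_event r m) = measure (distr M product_measure cell_incrs) (hit_event r m)"
    by (simp only: distr_cell_incrs)
  also have "\<dots> = measure M (sheet_hit_event r m)"
    unfolding vimage_hit_event[OF m, symmetric] by (rule measure_distr[OF measurable_cell_incrs sets_hit_event[OF m]])
  finally show ?thesis .
qed

end

subsection \<open>Events of near return\<close>

lemma sets_Collect_compact_Ex_le:
  fixes f :: "'b::{metric_space, second_countable_topology} \<Rightarrow> 'a \<Rightarrow> real"
  assumes K: "compact K" and f[measurable]: "\<And>p. p \<in> K \<Longrightarrow> f p \<in> borel_measurable M"
    and cont: "\<And>\<omega>. \<omega> \<in> space M \<Longrightarrow> continuous_on K (\<lambda>p. f p \<omega>)"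
  shows "{\<omega>\<in>space M. \<exists>p\<in>K. f p \<omega> \<le> e} \<in> sets M"
proof -
  obtain D where D: "countable D" "D \<subseteq> K" "K \<subseteq> closure D" using separable by metis
  have "{\<omega>\<in>space M. \<exists>p\<in>K. f p \<omega> \<le> e} = (\<Inter>n. \<Union>q\<in>D. {\<omega>\<in>space M. f q \<omega> < e + 1 / real (Suc n)})"
  proof (intro set_eqI iffI)
    fix \<omega> assume "\<omega> \<in> {\<omega>\<in>space M. \<exists>p\<in>K. f p \<omega> \<le> e}"
    then obtain p where p: "\<omega> \<in> space M" "p \<in> K" "f p \<omega> \<le> e" by auto
    show "\<omega> \<in> (\<Inter>n. \<Union>q\<in>D. {\<omega>\<in>space M. f q \<omega> < e + 1 / real (Suc n)})"
    proof
      fix n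
      obtain \<delta> where \<delta>: "0 < \<delta>" "\<And>q. q \<in> K \<Longrightarrow> dist q p < \<delta> \<Longrightarrow> dist (f q \<omega>) (f p \<omega>) < 1 / real (Suc n)"
        using cont[OF p(1)] p(2) unfolding continuous_on_iff by (metis of_nat_0_less_iff zero_less_Suc zero_less_divide_1_iff)
      obtain q where q: "q \<in> D" "dist q p < \<delta>" using D(3) p(2) \<delta>(1) by (meson closure_approachable subsetD)
      then have "f q \<omega> < e + 1 / real (Suc n)" using \<delta>(2)[of q] D(2) p(3) by (auto simp: dist_real_def)
      then show "\<omega> \<in> (\<Union>q\<in>D. {\<omega>\<in>space M. f q \<omega> < e + 1 / real (Suc n)})" using q p by auto
    qed
  next
    fix \<omega> assume all_close: "\<omega> \<in> (\<Inter>n. \<Union>q\<in>D. {\<omega>\<in>space M. f q \<omega> < e + 1 / real (Suc n)})"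
    then have \<omega>: "\<omega> \<in> space M" "K \<noteq> {}" using D(2) by auto
    obtain p where p: "p \<in> K" "\<And>q. q \<in> K \<Longrightarrow> f p \<omega> \<le> f q \<omega>"
      using continuous_attains_inf[OF K \<omega>(2) cont[OF \<omega>(1)]] by auto
    have "f p \<omega> \<le> e + 1 / real (Suc n)" for n
    proof -
      obtain q where "q \<in> D" "f q \<omega> < e + 1 / real (Suc n)" using all_close by blast
      then show ?thesis using p(2)[of q] D(2) by auto
    qed
    then have "f p \<omega> \<le> e + \<delta>" if "0 < \<delta>" for \<delta>
      using reals_Archimedean[OF that] by (metis add_left_mono inverse_eq_divide less_imp_le order_trans)
    then have "f p \<omega> \<le> e" by (rule field_le_epsilon)
    then show "\<omega> \<in> {\<omega>\<in>space M. \<exists>p\<in>K. f p \<omega> \<le> e}" using p \<omega> by auto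
  qed
  moreover have "{\<omega>\<in>space M. f q \<omega> < e + 1 / real (Suc n)} \<in> sets M" if "q \<in> D" for q n
  proof -
    have [measurable]: "f q \<in> borel_measurable M" using that D(2) by auto
    show ?thesis by measurable
  qed
  ultimately show ?thesis using D(1) by (auto intro!: sets.countable_INT sets.countable_UN')
qed

definition return_dist :: "(real \<times> real \<Rightarrow> 'a \<Rightarrow> real ^ 'd) \<Rightarrow> real \<times> real \<times> real \<Rightarrow> 'a \<Rightarrow> real" where
  "return_dist B = (\<lambda>(s, t1, t2) \<omega>. norm (B (s, t2) \<omega> - B (s, t1) \<omega>))"

definition near_event :: "'a measure \<Rightarrow> (real \<times> real \<Rightarrow> 'a \<Rightarrow> real ^ 'd) \<Rightarrow> (real \<times> real \<times> real) set \<Rightarrow> real \<Rightarrow> 'a set" where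
  "near_event M B T r = {\<omega>\<in>space M. \<exists>p\<in>T. return_dist B p \<omega> \<le> r}"

abbreviation window :: "real set \<Rightarrow> real \<Rightarrow> real \<Rightarrow> real \<Rightarrow> (real \<times> real \<times> real) set" where
  "window F U b c \<equiv> F \<times> {b - U..b} \<times> {c..c + U}"

abbreviation octant :: "(real \<times> real \<times> real) set" where
  "octant \<equiv> {0..} \<times> {0..} \<times> {0..}"

lemma continuous_on_return_dist:
  assumes B: "brownian_sheet M B" and \<omega>: "\<omega> \<in> space M" and T: "T \<subseteq> octant"
  shows "continuous_on T (\<lambda>p. return_dist B p \<omega>)"
proof -
  have cont: "continuous_on ({0..} \<times> {0..}) (\<lambda>p. B p \<omega>)" using B \<omega> by (auto simp: brownian_sheet_def)
  have "continuous_on T (\<lambda>p. B (fst p, snd (snd p)) \<omega>)" "continuous_on T (\<lambda>p. B (fst p, fst (snd p)) \<omega>)"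
    by (rule continuous_on_compose2[OF cont]; use T in \<open>auto intro!: continuous_intros\<close>)+
  then show ?thesis
    unfolding return_dist_def case_prod_unfold by (intro continuous_on_norm continuous_on_diff)
qed

lemma sets_near_event:
  assumes B: "brownian_sheet M B" and T: "compact T" "T \<subseteq> octant"
  shows "near_event M B T r \<in> sets M"
  unfolding near_event_def
proof (rule sets_Collect_compact_Ex_le[OF T(1)])
  fix p assume "p \<in> T"
  then have "0 \<le> fst p" "0 \<le> fst (snd p)" "0 \<le> snd (snd p)" using T(2) by auto
  then have [measurable]: "B (fst p, snd (snd p)) \<in> borel_measurable M" "B (fst p, fst (snd p)) \<in> borel_measurable M"
    using B by (auto simp: brownian_sheet_def)
  show "return_dist B p \<in> borel_measurable M"
    unfolding return_dist_def case_prod_unfold by measurable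
qed (rule continuous_on_return_dist[OF B _ T(2)])

lemma Inter_near_event_subset:
  assumes B: "brownian_sheet M B" and T: "compact T" "T \<subseteq> octant" and r: "r \<longlonglongrightarrow> r0"
  shows "(\<Inter>m. near_event M B T (r m)) \<subseteq> near_event M B T r0"
proof
  fix \<omega> assume \<omega>: "\<omega> \<in> (\<Inter>m. near_event M B T (r m))"
  then have "\<omega> \<in> space M" "T \<noteq> {}" by (auto simp: near_event_def)
  then obtain p where p: "p \<in> T" "\<And>p'. p' \<in> T \<Longrightarrow> return_dist B p \<omega> \<le> return_dist B p' \<omega>"
    using continuous_attains_inf[OF T(1) _ continuous_on_return_dist[OF B _ T(2)]] by blast
  have "return_dist B p \<omega> \<le> r m" for m
  proof -
    have "\<omega> \<in> near_event M B T (r m)" using \<omega> by blast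
    then obtain p' where "p' \<in> T" "return_dist B p' \<omega> \<le> r m"
      unfolding near_event_def by blast
    then show ?thesis using p(2)[of p'] by simp
  qed
  then have "return_dist B p \<omega> \<le> r0" by (intro LIMSEQ_le_const[OF r]) auto
  then show "\<omega> \<in> near_event M B T r0" using p(1) \<open>\<omega> \<in> space M\<close> by (auto simp: near_event_def)
qed

lemma prob_near_event_limit:
  assumes B: "brownian_sheet M B" and T: "compact T" "T \<subseteq> octant"
    and r: "antimono r" "r \<longlonglongrightarrow> r0" and \<kappa>: "\<And>m. \<kappa> \<le> measure M (near_event M B T (r m))"
  shows "\<kappa> \<le> measure M (near_event M B T r0)"
proof -
  interpret prob_space M using B by (simp add: brownian_sheet_def)
  have "decseq (\<lambda>m. near_event M B T (r m))"
    using r(1) by (fastforce simp: decseq_def near_event_def antimono_def intro: order_trans)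
  then have "(\<lambda>m. measure M (near_event M B T (r m))) \<longlonglongrightarrow> measure M (\<Inter>m. near_event M B T (r m))"
    using sets_near_event[OF B T] by (intro finite_Lim_measure_decseq) auto
  then have "\<kappa> \<le> measure M (\<Inter>m. near_event M B T (r m))"
    by (rule LIMSEQ_le_const) (use \<kappa> in auto)
  also have "\<dots> \<le> measure M (near_event M B T r0)"
    by (intro finite_measure_mono Inter_near_event_subset B T r sets_near_event)
  finally show ?thesis .
qed

lemma prob_near_event_zero_ge:
  assumes B: "brownian_sheet M B" and T: "compact T" "T \<subseteq> octant" and C: "0 \<le> C"
    and \<kappa>: "\<And>m. \<kappa> \<le> measure M (near_event M B T (C * (1 / real (Suc m))))"
  shows "\<kappa> \<le> measure M (near_event M B T 0)"
proof -
  have "(\<lambda>m. C * (1 / real (Suc m))) \<longlonglongrightarrow> C * 0"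
    by (intro tendsto_mult tendsto_const LIMSEQ_Suc[OF lim_1_over_n])
  moreover have "antimono (\<lambda>m. C * (1 / real (Suc m)))"
    unfolding antimono_def using C by (intro allI impI mult_left_mono divide_left_mono) auto
  ultimately show ?thesis using prob_near_event_limit[OF B T, of "\<lambda>m. C * (1 / real (Suc m))" 0] \<kappa> by simp
qed

text \<open>Continuity puts every exact return into all late approximating events; then apply Fatou's lemma to the indicators.\<close>

lemma near_event_approximation:
  assumes B: "brownian_sheet M B" and T: "compact T" "T \<subseteq> octant"
    and T': "\<And>m. compact (T' m)" "\<And>m. T' m \<subseteq> octant"
    and dense: "\<And>p. p \<in> T \<Longrightarrow> \<exists>q. (\<forall>m. q m \<in> T' m) \<and> q \<longlonglongrightarrow> p"
    and \<epsilon>: "0 < \<epsilon>" and \<kappa>: "0 \<le> \<kappa>" "\<kappa> < measure M (near_event M B T 0)"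
  obtains m where "\<kappa> < measure M (near_event M B (T' m) \<epsilon>)"
proof -
  interpret prob_space M using B by (simp add: brownian_sheet_def)
  note [measurable] = sets_near_event[OF B T] sets_near_event[OF B T']
  let ?ind = "\<lambda>A. indicator A :: 'a \<Rightarrow> ennreal"
  have "?ind (near_event M B T 0) \<omega> \<le> liminf (\<lambda>m. ?ind (near_event M B (T' m) \<epsilon>) \<omega>)" for \<omega>
  proof (cases "\<omega> \<in> near_event M B T 0")
    case True
    then obtain p where p: "\<omega> \<in> space M" "p \<in> T" "return_dist B p \<omega> \<le> 0" by (auto simp: near_event_def)
    obtain q where q: "\<And>m. q m \<in> T' m" "q \<longlonglongrightarrow> p" using dense[OF p(2)] by blast
    have in_octant: "q m \<in> octant" for m using q(1) T'(2) by blast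
    have "continuous_on octant (\<lambda>p. return_dist B p \<omega>)"
      by (rule continuous_on_return_dist[OF B p(1) order_refl])
    then have "(\<lambda>m. return_dist B (q m) \<omega>) \<longlonglongrightarrow> return_dist B p \<omega>"
      by (rule continuous_on_tendsto_compose[OF _ q(2)]) (use p(2) T(2) in_octant in auto)
    then have "eventually (\<lambda>m. return_dist B (q m) \<omega> < \<epsilon>) sequentially"
      using order_tendstoD(2)[of _ "return_dist B p \<omega>" sequentially \<epsilon>] p(3) \<epsilon> by simp
    then have "eventually (\<lambda>m. \<omega> \<in> near_event M B (T' m) \<epsilon>) sequentially"
      by eventually_elim (use p(1) q(1) in \<open>auto simp: near_event_def intro: less_imp_le\<close>)
    then have "eventually (\<lambda>m. 1 \<le> ?ind (near_event M B (T' m) \<epsilon>) \<omega>) sequentially"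
      by eventually_elim simp
    then show ?thesis using True by (intro Liminf_bounded) simp
  qed simp
  then have "(\<integral>\<^sup>+\<omega>. ?ind (near_event M B T 0) \<omega> \<partial>M) \<le> (\<integral>\<^sup>+\<omega>. liminf (\<lambda>m. ?ind (near_event M B (T' m) \<epsilon>) \<omega>) \<partial>M)"
    by (intro nn_integral_mono)
  also have "\<dots> \<le> liminf (\<lambda>m. \<integral>\<^sup>+\<omega>. ?ind (near_event M B (T' m) \<epsilon>) \<omega> \<partial>M)"
    by (rule nn_integral_liminf) measurable
  finally have "emeasure M (near_event M B T 0) \<le> liminf (\<lambda>m. emeasure M (near_event M B (T' m) \<epsilon>))"
    by simp
  moreover have "ennreal \<kappa> < emeasure M (near_event M B T 0)"
    using \<kappa> by (simp add: emeasure_eq_measure ennreal_less_iff)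
  ultimately have "eventually (\<lambda>m. ennreal \<kappa> < emeasure M (near_event M B (T' m) \<epsilon>)) sequentially"
    by (intro less_LiminfD) simp
  then obtain m where "ennreal \<kappa> < emeasure M (near_event M B (T' m) \<epsilon>)"
    by (auto simp: eventually_sequentially)
  then show ?thesis using that[of m] \<kappa>(1) by (simp add: emeasure_eq_measure ennreal_less_iff)
qed

subsection \<open>Grids\<close>

lemma compact_discretization:
  fixes F :: "real set"
  assumes F: "compact F" and \<eta>: "0 < \<eta>"
  obtains \<pi> where "\<pi> \<in> borel_measurable borel" "finite (\<pi> ` F)" "\<pi> ` F \<subseteq> F" "\<And>s. s \<in> F \<Longrightarrow> \<bar>\<pi> s - s\<bar> \<le> \<eta>"
proof -
  define g where "g z = (SOME y. y \<in> F \<and> \<lfloor>y / \<eta>\<rfloor> = z)" for z :: int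
  have g: "g \<lfloor>s / \<eta>\<rfloor> \<in> F \<and> \<lfloor>g \<lfloor>s / \<eta>\<rfloor> / \<eta>\<rfloor> = \<lfloor>s / \<eta>\<rfloor>" if "s \<in> F" for s
    unfolding g_def by (rule someI[of _ s]) (use that in auto)
  show ?thesis
  proof
    have "(\<lambda>s::real. \<lfloor>s / \<eta>\<rfloor>) \<in> borel \<rightarrow>\<^sub>M count_space UNIV" by measurable
    then show "(\<lambda>s. g \<lfloor>s / \<eta>\<rfloor>) \<in> borel_measurable borel"
      by (rule measurable_compose) simp
    show "(\<lambda>s. g \<lfloor>s / \<eta>\<rfloor>) ` F \<subseteq> F" using g by auto
    obtain a where a: "\<And>s. s \<in> F \<Longrightarrow> \<bar>s\<bar> \<le> a" using compact_imp_bounded[OF F] unfolding bounded_iff by auto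
    have "(\<lambda>s. \<lfloor>s / \<eta>\<rfloor>) ` F \<subseteq> {\<lfloor>- a / \<eta>\<rfloor>..\<lfloor>a / \<eta>\<rfloor>}"
    proof
      fix z assume "z \<in> (\<lambda>s. \<lfloor>s / \<eta>\<rfloor>) ` F"
      then obtain s where s: "s \<in> F" "z = \<lfloor>s / \<eta>\<rfloor>" by auto
      then have "- a \<le> s" "s \<le> a" using a[of s] by auto
      then have "- a / \<eta> \<le> s / \<eta>" "s / \<eta> \<le> a / \<eta>" using \<eta> by (intro divide_right_mono; simp)+
      then show "z \<in> {\<lfloor>- a / \<eta>\<rfloor>..\<lfloor>a / \<eta>\<rfloor>}" unfolding s by (auto intro: floor_mono)
    qed
    then have "finite ((\<lambda>s. \<lfloor>s / \<eta>\<rfloor>) ` F)" by (rule finite_subset) simp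
    then show "finite ((\<lambda>s. g \<lfloor>s / \<eta>\<rfloor>) ` F)" by (metis finite_imageI image_image)
    fix s assume "s \<in> F"
    define y where "y = g \<lfloor>s / \<eta>\<rfloor>"
    have "\<lfloor>y / \<eta>\<rfloor> = \<lfloor>s / \<eta>\<rfloor>" using g[OF \<open>s \<in> F\<close>] by (simp add: y_def)
    then have "\<bar>y / \<eta> - s / \<eta>\<bar> \<le> 1" by linarith
    then have "\<bar>(y - s) / \<eta>\<bar> \<le> 1" by (simp add: diff_divide_distrib)
    then show "\<bar>g \<lfloor>s / \<eta>\<rfloor> - s\<bar> \<le> \<eta>" using \<eta> by (simp add: y_def abs_divide)
  qed
qed

definition increasing_grid :: "nat \<Rightarrow> (nat \<Rightarrow> real) \<Rightarrow> bool" where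
  "increasing_grid n x \<longleftrightarrow> x 0 = 0 \<and> (\<forall>i j. i < j \<longrightarrow> j \<le> n \<longrightarrow> x i < x j)"

lemma increasing_gridD:
  assumes "increasing_grid n x"
  shows "x 0 = 0" "i < j \<Longrightarrow> j \<le> n \<Longrightarrow> x i < x j"
  using assms by (auto simp: increasing_grid_def)

lemma exists_increasing_grid:
  fixes G :: "real set"
  assumes G: "finite G" "G \<subseteq> {0<..}"
  obtains n x where "increasing_grid n x" "x ` {1..n} = G"
proof -
  define x where "x i = (if i = 0 then 0 else sorted_list_of_set G ! (i - 1))" for i
  let ?n = "card G"
  have len: "length (sorted_list_of_set G) = ?n" by simp
  have mem: "x i \<in> G" if "1 \<le> i" "i \<le> ?n" for i
  proof -
    have "sorted_list_of_set G ! (i - 1) \<in> set (sorted_list_of_set G)" using that len by (intro nth_mem) auto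
    then show ?thesis using that G by (simp add: x_def)
  qed
  have "x 0 = 0" by (simp add: x_def)
  moreover have "x i < x j" if "i < j" "j \<le> ?n" for i j
  proof (cases "i = 0")
    case True
    then show ?thesis using mem[of j] that G by (auto simp: x_def)
  next
    case False
    have "sorted_wrt (<) (sorted_list_of_set G)" by (rule strict_sorted_list_of_set)
    then have "sorted_list_of_set G ! (i - 1) < sorted_list_of_set G ! (j - 1)"
      using that False len by (intro sorted_wrt_nth_less[of "(<)"]) auto
    then show ?thesis using False that by (simp add: x_def)
  qed
  moreover have "x ` {1..?n} = G"
  proof
    show "x ` {1..?n} \<subseteq> G" using mem by auto
    show "G \<subseteq> x ` {1..?n}"
    proof
      fix y assume "y \<in> G"
      then have "y \<in> set (sorted_list_of_set G)" using G by simp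
      then obtain i where "i < ?n" "sorted_list_of_set G ! i = y" using len by (metis in_set_conv_nth)
      then show "y \<in> x ` {1..?n}" by (intro image_eqI[of _ _ "Suc i"]) (auto simp: x_def)
    qed
  qed
  ultimately show ?thesis by (intro that[of ?n x]) (auto simp: increasing_grid_def)
qed

lemma exists_increasing_grid_net:
  fixes F :: "real set"
  assumes F: "compact F" "F \<subseteq> {0<..}" and \<eta>: "0 < \<eta>"
  obtains n x where "increasing_grid n x" "x ` {1..n} \<subseteq> F"
    "\<And>s. s \<in> F \<Longrightarrow> \<exists>i\<in>{1..n}. \<bar>x i - s\<bar> \<le> \<eta>"
proof -
  obtain \<pi> where \<pi>: "finite (\<pi> ` F)" "\<pi> ` F \<subseteq> F" "\<And>s. s \<in> F \<Longrightarrow> \<bar>\<pi> s - s\<bar> \<le> \<eta>"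
    using compact_discretization[OF F(1) \<eta>] by metis
  have "\<pi> ` F \<subseteq> {0<..}" using \<pi>(2) F(2) by auto
  then obtain n x where x: "increasing_grid n x" "x ` {1..n} = \<pi> ` F"
    by (rule exists_increasing_grid[OF \<pi>(1)]) (rule that)
  have "\<exists>i\<in>{1..n}. \<bar>x i - s\<bar> \<le> \<eta>" if "s \<in> F" for s
  proof -
    have "\<pi> s \<in> x ` {1..n}" using that x(2) by auto
    then show ?thesis using \<pi>(3)[OF that] by auto
  qed
  then show ?thesis using that[of n x] x \<pi>(2) by auto
qed

lemma grid_point_near:
  fixes t :: real
  assumes t: "0 \<le> t" "t \<le> U" and h: "0 < h" "real N * h = U" "0 < N"
  obtains j where "j < N" "\<bar>real j * h - t\<bar> \<le> h"
proof -
  define j where "j = min (nat \<lfloor>t / h\<rfloor>) (N - 1)"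
  have nn: "0 \<le> \<lfloor>t / h\<rfloor>" using t h by simp
  have fl: "real (nat \<lfloor>t / h\<rfloor>) \<le> t / h" "t / h < real (nat \<lfloor>t / h\<rfloor>) + 1"
    using nn by (simp_all add: of_nat_nat)
  have tN: "t / h \<le> real N" using t h by (simp add: field_simps)
  have "real j \<le> t / h" "t / h \<le> real j + 1"
    using fl tN h(3) unfolding j_def by (auto simp: min_def of_nat_diff)
  then have "\<bar>real j - t / h\<bar> \<le> 1" by linarith
  then have "\<bar>real j - t / h\<bar> * h \<le> 1 * h" using h by (intro mult_right_mono) auto
  moreover have "\<bar>real j - t / h\<bar> * h = \<bar>real j * h - t\<bar>"
    using h(1) abs_mult_pos[of h "real j - t / h"] by (simp add: left_diff_distrib)
  ultimately have "\<bar>real j * h - t\<bar> \<le> h" by simp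
  moreover have "j < N" using h(3) by (auto simp: j_def)
  ultimately show ?thesis by (rule that[rotated])
qed

definition grid_times :: "(nat \<Rightarrow> real) \<Rightarrow> nat \<Rightarrow> nat \<Rightarrow> real \<Rightarrow> real \<Rightarrow> real \<Rightarrow> (real \<times> real \<times> real) set" where
  "grid_times x n m b c h = (\<lambda>(i, j, k). (x i, b - real j * h, c + real k * h)) ` ({1..n} \<times> {..<m} \<times> {..<m})"

lemma compact_grid_times: "compact (grid_times x n m b c h)"
  unfolding grid_times_def by (intro finite_imp_compact) auto

lemma grid_times_subset:
  assumes F: "x ` {1..n} \<subseteq> F" and h: "0 \<le> h" "real m * h \<le> U"
  shows "grid_times x n m b c h \<subseteq> window F U b c"
proof -
  have "real j * h \<le> U" if "j < m" for j
    using mult_right_mono[of "real j" "real m" h] that h by simp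
  then show ?thesis using F h(1) by (auto simp: grid_times_def)
qed

lemma window_subset_octant:
  "F \<subseteq> {0<..} \<Longrightarrow> U \<le> b \<Longrightarrow> 0 \<le> c \<Longrightarrow> window F U b c \<subseteq> octant"
  by (auto intro: less_imp_le)

lemma exists_grid_time_near:
  assumes s: "\<exists>i\<in>{1..n}. \<bar>x i - s\<bar> \<le> \<eta>" and t: "t1 \<in> {b - U..b}" "t2 \<in> {c..c + U}"
    and h: "0 < h" "real N * h = U" "0 < N"
  shows "\<exists>q\<in>grid_times x n N b c h. \<bar>fst q - s\<bar> \<le> \<eta> \<and> \<bar>fst (snd q) - t1\<bar> \<le> h \<and> \<bar>snd (snd q) - t2\<bar> \<le> h"
proof -
  obtain i where i: "i \<in> {1..n}" "\<bar>x i - s\<bar> \<le> \<eta>" using s by blast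
  obtain j where j: "j < N" "\<bar>real j * h - (b - t1)\<bar> \<le> h"
    by (rule grid_point_near[OF _ _ h, of "b - t1"]) (use t in auto)
  obtain k where k: "k < N" "\<bar>real k * h - (t2 - c)\<bar> \<le> h"
    by (rule grid_point_near[OF _ _ h, of "t2 - c"]) (use t in auto)
  have "(x i, b - real j * h, c + real k * h) \<in> grid_times x n N b c h"
    unfolding grid_times_def using i j k by (intro image_eqI[of _ _ "(i, j, k)"]) auto
  then show ?thesis
    by (rule bexI[rotated]) (use i j k in \<open>auto simp: abs_le_iff\<close>)
qed

lemma exists_grid_near_event:
  fixes B :: "real \<times> real \<Rightarrow> 'a \<Rightarrow> real ^ 'd"
  assumes B: "brownian_sheet M B" and F: "compact F" "F \<subseteq> {0<..}" and U: "0 < U" "U \<le> b" "0 \<le> c"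
    and \<kappa>: "0 \<le> \<kappa>" "\<kappa> < measure M (near_event M B (window F U b c) 0)" and \<epsilon>: "0 < \<epsilon>"
  obtains n N x where "0 < N" "increasing_grid n x" "x ` {1..n} \<subseteq> F"
    "\<kappa> < measure M (near_event M B (grid_times x n N b c (U / real N)) \<epsilon>)"
proof -
  let ?\<eta> = "\<lambda>m. 1 / real (Suc m)" and ?h = "\<lambda>m. U / real (Suc m)" and ?T = "window F U b c"
  have "\<exists>n x. increasing_grid n x \<and> x ` {1..n} \<subseteq> F \<and> (\<forall>s\<in>F. \<exists>i\<in>{1..n}. \<bar>x i - s\<bar> \<le> ?\<eta> m)" for m
    by (rule exists_increasing_grid_net[OF F, of "?\<eta> m"]) (simp, blast)
  then obtain n and x :: "nat \<Rightarrow> nat \<Rightarrow> real" where x: "\<And>m. increasing_grid (n m) (x m)"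
      "\<And>m. x m ` {1..n m} \<subseteq> F" and net: "\<And>m s. s \<in> F \<Longrightarrow> \<exists>i\<in>{1..n m}. \<bar>x m i - s\<bar> \<le> ?\<eta> m"
    by metis
  define T' where "T' m = grid_times (x m) (n m) (Suc m) b c (?h m)" for m
  have T'_subset: "T' m \<subseteq> ?T" for m
    unfolding T'_def using U x(2) by (intro grid_times_subset) auto
  have octant: "?T \<subseteq> octant" using F U by (intro window_subset_octant) auto
  have approx: "\<exists>q. (\<forall>m. q m \<in> T' m) \<and> q \<longlonglongrightarrow> p" if "p \<in> ?T" for p
  proof -
    obtain s t1 t2 where p_eq: "p = (s, t1, t2)" by (rule prod_cases3)
    then have p: "s \<in> F" "t1 \<in> {b - U..b}" "t2 \<in> {c..c + U}" using that by auto
    have "\<exists>q\<in>T' m. \<bar>fst q - s\<bar> \<le> ?\<eta> m \<and> \<bar>fst (snd q) - t1\<bar> \<le> ?h m \<and> \<bar>snd (snd q) - t2\<bar> \<le> ?h m" for m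
      unfolding T'_def using p U net[OF p(1), of m] by (intro exists_grid_time_near) auto
    then obtain q where q: "\<And>m. q m \<in> T' m" "\<And>m. \<bar>fst (q m) - s\<bar> \<le> ?\<eta> m"
        "\<And>m. \<bar>fst (snd (q m)) - t1\<bar> \<le> ?h m" "\<And>m. \<bar>snd (snd (q m)) - t2\<bar> \<le> ?h m"
      by metis
    have \<eta>: "?\<eta> \<longlonglongrightarrow> 0" by (rule LIMSEQ_Suc[OF lim_1_over_n])
    then have h: "?h \<longlonglongrightarrow> 0" using tendsto_mult_right_zero[OF \<eta>, of U] by simp
    have squeeze: "f \<longlonglongrightarrow> a" if "\<And>m. \<bar>f m - a\<bar> \<le> e m" "e \<longlonglongrightarrow> 0" for f e :: "nat \<Rightarrow> real" and a
      using Lim_null_comparison[of "\<lambda>m. f m - a" e sequentially] that by (simp add: LIM_zero_iff)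
    have "(\<lambda>m. fst (q m)) \<longlonglongrightarrow> s" "(\<lambda>m. fst (snd (q m))) \<longlonglongrightarrow> t1" "(\<lambda>m. snd (snd (q m))) \<longlonglongrightarrow> t2"
      using squeeze[OF q(2) \<eta>] squeeze[OF q(3) h] squeeze[OF q(4) h] by simp_all
    then have "(\<lambda>m. (fst (q m), fst (snd (q m)), snd (snd (q m)))) \<longlonglongrightarrow> (s, t1, t2)"
      by (intro tendsto_Pair)
    then show ?thesis using q(1) p_eq by auto
  qed
  have compact: "compact ?T" using F by (intro compact_Times) auto
  have T': "\<And>m. compact (T' m)" "\<And>m. T' m \<subseteq> octant"
    using order_trans[OF T'_subset octant] by (simp_all only: T'_def compact_grid_times)
  obtain m where "\<kappa> < measure M (near_event M B (T' m) \<epsilon>)"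
    by (rule near_event_approximation[OF B compact octant T' approx \<epsilon> \<kappa>])
  then show ?thesis
    using that[of "Suc m" "n m" "x m"] x unfolding T'_def by auto
qed

subsection \<open>Limits of measures with bounded energy\<close>

lemma filterlim_riesz_fun_at_top:
  assumes \<beta>: "0 \<le> \<beta>"
  shows "filterlim (riesz_fun \<beta>) at_top (at_right 0)"
proof -
  have pos: "eventually (\<lambda>a. 0 < a) (at_right (0::real))"
    by (rule eventually_at_right_less)
  have log: "filterlim (\<lambda>a. - ln a :: real) at_top (at_right 0)"
    using ln_at_0 by (simp add: filterlim_uminus_at_top)
  show ?thesis
  proof (cases "\<beta> = 0")
    case True
    show ?thesis
      by (rule filterlim_at_top_mono[OF log], rule eventually_mono[OF pos])
         (simp add: riesz_fun_def True ln_div)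
  next
    case False
    have "filterlim (\<lambda>a. exp (\<beta> * - ln a)) at_top (at_right 0)"
      using False \<beta> by (intro filterlim_compose[OF exp_at_top] filterlim_tendsto_pos_mult_at_top[OF tendsto_const _ log]) simp
    then show ?thesis
      by (rule filterlim_at_top_mono, intro eventually_mono[OF pos])
         (use False \<beta> in \<open>simp add: riesz_fun_def powr_def\<close>)
  qed
qed

lemma tendsto_riesz_kernel:
  assumes a: "a \<longlonglongrightarrow> \<bar>r\<bar>" and pos: "\<And>n. 0 < a n"
  shows "(\<lambda>n. ennreal (riesz_fun \<beta> (a n))) \<longlonglongrightarrow> riesz_kernel \<beta> r"
proof (cases "0 \<le> \<beta> \<and> r = 0")
  case True
  have "a n \<noteq> 0" for n using pos[of n] by simp
  then have "filterlim a (at_right 0) sequentially"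
    using a pos True by (simp add: filterlim_at)
  then have "filterlim (\<lambda>n. riesz_fun \<beta> (a n)) at_top sequentially"
    by (rule filterlim_compose[OF filterlim_riesz_fun_at_top[OF conjunct1[OF True]]])
  then show ?thesis
    using True by (simp add: riesz_kernel_eq ennreal_tendsto_top_eq_at_top)
next
  case False
  have "(\<lambda>n. riesz_fun \<beta> (a n)) \<longlonglongrightarrow> riesz_fun \<beta> \<bar>r\<bar>"
  proof (cases "\<beta> < 0")
    case True
    then show ?thesis by (simp add: riesz_fun_def)
  next
    case nonneg: False
    then have "\<bar>r\<bar> \<noteq> 0" using False by simp
    then have "(\<lambda>n. max 0 (ln (1 / a n))) \<longlonglongrightarrow> max 0 (ln (1 / \<bar>r\<bar>))"
        "(\<lambda>n. a n powr (- \<beta>)) \<longlonglongrightarrow> \<bar>r\<bar> powr (- \<beta>)"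
      by (intro tendsto_intros a; simp)+
    then show ?thesis using nonneg by (simp add: riesz_fun_def)
  qed
  then show ?thesis
    using False by (auto simp: riesz_kernel_eq intro: tendsto_ennrealI)
qed

lemma nn_integral_distr_twice:
  assumes \<Omega>: "prob_space \<Omega>" and Z[measurable]: "Z \<in> borel_measurable \<Omega>"
    and k[measurable]: "case_prod k \<in> borel_measurable (borel \<Otimes>\<^sub>M borel)"
  shows "(\<integral>\<^sup>+x. \<integral>\<^sup>+y. k x y \<partial>distr \<Omega> borel Z \<partial>distr \<Omega> borel Z) = (\<integral>\<^sup>+\<omega>. \<integral>\<^sup>+\<omega>'. k (Z \<omega>) (Z \<omega>') \<partial>\<Omega> \<partial>\<Omega>)"
proof -
  interpret \<Omega>: prob_space \<Omega> by (rule \<Omega>)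
  have inner: "(\<integral>\<^sup>+y. k x y \<partial>distr \<Omega> borel Z) = (\<integral>\<^sup>+\<omega>'. k x (Z \<omega>') \<partial>\<Omega>)" for x
    by (rule nn_integral_distr) measurable
  show ?thesis
    unfolding inner by (rule nn_integral_distr) measurable
qed

lemma tight_of_compact_support:
  fixes \<mu> :: "nat \<Rightarrow> real measure"
  assumes F: "compact F" and \<mu>: "\<And>n. real_distribution (\<mu> n)" and supp: "\<And>n. AE x in \<mu> n. x \<in> F"
  shows "tight \<mu>"
proof -
  obtain a where a: "\<And>s. s \<in> F \<Longrightarrow> \<bar>s\<bar> \<le> a" using compact_imp_bounded[OF F] unfolding bounded_iff by auto
  have "1 - \<epsilon> < measure (\<mu> n) {- (\<bar>a\<bar> + 1)<..\<bar>a\<bar> + 1}" if "0 < \<epsilon>" for \<epsilon> :: real and n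
  proof -
    interpret real_distribution "\<mu> n" by (rule \<mu>)
    have "AE x in \<mu> n. x \<in> {- (\<bar>a\<bar> + 1)<..\<bar>a\<bar> + 1}"
      using supp[of n] by eventually_elim (use a in force)
    then have "measure (\<mu> n) {- (\<bar>a\<bar> + 1)<..\<bar>a\<bar> + 1} = 1"
      by (intro prob_eq_1[THEN iffD2]) auto
    then show ?thesis using that by simp
  qed
  moreover have "- (\<bar>a\<bar> + 1) < \<bar>a\<bar> + 1" by simp
  ultimately show ?thesis
    unfolding tight_def using \<mu> by blast
qed

lemma prob_measures_on_of_AE_limit:
  assumes \<Omega>: "prob_space \<Omega>" and F: "compact F"
    and Y: "\<And>n. Y n \<in> borel_measurable \<Omega>" "\<And>n. AE x in distr \<Omega> borel (Y n). x \<in> F"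
    and Z: "Z \<in> borel_measurable \<Omega>" and lim: "\<And>\<omega>. \<omega> \<in> space \<Omega> \<Longrightarrow> (\<lambda>n. Y n \<omega>) \<longlonglongrightarrow> Z \<omega>"
  shows "distr \<Omega> borel Z \<in> prob_measures_on F"
proof -
  interpret \<Omega>: prob_space \<Omega> by (rule \<Omega>)
  have F_borel: "F \<in> sets borel" using F by (simp add: borel_compact)
  have "AE \<omega> in \<Omega>. Y n \<omega> \<in> F" for n
    using Y(2)[of n] Y(1) F_borel by (subst (asm) AE_distr_iff) auto
  then have "AE \<omega> in \<Omega>. \<forall>n. Y n \<omega> \<in> F"
    by (simp add: AE_all_countable)
  then have "AE \<omega> in \<Omega>. Z \<omega> \<in> F"
    using AE_space
  proof eventually_elim
    case (elim \<omega>)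
    then show ?case
      using closed_sequentially[OF compact_imp_closed[OF F], of "\<lambda>n. Y n \<omega>" "Z \<omega>"] lim[of \<omega>] by auto
  qed
  then have "AE x in distr \<Omega> borel Z. x \<in> F"
    using Z F_borel by (subst AE_distr_iff) auto
  moreover have "prob_space (distr \<Omega> borel Z)"
    using Z by (rule \<Omega>.prob_space_distr)
  ultimately show ?thesis
    using F_borel prob_space.emeasure_eq_1_AE[of "distr \<Omega> borel Z" F] by (simp add: prob_measures_on_def)
qed

lemma riesz_energy_le_of_limit:
  assumes \<Omega>: "prob_space \<Omega>" and Y[measurable]: "\<And>n. Y n \<in> borel_measurable \<Omega>" and Z[measurable]: "Z \<in> borel_measurable \<Omega>"
    and lim: "\<And>\<omega>. \<omega> \<in> space \<Omega> \<Longrightarrow> (\<lambda>n. Y n \<omega>) \<longlonglongrightarrow> Z \<omega>" and e: "\<And>n. 0 < e n" "e \<longlonglongrightarrow> 0"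
    and bound: "\<And>n. (\<integral>\<^sup>+x. \<integral>\<^sup>+y. ennreal (riesz_fun \<beta> (\<bar>x - y\<bar> + e n)) \<partial>distr \<Omega> borel (Y n) \<partial>distr \<Omega> borel (Y n)) \<le> C"
  shows "riesz_energy \<beta> (distr \<Omega> borel Z) \<le> C"
proof -
  interpret \<Omega>: prob_space \<Omega> by (rule \<Omega>)
  let ?f = "\<lambda>n x y. ennreal (riesz_fun \<beta> (\<bar>x - y\<bar> + e n))"
  have "riesz_energy \<beta> (distr \<Omega> borel Z) = (\<integral>\<^sup>+\<omega>. \<integral>\<^sup>+\<omega>'. riesz_kernel \<beta> (Z \<omega> - Z \<omega>') \<partial>\<Omega> \<partial>\<Omega>)"
    unfolding riesz_energy_def by (rule nn_integral_distr_twice[OF \<Omega> Z]) measurable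
  also have "\<dots> = (\<integral>\<^sup>+\<omega>. \<integral>\<^sup>+\<omega>'. liminf (\<lambda>n. ?f n (Y n \<omega>) (Y n \<omega>')) \<partial>\<Omega> \<partial>\<Omega>)"
  proof (intro nn_integral_cong lim_imp_Liminf[symmetric] tendsto_riesz_kernel trivial_limit_sequentially)
    fix \<omega> \<omega>' assume "\<omega> \<in> space \<Omega>" "\<omega>' \<in> space \<Omega>"
    then have "(\<lambda>n. \<bar>Y n \<omega> - Y n \<omega>'\<bar> + e n) \<longlonglongrightarrow> \<bar>Z \<omega> - Z \<omega>'\<bar> + 0"
      using lim e(2) by (intro tendsto_intros) auto
    then show "(\<lambda>n. \<bar>Y n \<omega> - Y n \<omega>'\<bar> + e n) \<longlonglongrightarrow> \<bar>Z \<omega> - Z \<omega>'\<bar>" by simp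
    show "0 < \<bar>Y n \<omega> - Y n \<omega>'\<bar> + e n" for n using e(1) by (simp add: add_nonneg_pos)
  qed
  also have "\<dots> \<le> (\<integral>\<^sup>+\<omega>. liminf (\<lambda>n. \<integral>\<^sup>+\<omega>'. ?f n (Y n \<omega>) (Y n \<omega>') \<partial>\<Omega>) \<partial>\<Omega>)"
    by (intro nn_integral_mono nn_integral_liminf) measurable
  also have "\<dots> \<le> liminf (\<lambda>n. \<integral>\<^sup>+\<omega>. \<integral>\<^sup>+\<omega>'. ?f n (Y n \<omega>) (Y n \<omega>') \<partial>\<Omega> \<partial>\<Omega>)"
    by (intro nn_integral_liminf) measurable
  also have "\<dots> = liminf (\<lambda>n. \<integral>\<^sup>+x. \<integral>\<^sup>+y. ?f n x y \<partial>distr \<Omega> borel (Y n) \<partial>distr \<Omega> borel (Y n))"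
    by (intro arg_cong[where f=liminf] ext nn_integral_distr_twice[OF \<Omega> Y, symmetric]) measurable
  also have "\<dots> \<le> liminf (\<lambda>n. C)"
    using bound by (intro Liminf_mono) auto
  finally show ?thesis by (simp add: Liminf_const)
qed

text \<open>Pass to an almost surely convergent coupling and apply Fatou's lemma in both variables.\<close>

theorem exists_finite_energy_limit:
  fixes \<mu> :: "nat \<Rightarrow> real measure"
  assumes F: "compact F" and \<mu>: "\<And>n. real_distribution (\<mu> n)" and supp: "\<And>n. AE x in \<mu> n. x \<in> F"
    and e: "\<And>n. 0 < e n" "e \<longlonglongrightarrow> 0"
    and bound: "\<And>n. (\<integral>\<^sup>+x. \<integral>\<^sup>+y. ennreal (riesz_fun \<beta> (\<bar>x - y\<bar> + e n)) \<partial>\<mu> n \<partial>\<mu> n) \<le> C"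
  obtains \<nu> where "\<nu> \<in> prob_measures_on F" "riesz_energy \<beta> \<nu> \<le> C"
proof -
  have "tight \<mu>" by (rule tight_of_compact_support[OF F \<mu> supp])
  then obtain r \<nu> where r: "strict_mono r" and \<nu>: "real_distribution \<nu>" and conv: "weak_conv_m (\<lambda>n. \<mu> (r n)) \<nu>"
    using tight_imp_convergent_subsubsequence[OF _ strict_mono_id, of \<mu>]
    by (auto simp: comp_def)
  obtain \<Omega> :: "real measure" and Y Z where \<Omega>: "prob_space \<Omega>"
    and Y: "\<And>n. Y n \<in> borel_measurable \<Omega>" "\<And>n. distr \<Omega> borel (Y n) = \<mu> (r n)"
    and Z: "Z \<in> \<Omega> \<rightarrow>\<^sub>M lborel" "distr \<Omega> borel Z = \<nu>"
    and lim: "\<And>\<omega>. \<omega> \<in> space \<Omega> \<Longrightarrow> (\<lambda>n. Y n \<omega>) \<longlonglongrightarrow> Z \<omega>"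
    using Skorohod[OF \<mu> \<nu> conv] by metis
  have Z_borel: "Z \<in> borel_measurable \<Omega>" using Z(1) by simp
  show ?thesis
  proof (rule that)
    show "distr \<Omega> borel Z \<in> prob_measures_on F"
    proof (rule prob_measures_on_of_AE_limit[OF \<Omega> F Y(1) _ Z_borel lim])
      show "AE x in distr \<Omega> borel (Y n). x \<in> F" for n unfolding Y(2) by (rule supp)
    qed
    show "riesz_energy \<beta> (distr \<Omega> borel Z) \<le> C"
    proof (rule riesz_energy_le_of_limit[OF \<Omega> Y(1) Z_borel lim])
      show "(\<lambda>n. e (r n)) \<longlonglongrightarrow> 0"
        using LIMSEQ_subseq_LIMSEQ[OF e(2) r] by (simp add: comp_def)
    qed (use e(1) bound in \<open>simp_all add: Y(2)\<close>)
  qed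
qed

subsection \<open>Near returns on a grid and energies\<close>

context grid_noise
begin

lemma exists_measure_of_grid_energy:
  assumes p: "\<And>i. 0 \<le> p i" "(\<Sum>i\<in>{1..n}. p i) = 1"
    and C: "0 \<le> C" "\<And>a. 0 < a \<Longrightarrow> riesz_fun \<beta> a \<le> C * (1 + lattice_kernel (real CARD('d) / 2) U N a)"
  obtains \<mu> where "real_distribution \<mu>" "AE y in \<mu>. y \<in> x ` {1..n}"
    "(\<integral>\<^sup>+y. \<integral>\<^sup>+z. ennreal (riesz_fun \<beta> (\<bar>y - z\<bar> + \<epsilon>\<^sup>2)) \<partial>\<mu> \<partial>\<mu>) \<le> ennreal (C * (1 + grid_energy p))"
proof -
  define \<pi> where "\<pi> = point_measure {1..n} (\<lambda>i. ennreal (p i))"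
  have "emeasure \<pi> (space \<pi>) = (\<Sum>i\<in>{1..n}. ennreal (p i))"
    unfolding \<pi>_def space_point_measure by (rule emeasure_point_measure_finite) auto
  also have "\<dots> = 1" using p by (simp add: sum_ennreal)
  finally have \<pi>: "prob_space \<pi>" by (rule prob_spaceI)
  interpret \<pi>: prob_space \<pi> by (rule \<pi>)
  have x: "x \<in> borel_measurable \<pi>" unfolding \<pi>_def by simp
  let ?f = "\<lambda>i i'. riesz_fun \<beta> (\<bar>x i - x i'\<bar> + \<epsilon>\<^sup>2)"
  show ?thesis
  proof (rule that[of "distr \<pi> borel x"])
    show "real_distribution (distr \<pi> borel x)" by (rule \<pi>.real_distribution_distr) (rule x)
    have "x ` {1..n} \<in> sets borel" by (intro borel_closed finite_imp_closed) auto
    then show "AE y in distr \<pi> borel x. y \<in> x ` {1..n}"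
      using x by (subst AE_distr_iff) (auto simp: \<pi>_def space_point_measure intro!: AE_I2)
    have "(\<integral>\<^sup>+y. \<integral>\<^sup>+z. ennreal (riesz_fun \<beta> (\<bar>y - z\<bar> + \<epsilon>\<^sup>2)) \<partial>distr \<pi> borel x \<partial>distr \<pi> borel x)
        = (\<integral>\<^sup>+i. \<integral>\<^sup>+i'. ennreal (?f i i') \<partial>\<pi> \<partial>\<pi>)"
      by (rule nn_integral_distr_twice[OF \<pi> x]) measurable
    also have "\<dots> = (\<Sum>i\<in>{1..n}. ennreal (p i) * (\<Sum>i'\<in>{1..n}. ennreal (p i') * ennreal (?f i i')))"
      unfolding \<pi>_def by (simp add: nn_integral_point_measure_finite)
    also have "\<dots> = ennreal (\<Sum>i\<in>{1..n}. p i * (\<Sum>i'\<in>{1..n}. p i' * ?f i i'))"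
      using p(1) riesz_fun_nonneg by (simp add: ennreal_mult sum_nonneg flip: sum_ennreal)
    also have "\<dots> \<le> ennreal (\<Sum>i\<in>{1..n}. p i * (\<Sum>i'\<in>{1..n}. p i' * (C * (1 + grid_kernel i i'))))"
      using p(1) C(2) \<epsilon>_pos unfolding grid_kernel_def
      by (intro ennreal_leI sum_mono mult_left_mono C(2) add_nonneg_pos zero_less_power sum_nonneg) auto
    also have "(\<Sum>i\<in>{1..n}. p i * (\<Sum>i'\<in>{1..n}. p i' * (C * (1 + grid_kernel i i'))))
        = C * ((\<Sum>i\<in>{1..n}. p i * (\<Sum>i'\<in>{1..n}. p i')) + grid_energy p)"
      by (simp add: grid_energy_def sum_distrib_left sum.distrib distrib_left ac_simps)
    also have "\<dots> = C * (1 + grid_energy p)"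
      using p(2) by simp
    finally show "(\<integral>\<^sup>+y. \<integral>\<^sup>+z. ennreal (riesz_fun \<beta> (\<bar>y - z\<bar> + \<epsilon>\<^sup>2)) \<partial>distr \<pi> borel x \<partial>distr \<pi> borel x)
      \<le> ennreal (C * (1 + grid_energy p))" .
  qed
qed

end

context sheet_grid
begin

abbreviation near_grid :: "nat \<Rightarrow> real \<Rightarrow> 'a set" where
  "near_grid m r \<equiv> near_event M B (grid_times x n m b c h) r"

lemma grid_times_subset_octant: "m \<le> 2 * N \<Longrightarrow> grid_times x n m b c h \<subseteq> octant"
proof -
  assume m: "m \<le> 2 * N"
  have "0 \<le> b - real j * h" if "j < m" for j
    using times_h_le[of j 2] that m b_ge by simp
  moreover have "0 \<le> c" using b_ge U_pos g_pos by simp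
  ultimately show ?thesis
    using h_pos by (auto simp: grid_times_def intro!: x_nonneg)
qed

lemma prob_near_grid_le_hit_event:
  assumes "m \<le> 2 * N"
  shows "measure M (near_grid m r) \<le> measure product_measure (hit_event r m)"
  unfolding prob_hit_event_eq[OF assms]
proof (rule MP.finite_measure_mono)
  show "near_grid m r \<subseteq> sheet_hit_event r m"
    unfolding sheet_hit_event_def near_event_def grid_times_def return_dist_def
    by (fastforce intro: order_trans[OF component_le_norm_cart] simp flip: vector_minus_component)
qed (rule sets_sheet_hit_event[OF assms])

lemma prob_hit_event_le_near_grid:
  assumes "m \<le> 2 * N"
  shows "measure product_measure (hit_event r m) \<le> measure M (near_grid m (real CARD('d) * r))"
  unfolding prob_hit_event_eq[OF assms]
proof (rule MP.finite_measure_mono)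
  have "norm v \<le> real CARD('d) * r" if "\<And>l. \<bar>v $ l\<bar> \<le> r" for v :: "real ^ 'd"
    using norm_le_l1_cart[of v] sum_bounded_above[of UNIV "\<lambda>l. \<bar>v $ l\<bar>" r] that by simp
  then show "sheet_hit_event r m \<subseteq> near_grid m (real CARD('d) * r)"
    unfolding sheet_hit_event_def near_event_def grid_times_def return_dist_def
    by (fastforce simp flip: vector_minus_component)
  show "near_grid m (real CARD('d) * r) \<in> sets M"
    by (rule sets_near_event[OF sheet compact_grid_times grid_times_subset_octant[OF assms]])
qed

lemma exists_energy_measure_of_near_grid:
  assumes \<kappa>: "0 < \<kappa>" "\<kappa> \<le> measure M (near_grid N \<epsilon>)"
    and C: "0 \<le> C" "\<And>a. 0 < a \<Longrightarrow> riesz_fun \<beta> a \<le> C * (1 + lattice_kernel (real CARD('d) / 2) U N a)"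
  obtains \<mu> where "real_distribution \<mu>" "AE y in \<mu>. y \<in> x ` {1..n}"
    "(\<integral>\<^sup>+y. \<integral>\<^sup>+z. ennreal (riesz_fun \<beta> (\<bar>y - z\<bar> + \<epsilon>\<^sup>2)) \<partial>\<mu> \<partial>\<mu>)
      \<le> ennreal (C * (1 + energy_const CARD('d) / \<kappa>))"
proof -
  have hit: "\<kappa> \<le> measure product_measure (hit_event \<epsilon> N)"
    using \<kappa>(2) prob_near_grid_le_hit_event[of N \<epsilon>] by simp
  then have "0 < measure product_measure (hit_event \<epsilon> N)" using \<kappa>(1) by simp
  then obtain p where p: "\<And>i. 0 \<le> p i" "(\<Sum>i\<in>{1..n}. p i) = 1"
    and pA: "measure product_measure (hit_event \<epsilon> N) * grid_energy p \<le> energy_const CARD('d)"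
    by (rule exists_energy_of_hit_event) (rule that)
  have "\<kappa> * grid_energy p \<le> energy_const CARD('d)"
    using pA mult_right_mono[OF hit grid_energy_nonneg[of p, OF p(1)]] by linarith
  then have "grid_energy p \<le> energy_const CARD('d) / \<kappa>" using \<kappa>(1) by (simp add: field_simps)
  then have "ennreal (C * (1 + grid_energy p)) \<le> ennreal (C * (1 + energy_const CARD('d) / \<kappa>))"
    using C(1) by (intro ennreal_leI mult_left_mono) auto
  moreover obtain \<mu> where "real_distribution \<mu>" "AE y in \<mu>. y \<in> x ` {1..n}"
    "(\<integral>\<^sup>+y. \<integral>\<^sup>+z. ennreal (riesz_fun \<beta> (\<bar>y - z\<bar> + \<epsilon>\<^sup>2)) \<partial>\<mu> \<partial>\<mu>) \<le> ennreal (C * (1 + grid_energy p))"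
    by (rule exists_measure_of_grid_energy[OF p C]) (assumption, rule that)
  ultimately show ?thesis
    using that[of \<mu>] by (auto intro: order_trans)
qed

lemma prob_near_window_ge:
  assumes p: "\<And>i. 0 \<le> p i" "(\<Sum>i\<in>{1..n}. p i) = 1" and \<epsilon>: "\<epsilon> \<le> 1"
    and F: "compact F" "F \<subseteq> {0<..}" "x ` {1..n} \<subseteq> F"
  shows "(density_const ^ CARD('d))\<^sup>2
    \<le> measure M (near_event M B (window F (2 * U) b c) (2 * real CARD('d) * \<epsilon>)) * (64 * pair_const ^ CARD('d) * grid_energy p)"
proof -
  let ?T = "window F (2 * U) b c"
  have "grid_times x n (2 * N) b c h \<subseteq> ?T"
    using F(3) h_pos N_times_h by (intro grid_times_subset) auto
  then have "near_grid (2 * N) r \<subseteq> near_event M B ?T r" for r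
    unfolding near_event_def by blast
  moreover have "near_event M B ?T r \<in> sets M" for r
  proof (rule sets_near_event[OF sheet])
    show "compact ?T" using F(1) by (intro compact_Times) auto
    show "?T \<subseteq> octant" using F(2) b_ge U_pos g_pos by (intro window_subset_octant) auto
  qed
  ultimately have near_grid_le: "measure M (near_grid (2 * N) r) \<le> measure M (near_event M B ?T r)" for r
    by (intro MP.finite_measure_mono)
  have "measure product_measure (hit_event (2 * \<epsilon>) (2 * N)) \<le> measure M (near_event M B ?T (2 * real CARD('d) * \<epsilon>))"
    using order_trans[OF prob_hit_event_le_near_grid near_grid_le] by (simp add: mult.left_commute mult.assoc)
  moreover have "(density_const ^ CARD('d))\<^sup>2
      \<le> measure product_measure (hit_event (2 * \<epsilon>) (2 * N)) * (64 * pair_const ^ CARD('d) * grid_energy p)"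
    by (rule prob_hit_event_ge[OF p \<epsilon>])
  moreover have "0 \<le> 64 * pair_const ^ CARD('d) * grid_energy p"
    using pair_const_pos grid_energy_nonneg[of p, OF p(1)] by auto
  ultimately show ?thesis by (meson mult_right_mono order_trans)
qed

end

lemma sheet_gridI:
  assumes "0 < n" "0 < N" "increasing_grid n x" "x ` {1..n} \<subseteq> F"
    and "0 < s0" "\<And>s. s \<in> F \<Longrightarrow> s0 \<le> s" "\<And>s. s \<in> F \<Longrightarrow> s \<le> s1"
    and "b < c" "0 < U" "2 * U \<le> b" "0 < \<epsilon>" "brownian_sheet M B"
  shows "sheet_grid n N x b c U s0 s1 \<epsilon> M B"
proof -
  have "x i \<in> F" if "1 \<le> i" "i \<le> n" for i using assms(4) that by auto
  then show ?thesis using assms increasing_gridD[OF assms(3)] by unfold_locales auto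
qed

subsection \<open>Returns with positive probability carry a measure of finite energy\<close>

lemma compact_positive_bounds:
  fixes F :: "real set"
  assumes "compact F" "F \<subseteq> {0<..}" "F \<noteq> {}"
  obtains s0 s1 where "0 < s0" "\<And>s. s \<in> F \<Longrightarrow> s0 \<le> s" "\<And>s. s \<in> F \<Longrightarrow> s \<le> s1"
proof -
  obtain s0 where "s0 \<in> F" "\<And>s. s \<in> F \<Longrightarrow> s0 \<le> s" using compact_attains_inf[OF assms(1,3)] by auto
  moreover obtain s1 where "\<And>s. s \<in> F \<Longrightarrow> s \<le> s1" using compact_attains_sup[OF assms(1,3)] by auto
  ultimately show ?thesis using assms(2) by (intro that[of s0 s1]) auto
qed

lemma exists_regularized_energy_measure:
  fixes B :: "real \<times> real \<Rightarrow> 'a \<Rightarrow> real ^ 'd"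
  assumes B: "brownian_sheet M B" and F: "compact F" "F \<subseteq> {0<..}"
    and s: "0 < s0" "\<And>s. s \<in> F \<Longrightarrow> s0 \<le> s" "\<And>s. s \<in> F \<Longrightarrow> s \<le> s1"
    and bc: "b < c" and U: "0 < U" "2 * U \<le> b" and \<epsilon>: "0 < \<epsilon>"
    and \<kappa>: "0 < \<kappa>" "\<kappa> < measure M (near_event M B (window F U b c) 0)"
    and C: "0 \<le> C" "\<And>N a. 0 < N \<Longrightarrow> 0 < a \<Longrightarrow> riesz_fun \<beta> a \<le> C * (1 + lattice_kernel (real CARD('d) / 2) U N a)"
  obtains \<mu> where "real_distribution \<mu>" "AE y in \<mu>. y \<in> F"
    "(\<integral>\<^sup>+y. \<integral>\<^sup>+z. ennreal (riesz_fun \<beta> (\<bar>y - z\<bar> + \<epsilon>\<^sup>2)) \<partial>\<mu> \<partial>\<mu>)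
      \<le> ennreal (C * (1 + grid_noise.energy_const (c - b) U s0 s1 CARD('d) / \<kappa>))"
proof -
  have "U \<le> b" "0 \<le> c" using U bc by auto
  then obtain n N x where N: "0 < N" and x: "increasing_grid n x" "x ` {1..n} \<subseteq> F"
    and near: "\<kappa> < measure M (near_event M B (grid_times x n N b c (U / real N)) \<epsilon>)"
    by (rule exists_grid_near_event[OF B F U(1) _ _ less_imp_le[OF \<kappa>(1)] \<kappa>(2) \<epsilon>]) (rule that)
  have n: "0 < n"
    using near \<kappa>(1) by (cases "n = 0") (simp_all add: near_event_def grid_times_def)
  interpret sheet_grid n N x b c U s0 s1 \<epsilon> "TYPE('d)" M B
    by (rule sheet_gridI[OF n N x s bc U \<epsilon> B])
  obtain \<mu> where \<mu>: "real_distribution \<mu>" "AE y in \<mu>. y \<in> x ` {1..n}"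
    "(\<integral>\<^sup>+y. \<integral>\<^sup>+z. ennreal (riesz_fun \<beta> (\<bar>y - z\<bar> + \<epsilon>\<^sup>2)) \<partial>\<mu> \<partial>\<mu>) \<le> ennreal (C * (1 + energy_const CARD('d) / \<kappa>))"
    by (rule exists_energy_measure_of_near_grid
        [OF \<kappa>(1) less_imp_le[OF near[folded h_def]] C(1) C(2)[OF N]]) (assumption, rule that)
  have "AE y in \<mu>. y \<in> F" using \<mu>(2) by eventually_elim (use x(2) in auto)
  then show ?thesis by (rule that[OF \<mu>(1) _ \<mu>(3)])
qed

theorem finite_energy_of_near_event:
  fixes B :: "real \<times> real \<Rightarrow> 'a \<Rightarrow> real ^ 'd"
  assumes B: "brownian_sheet M B" and F: "compact F" "F \<subseteq> {0<..}" and bc: "b < c" and U: "0 < U" "2 * U \<le> b"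
    and pos: "0 < measure M (near_event M B (window F U b c) 0)"
  obtains \<nu> where "\<nu> \<in> prob_measures_on F" "riesz_energy ((real CARD('d) - 4) / 2) \<nu> < \<top>"
proof -
  let ?\<beta> = "(real CARD('d) - 4) / 2" and ?P = "measure M (near_event M B (window F U b c) 0)"
  have "F \<noteq> {}" using pos by (auto simp: near_event_def)
  then obtain s0 s1 where s: "0 < s0" "\<And>s. s \<in> F \<Longrightarrow> s0 \<le> s" "\<And>s. s \<in> F \<Longrightarrow> s \<le> s1"
    using compact_positive_bounds[OF F] by blast
  have \<beta>: "real CARD('d) / 2 - 2 = ?\<beta>" by (simp add: diff_divide_distrib)
  obtain C where C: "0 \<le> C"
    "\<And>N a. 0 < N \<Longrightarrow> 0 < a \<Longrightarrow> riesz_fun ?\<beta> a \<le> C * (1 + lattice_kernel (real CARD('d) / 2) U N a)"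
    by (rule riesz_fun_le_lattice_kernel[OF U(1), of "real CARD('d) / 2", unfolded \<beta>]) (rule that)
  define D where "D = C * (1 + grid_noise.energy_const (c - b) U s0 s1 CARD('d) / (?P / 2))"
  have "0 < ?P / 2" "?P / 2 < ?P" using pos by auto
  then have "\<exists>\<mu>. real_distribution \<mu> \<and> (AE y in \<mu>. y \<in> F) \<and>
    (\<integral>\<^sup>+y. \<integral>\<^sup>+z. ennreal (riesz_fun ?\<beta> (\<bar>y - z\<bar> + (1 / real (Suc m))\<^sup>2)) \<partial>\<mu> \<partial>\<mu>) \<le> ennreal D" for m
    using exists_regularized_energy_measure[OF B F s bc U _ _ _ C, of "1 / real (Suc m)" "?P / 2"]
    by (auto simp: D_def simp del: of_nat_Suc)
  then obtain \<mu> where \<mu>: "\<And>m. real_distribution (\<mu> m)" "\<And>m. AE y in \<mu> m. y \<in> F"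
    "\<And>m. (\<integral>\<^sup>+y. \<integral>\<^sup>+z. ennreal (riesz_fun ?\<beta> (\<bar>y - z\<bar> + (1 / real (Suc m))\<^sup>2)) \<partial>\<mu> m \<partial>\<mu> m) \<le> ennreal D"
    by metis
  have "(\<lambda>m. (1 / real (Suc m))\<^sup>2) \<longlonglongrightarrow> 0\<^sup>2"
    by (intro tendsto_power LIMSEQ_Suc[OF lim_1_over_n])
  then have lim: "(\<lambda>m. (1 / real (Suc m))\<^sup>2) \<longlonglongrightarrow> 0" by simp
  obtain \<nu> where "\<nu> \<in> prob_measures_on F" "riesz_energy ?\<beta> \<nu> \<le> ennreal D"
    by (rule exists_finite_energy_limit[OF F(1) \<mu>(1,2) _ lim \<mu>(3)]) (simp, rule that)
  then show ?thesis using that[of \<nu>] by (simp add: le_less_trans)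
qed

subsection \<open>A measure of finite energy forces returns\<close>

lemma nn_integral_finite_range:
  assumes \<mu>: "prob_space \<mu>" and \<pi>[measurable]: "\<pi> \<in> borel_measurable \<mu>" and range: "AE y in \<mu>. \<pi> y \<in> x ` J"
    and J: "finite J" "inj_on x J"
  shows "(\<integral>\<^sup>+y. g (\<pi> y :: real) \<partial>\<mu>) = (\<Sum>i\<in>J. ennreal (measure \<mu> {y\<in>space \<mu>. \<pi> y = x i}) * g (x i))"
proof -
  interpret prob_space \<mu> by (rule \<mu>)
  have "(\<integral>\<^sup>+y. g (\<pi> y) \<partial>\<mu>) = (\<integral>\<^sup>+y. (\<Sum>i\<in>J. g (x i) * indicator {y\<in>space \<mu>. \<pi> y = x i} y) \<partial>\<mu>)"
  proof (rule nn_integral_cong_AE)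
    show "AE y in \<mu>. g (\<pi> y) = (\<Sum>i\<in>J. g (x i) * indicator {y\<in>space \<mu>. \<pi> y = x i} y)"
      using range AE_space
    proof eventually_elim
      case (elim y)
      then obtain i where i: "i \<in> J" "\<pi> y = x i" by auto
      have "(\<Sum>i'\<in>J. g (x i') * indicator {y\<in>space \<mu>. \<pi> y = x i'} y) = (\<Sum>i'\<in>J. if i' = i then g (x i) else 0)"
        using i J(2) elim by (intro sum.cong) (auto simp: inj_on_def indicator_def)
      then show ?case using i J(1) by simp
    qed
  qed
  also have "\<dots> = (\<Sum>i\<in>J. \<integral>\<^sup>+y. g (x i) * indicator {y\<in>space \<mu>. \<pi> y = x i} y \<partial>\<mu>)"
    by (rule nn_integral_sum) measurable
  also have "\<dots> = (\<Sum>i\<in>J. ennreal (measure \<mu> {y\<in>space \<mu>. \<pi> y = x i}) * g (x i))"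
    by (intro sum.cong refl) (simp add: nn_integral_cmult_indicator emeasure_eq_measure mult.commute)
  finally show ?thesis .
qed

lemma discrete_energy_eq_nn_integral:
  fixes f :: "real \<Rightarrow> real \<Rightarrow> real"
  assumes \<mu>: "prob_space \<mu>" and \<pi>: "\<pi> \<in> borel_measurable \<mu>" and range: "AE y in \<mu>. \<pi> y \<in> x ` J"
    and J: "finite J" "inj_on x J" and f: "\<And>u v. 0 \<le> f u v"
  shows "ennreal (\<Sum>i\<in>J. \<Sum>j\<in>J. measure \<mu> {y\<in>space \<mu>. \<pi> y = x i} * measure \<mu> {y\<in>space \<mu>. \<pi> y = x j} * f (x i) (x j))
    = (\<integral>\<^sup>+y. \<integral>\<^sup>+z. ennreal (f (\<pi> y) (\<pi> z)) \<partial>\<mu> \<partial>\<mu>)"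
proof -
  let ?p = "\<lambda>i. measure \<mu> {y\<in>space \<mu>. \<pi> y = x i}"
  note finite_range = nn_integral_finite_range[OF \<mu> \<pi> range J]
  have "(\<integral>\<^sup>+y. \<integral>\<^sup>+z. ennreal (f (\<pi> y) (\<pi> z)) \<partial>\<mu> \<partial>\<mu>)
      = (\<Sum>i\<in>J. ennreal (?p i) * (\<Sum>j\<in>J. ennreal (?p j) * ennreal (f (x i) (x j))))"
    by (simp only: finite_range[of "\<lambda>v. ennreal (f _ v)"] finite_range[of "\<lambda>u. \<Sum>j\<in>J. ennreal (?p j) * ennreal (f u (x j))"])
  also have "\<dots> = (\<Sum>i\<in>J. \<Sum>j\<in>J. ennreal (?p i * ?p j * f (x i) (x j)))"
    using f by (simp add: sum_distrib_left ennreal_mult mult.assoc)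
  also have "\<dots> = ennreal (\<Sum>i\<in>J. \<Sum>j\<in>J. ?p i * ?p j * f (x i) (x j))"
    using f by (simp add: sum_nonneg)
  finally show ?thesis ..
qed

lemma riesz_fun_le_riesz_kernel:
  obtains C where "0 \<le> C" "\<And>e u v y z. 0 < e \<Longrightarrow> \<bar>u - y\<bar> \<le> e \<Longrightarrow> \<bar>v - z\<bar> \<le> e \<Longrightarrow>
    ennreal (1 + riesz_fun \<beta> (\<bar>u - v\<bar> + e)) \<le> ennreal C * (1 + riesz_kernel \<beta> (y - z))"
proof -
  obtain C where C: "0 \<le> C" "\<And>a. 0 < a \<Longrightarrow> riesz_fun \<beta> (a / 3) \<le> C * (1 + riesz_fun \<beta> a)"
    by (rule riesz_fun_divide_le[of 3]) (simp, rule that)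
  show ?thesis
  proof (rule that[of "1 + C"])
    fix e u v y z :: real
    assume e: "0 < e" and near: "\<bar>u - y\<bar> \<le> e" "\<bar>v - z\<bar> \<le> e"
    consider "0 \<le> \<beta> \<and> y = z" | "\<beta> < 0" | "0 \<le> \<beta>" "y \<noteq> z" by linarith
    then show "ennreal (1 + riesz_fun \<beta> (\<bar>u - v\<bar> + e)) \<le> ennreal (1 + C) * (1 + riesz_kernel \<beta> (y - z))"
    proof cases
      case 1
      then show ?thesis using C(1) by (simp add: riesz_kernel_eq ennreal_mult_top)
    next
      case 2
      then have "1 + riesz_fun \<beta> (\<bar>u - v\<bar> + e) \<le> (1 + C) * (1 + riesz_fun \<beta> \<bar>y - z\<bar>)"
        using C(1) by (simp add: riesz_fun_def)
      then show ?thesis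
        using 2 C(1) riesz_fun_nonneg[of \<beta> "\<bar>y - z\<bar>"]
        by (simp add: riesz_kernel_eq ennreal_leI flip: ennreal_mult ennreal_1 ennreal_plus)
    next
      case 3
      have "\<bar>y - z\<bar> \<le> \<bar>u - y\<bar> + \<bar>u - v\<bar> + \<bar>v - z\<bar>" by arith
      also have "\<dots> \<le> e + \<bar>u - v\<bar> + e" using near by (intro add_mono) auto
      also have "\<dots> \<le> 3 * (\<bar>u - v\<bar> + e)" using e by simp
      finally have "riesz_fun \<beta> (\<bar>u - v\<bar> + e) \<le> riesz_fun \<beta> (\<bar>y - z\<bar> / 3)"
        using 3 by (intro riesz_fun_antimono) auto
      also have "\<dots> \<le> C * (1 + riesz_fun \<beta> \<bar>y - z\<bar>)" using 3 by (intro C(2)) simp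
      finally have "1 + riesz_fun \<beta> (\<bar>u - v\<bar> + e) \<le> (1 + C) * (1 + riesz_fun \<beta> \<bar>y - z\<bar>)"
        using riesz_fun_nonneg[of \<beta> "\<bar>y - z\<bar>"] by (simp add: distrib_right)
      then show ?thesis
        using 3 C(1) riesz_fun_nonneg[of \<beta> "\<bar>y - z\<bar>"]
        by (simp add: riesz_kernel_eq ennreal_leI flip: ennreal_mult ennreal_1 ennreal_plus)
    qed
  qed (use C(1) in simp)
qed

lemma lattice_kernel_le_riesz_kernel:
  assumes U: "0 < U"
  obtains C where "0 \<le> C" "\<And>N e u v y z. 0 < N \<Longrightarrow> 0 < e \<Longrightarrow> U / real N \<le> e \<Longrightarrow> \<bar>u - v\<bar> + e \<le> A \<Longrightarrow>
    \<bar>u - y\<bar> \<le> e \<Longrightarrow> \<bar>v - z\<bar> \<le> e \<Longrightarrow> ennreal (lattice_kernel p U N (\<bar>u - v\<bar> + e)) \<le> ennreal C * (1 + riesz_kernel (p - 2) (y - z))"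
proof -
  obtain C1 where C1: "0 \<le> C1" "\<And>N a. 0 < N \<Longrightarrow> 0 < a \<Longrightarrow> U / real N \<le> a \<Longrightarrow> a \<le> A \<Longrightarrow>
      lattice_kernel p U N a \<le> C1 * (1 + riesz_fun (p - 2) a)"
    by (rule lattice_kernel_le_riesz_fun[OF U]) (rule that)
  obtain C2 where C2: "0 \<le> C2" "\<And>e u v y z. 0 < e \<Longrightarrow> \<bar>u - y\<bar> \<le> e \<Longrightarrow> \<bar>v - z\<bar> \<le> e \<Longrightarrow>
      ennreal (1 + riesz_fun (p - 2) (\<bar>u - v\<bar> + e)) \<le> ennreal C2 * (1 + riesz_kernel (p - 2) (y - z))"
    by (rule riesz_fun_le_riesz_kernel) (rule that)
  show ?thesis
  proof (rule that[of "C1 * C2"])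
    fix N :: nat and e u v y z :: real
    assume N: "0 < N" and e: "0 < e" "U / real N \<le> e" "\<bar>u - v\<bar> + e \<le> A" and near: "\<bar>u - y\<bar> \<le> e" "\<bar>v - z\<bar> \<le> e"
    have "lattice_kernel p U N (\<bar>u - v\<bar> + e) \<le> C1 * (1 + riesz_fun (p - 2) (\<bar>u - v\<bar> + e))"
      using N e by (intro C1(2)) auto
    then have "ennreal (lattice_kernel p U N (\<bar>u - v\<bar> + e)) \<le> ennreal C1 * ennreal (1 + riesz_fun (p - 2) (\<bar>u - v\<bar> + e))"
      using C1(1) riesz_fun_nonneg[of "p - 2" "\<bar>u - v\<bar> + e"] by (subst ennreal_mult[symmetric]) (auto intro: ennreal_leI)
    also have "\<dots> \<le> ennreal C1 * (ennreal C2 * (1 + riesz_kernel (p - 2) (y - z)))"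
      by (intro mult_left_mono C2(2)) (use e near in auto)
    finally show "ennreal (lattice_kernel p U N (\<bar>u - v\<bar> + e)) \<le> ennreal (C1 * C2) * (1 + riesz_kernel (p - 2) (y - z))"
      using C1(1) C2(1) by (simp add: ennreal_mult mult.assoc)
  qed (use C1(1) C2(1) in simp)
qed

lemma nn_integral_affine_riesz_kernel:
  assumes \<mu>: "prob_space \<mu>" and [measurable_cong]: "sets \<mu> = sets borel"
  shows "(\<integral>\<^sup>+y. \<integral>\<^sup>+z. C * (1 + riesz_kernel \<beta> (y - z)) \<partial>\<mu> \<partial>\<mu>) = C * (1 + riesz_energy \<beta> \<mu>)"
proof -
  interpret prob_space \<mu> by (rule \<mu>)
  have "(\<integral>\<^sup>+z. C * (1 + riesz_kernel \<beta> (y - z)) \<partial>\<mu>) = C * (1 + (\<integral>\<^sup>+z. riesz_kernel \<beta> (y - z) \<partial>\<mu>))" for y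
    by (simp add: nn_integral_cmult nn_integral_add emeasure_space_1)
  then show ?thesis
    by (simp add: riesz_energy_def nn_integral_cmult nn_integral_add emeasure_space_1)
qed

lemma exists_discretized_measure:
  fixes F :: "real set"
  assumes F: "compact F" "F \<subseteq> {0<..}" and \<mu>: "prob_space \<mu>" "sets \<mu> = sets borel" "AE y in \<mu>. y \<in> F" and e: "0 < e"
  obtains n x p \<pi> where "increasing_grid n x" "x ` {1..n} \<subseteq> F" "\<And>i. 0 \<le> p i" "(\<Sum>i\<in>{1..n}. p i) = 1"
    "\<And>s. s \<in> F \<Longrightarrow> \<pi> s \<in> F \<and> \<bar>\<pi> s - s\<bar> \<le> e"
    "\<And>f. \<forall>u v. 0 \<le> f u v \<Longrightarrow>
      ennreal (\<Sum>i\<in>{1..n}. \<Sum>j\<in>{1..n}. p i * p j * f (x i) (x j)) = (\<integral>\<^sup>+y. \<integral>\<^sup>+z. ennreal (f (\<pi> y) (\<pi> z)) \<partial>\<mu> \<partial>\<mu>)"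
proof -
  interpret \<mu>: prob_space \<mu> by (rule \<mu>(1))
  obtain \<pi> where \<pi>: "\<pi> \<in> borel_measurable borel" "finite (\<pi> ` F)" "\<pi> ` F \<subseteq> F" "\<And>s. s \<in> F \<Longrightarrow> \<bar>\<pi> s - s\<bar> \<le> e"
    by (rule compact_discretization[OF F(1) e]) (rule that)
  have "\<pi> ` F \<subseteq> {0<..}" using \<pi>(3) F(2) by auto
  then obtain n x where x: "increasing_grid n x" "x ` {1..n} = \<pi> ` F"
    by (rule exists_increasing_grid[OF \<pi>(2)]) (rule that)
  have inj: "inj_on x {1..n}"
    by (rule linorder_inj_onI) (use increasing_gridD(2)[OF x(1)] in \<open>auto dest: less_imp_neq\<close>)
  have \<pi>_\<mu>: "\<pi> \<in> borel_measurable \<mu>" using \<pi>(1) unfolding measurable_cong_sets[OF \<mu>(2) refl] .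
  have range: "AE y in \<mu>. \<pi> y \<in> x ` {1..n}" using \<mu>(3) unfolding x(2) by eventually_elim (rule imageI)
  define p where "p i = measure \<mu> {y\<in>space \<mu>. \<pi> y = x i}" for i
  have "ennreal (\<Sum>i\<in>{1..n}. p i) = (\<integral>\<^sup>+y. 1 \<partial>\<mu>)"
    using nn_integral_finite_range[OF \<mu>(1) \<pi>_\<mu> range finite_atLeastAtMost inj, of "\<lambda>_. 1"] by (simp add: p_def sum_ennreal)
  then have "(\<Sum>i\<in>{1..n}. p i) = 1"
    using \<mu>.emeasure_space_1 by (simp add: p_def sum_nonneg)
  moreover have "ennreal (\<Sum>i\<in>{1..n}. \<Sum>j\<in>{1..n}. p i * p j * f (x i) (x j)) = (\<integral>\<^sup>+y. \<integral>\<^sup>+z. ennreal (f (\<pi> y) (\<pi> z)) \<partial>\<mu> \<partial>\<mu>)"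
    if "\<forall>u v. 0 \<le> f u v" for f
    unfolding p_def by (rule discrete_energy_eq_nn_integral[OF \<mu>(1) \<pi>_\<mu> range finite_atLeastAtMost inj that[rule_format]])
  ultimately show ?thesis
    using x \<pi>(3,4) by (intro that[of n x p \<pi>]) (auto simp: p_def)
qed

theorem exists_discrete_measure_of_finite_energy:
  fixes F :: "real set"
  assumes F: "compact F" "F \<subseteq> {0<..}" and U: "0 < U" and \<mu>: "\<mu> \<in> prob_measures_on F"
    and energy: "riesz_energy (q - 2) \<mu> < \<top>"
  obtains E where "0 \<le> E" "\<And>N e. 0 < N \<Longrightarrow> 0 < e \<Longrightarrow> e \<le> 1 \<Longrightarrow> U / real N \<le> e \<Longrightarrow>
    \<exists>n x p. increasing_grid n x \<and> x ` {1..n} \<subseteq> F \<and> (\<forall>i. 0 \<le> p i) \<and> (\<Sum>i\<in>{1..n}. p i) = 1 \<and>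
      (\<Sum>i\<in>{1..n}. \<Sum>j\<in>{1..n}. p i * p j * lattice_kernel q U N (\<bar>x i - x j\<bar> + e)) \<le> E"
proof -
  have prob: "prob_space \<mu>" and sets_\<mu>: "sets \<mu> = sets borel" and \<mu>_F: "emeasure \<mu> F = 1"
    using \<mu> by (auto simp: prob_measures_on_def)
  interpret \<mu>: prob_space \<mu> by (rule prob)
  have AE_F: "AE y in \<mu>. y \<in> F"
    using \<mu>_F borel_compact[OF F(1)] by (intro \<mu>.AE_prob_1) (simp add: measure_def)
  obtain a where a: "\<And>s. s \<in> F \<Longrightarrow> \<bar>s\<bar> \<le> a" using compact_imp_bounded[OF F(1)] unfolding bounded_iff by auto
  obtain C where C: "0 \<le> C" "\<And>N e u v y z. 0 < N \<Longrightarrow> 0 < e \<Longrightarrow> U / real N \<le> e \<Longrightarrow> \<bar>u - v\<bar> + e \<le> 2 * a + 1 \<Longrightarrow>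
    \<bar>u - y\<bar> \<le> e \<Longrightarrow> \<bar>v - z\<bar> \<le> e \<Longrightarrow> ennreal (lattice_kernel q U N (\<bar>u - v\<bar> + e)) \<le> ennreal C * (1 + riesz_kernel (q - 2) (y - z))"
    by (rule lattice_kernel_le_riesz_kernel[OF U]) (rule that)
  have "ennreal C * (1 + riesz_energy (q - 2) \<mu>) < \<top>"
    using energy by (simp add: ennreal_mult_less_top)
  then obtain E where E: "ennreal C * (1 + riesz_energy (q - 2) \<mu>) = ennreal E" "0 \<le> E"
    by (cases "ennreal C * (1 + riesz_energy (q - 2) \<mu>)") auto
  show ?thesis
  proof (rule that[OF E(2)])
    fix N :: nat and e :: real assume N: "0 < N" and e: "0 < e" "e \<le> 1" "U / real N \<le> e"
    obtain n x p \<pi> where x: "increasing_grid n x" "x ` {1..n} \<subseteq> F" and p: "\<And>i. 0 \<le> p i" "(\<Sum>i\<in>{1..n}. p i) = 1"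
      and \<pi>: "\<And>s. s \<in> F \<Longrightarrow> \<pi> s \<in> F \<and> \<bar>\<pi> s - s\<bar> \<le> e"
      and discrete: "\<And>f. \<forall>u v. 0 \<le> f u v \<Longrightarrow>
        ennreal (\<Sum>i\<in>{1..n}. \<Sum>j\<in>{1..n}. p i * p j * f (x i) (x j)) = (\<integral>\<^sup>+y. \<integral>\<^sup>+z. ennreal (f (\<pi> y) (\<pi> z)) \<partial>\<mu> \<partial>\<mu>)"
      by (rule exists_discretized_measure[OF F prob sets_\<mu> AE_F e(1)]) (rule that)
    have kernel_le: "ennreal (lattice_kernel q U N (\<bar>\<pi> y - \<pi> z\<bar> + e)) \<le> ennreal C * (1 + riesz_kernel (q - 2) (y - z))"
      if "y \<in> F" "z \<in> F" for y z
      using N e \<pi>[OF that(1)] \<pi>[OF that(2)] a[of "\<pi> y"] a[of "\<pi> z"] by (intro C(2)) auto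
    have "ennreal (\<Sum>i\<in>{1..n}. \<Sum>j\<in>{1..n}. p i * p j * lattice_kernel q U N (\<bar>x i - x j\<bar> + e))
        = (\<integral>\<^sup>+y. \<integral>\<^sup>+z. ennreal (lattice_kernel q U N (\<bar>\<pi> y - \<pi> z\<bar> + e)) \<partial>\<mu> \<partial>\<mu>)"
      by (rule discrete) (intro allI lattice_kernel_nonneg)
    also have "\<dots> \<le> (\<integral>\<^sup>+y. \<integral>\<^sup>+z. ennreal C * (1 + riesz_kernel (q - 2) (y - z)) \<partial>\<mu> \<partial>\<mu>)"
      by (intro nn_integral_mono_AE eventually_mono[OF AE_F] kernel_le)
    also have "\<dots> = ennreal E"
      unfolding nn_integral_affine_riesz_kernel[OF prob sets_\<mu>] E(1) ..
    finally have "(\<Sum>i\<in>{1..n}. \<Sum>j\<in>{1..n}. p i * p j * lattice_kernel q U N (\<bar>x i - x j\<bar> + e)) \<le> E"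
      using E(2) by (simp add: ennreal_le_iff)
    then show "\<exists>n x p. increasing_grid n x \<and> x ` {1..n} \<subseteq> F \<and> (\<forall>i. 0 \<le> p i) \<and> (\<Sum>i\<in>{1..n}. p i) = 1 \<and>
      (\<Sum>i\<in>{1..n}. \<Sum>j\<in>{1..n}. p i * p j * lattice_kernel q U N (\<bar>x i - x j\<bar> + e)) \<le> E"
      using x p by (intro exI conjI allI)
  qed
qed

lemma prob_near_event_ge:
  fixes B :: "real \<times> real \<Rightarrow> 'a \<Rightarrow> real ^ 'd"
  assumes B: "brownian_sheet M B" and F: "compact F" "F \<subseteq> {0<..}"
    and s: "0 < s0" "\<And>s. s \<in> F \<Longrightarrow> s0 \<le> s" "\<And>s. s \<in> F \<Longrightarrow> s \<le> s1"
    and bc: "b < c" and U: "0 < U" "2 * U \<le> b" and \<epsilon>: "0 < \<epsilon>" "\<epsilon> \<le> 1" and N: "0 < N"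
    and x: "increasing_grid n x" "x ` {1..n} \<subseteq> F" and p: "\<And>i. 0 \<le> p i" "(\<Sum>i\<in>{1..n}. p i) = 1"
    and energy: "(\<Sum>i\<in>{1..n}. \<Sum>j\<in>{1..n}. p i * p j * lattice_kernel (real CARD('d) / 2) U N (\<bar>x i - x j\<bar> + \<epsilon>\<^sup>2)) \<le> E"
  shows "0 < grid_noise.density_const (c - b) U s1"
    and "(grid_noise.density_const (c - b) U s1 ^ CARD('d))\<^sup>2
    \<le> measure M (near_event M B (window F (2 * U) b c) (2 * real CARD('d) * \<epsilon>))
      * (64 * grid_noise.pair_const (c - b) s0 ^ CARD('d) * E)"
proof -
  have n: "0 < n" using p(2) by (cases "n = 0") simp_all
  interpret sheet_grid n N x b c U s0 s1 \<epsilon> "TYPE('d)" M B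
    by (rule sheet_gridI[OF n N x s bc U \<epsilon>(1) B])
  show "0 < density_const" by (rule density_const_pos)
  have "grid_energy p \<le> E" using energy by (simp add: grid_energy_def grid_kernel_def)
  then show "(density_const ^ CARD('d))\<^sup>2
    \<le> measure M (near_event M B (window F (2 * U) b c) (2 * real CARD('d) * \<epsilon>)) * (64 * pair_const ^ CARD('d) * E)"
    using pair_const_pos
    by (intro order_trans[OF prob_near_window_ge[OF p \<epsilon>(2) F x(2)]] mult_left_mono) auto
qed

theorem prob_near_event_pos:
  fixes B :: "real \<times> real \<Rightarrow> 'a \<Rightarrow> real ^ 'd"
  assumes B: "brownian_sheet M B" and F: "compact F" "F \<subseteq> {0<..}"
    and bc: "b < c" and U: "0 < U" "2 * U \<le> b"
    and \<mu>: "\<mu> \<in> prob_measures_on F" and energy: "riesz_energy ((real CARD('d) - 4) / 2) \<mu> < \<top>"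
  shows "0 < measure M (near_event M B (window F (2 * U) b c) 0)"
proof -
  let ?T = "window F (2 * U) b c" and ?\<epsilon> = "\<lambda>m. 1 / real (Suc m)"
  let ?P = "\<lambda>m. measure M (near_event M B ?T (2 * real CARD('d) * ?\<epsilon> m))"
  have "F \<noteq> {}" using \<mu> by (auto simp: prob_measures_on_def)
  then obtain s0 s1 where s: "0 < s0" "\<And>s. s \<in> F \<Longrightarrow> s0 \<le> s" "\<And>s. s \<in> F \<Longrightarrow> s \<le> s1"
    using compact_positive_bounds[OF F] by blast
  have "riesz_energy (real CARD('d) / 2 - 2) \<mu> < \<top>" using energy by (simp add: diff_divide_distrib)
  then obtain E where E: "\<And>N e. 0 < N \<Longrightarrow> 0 < e \<Longrightarrow> e \<le> 1 \<Longrightarrow> U / real N \<le> e \<Longrightarrow>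
    \<exists>n x p. increasing_grid n x \<and> x ` {1..n} \<subseteq> F \<and> (\<forall>i. 0 \<le> p i) \<and> (\<Sum>i\<in>{1..n}. p i) = 1 \<and>
      (\<Sum>i\<in>{1..n}. \<Sum>j\<in>{1..n}. p i * p j * lattice_kernel (real CARD('d) / 2) U N (\<bar>x i - x j\<bar> + e)) \<le> E"
    by (rule exists_discrete_measure_of_finite_energy[OF F U(1) \<mu>]) (rule that)
  define \<delta> where "\<delta> = grid_noise.density_const (c - b) U s1"
  define Z where "Z = 64 * grid_noise.pair_const (c - b) s0 ^ CARD('d) * E"
  have bound: "0 < \<delta>" "(\<delta> ^ CARD('d))\<^sup>2 \<le> ?P m * Z" for m
  proof -
    have \<epsilon>: "0 < ?\<epsilon> m" "?\<epsilon> m \<le> 1" by auto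
    obtain N where "U / (?\<epsilon> m)\<^sup>2 < real N" using reals_Archimedean2 by blast
    then have N: "0 < N" "U / real N \<le> (?\<epsilon> m)\<^sup>2"
      using U(1) \<epsilon>(1) by (cases "N = 0"; simp add: pos_divide_less_eq pos_divide_le_eq mult.commute not_less)+
    then obtain n x p where x: "increasing_grid n x" "x ` {1..n} \<subseteq> F" and p: "\<And>i. 0 \<le> p i" "(\<Sum>i\<in>{1..n}. p i) = 1"
      and p_energy: "(\<Sum>i\<in>{1..n}. \<Sum>j\<in>{1..n}. p i * p j * lattice_kernel (real CARD('d) / 2) U N (\<bar>x i - x j\<bar> + (?\<epsilon> m)\<^sup>2)) \<le> E"
      using E[of N "(?\<epsilon> m)\<^sup>2"] by (auto simp: power_le_one)
    show "0 < \<delta>" "(\<delta> ^ CARD('d))\<^sup>2 \<le> ?P m * Z"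
      unfolding \<delta>_def Z_def using prob_near_event_ge[OF B F s bc U \<epsilon> N(1) x p p_energy] by simp_all
  qed
  have "0 < (\<delta> ^ CARD('d))\<^sup>2" using bound(1) by simp
  then have "0 < ?P 0 * Z" using bound(2)[of 0] by linarith
  then have Z: "0 < Z" by (simp add: zero_less_mult_iff measure_nonneg leD)
  have T: "compact ?T" "?T \<subseteq> octant"
    using F U bc by (auto intro!: compact_Times window_subset_octant)
  have "(\<delta> ^ CARD('d))\<^sup>2 / Z \<le> ?P m" for m
    using bound(2)[of m] Z by (simp add: pos_divide_le_eq)
  then have "(\<delta> ^ CARD('d))\<^sup>2 / Z \<le> measure M (near_event M B ?T 0)"
    by (rule prob_near_event_zero_ge[OF B T, rotated]) simp
  moreover have "0 < (\<delta> ^ CARD('d))\<^sup>2 / Z" using bound(1) Z by simp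
  ultimately show ?thesis by linarith
qed

subsection \<open>Double times and capacity\<close>

definition double_times_event :: "'a measure \<Rightarrow> (real \<times> real \<Rightarrow> 'a \<Rightarrow> real ^ 'd) \<Rightarrow> real set \<Rightarrow> 'a set" where
  "double_times_event M B F = {\<omega>\<in>space M. double_times B \<omega> \<inter> F \<noteq> {}}"

lemma near_event_subset_double_times_event:
  assumes "T \<subseteq> {(s, t1, t2). s \<in> F \<and> 0 < t1 \<and> t1 < t2}" "F \<subseteq> {0<..}"
  shows "near_event M B T 0 \<subseteq> double_times_event M B F"
proof
  fix \<omega> assume "\<omega> \<in> near_event M B T 0"
  then obtain s t1 t2 where "\<omega> \<in> space M" "(s, t1, t2) \<in> T" and return: "B (s, t1) \<omega> = B (s, t2) \<omega>"
    by (auto simp: near_event_def return_dist_def)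
  then have times: "s \<in> F" "0 < t1" "t1 < t2" "0 < s" using assms by auto
  then have "s \<in> double_times B \<omega>" using return by (auto simp: double_times_def)
  then show "\<omega> \<in> double_times_event M B F"
    using times(1) \<open>\<omega> \<in> space M\<close> by (auto simp: double_times_event_def)
qed

abbreviation rational_pairs :: "(real \<times> real) set" where
  "rational_pairs \<equiv> {(b, c)\<in>\<rat> \<times> \<rat>. 0 < b \<and> b < c}"

lemma countable_rational_pairs: "countable rational_pairs"
  by (rule countable_subset[of _ "\<rat> \<times> \<rat>"]) (auto intro: countable_rat)

lemma double_times_event_eq:
  assumes F: "F \<subseteq> {0<..}"
  shows "double_times_event M B F = (\<Union>(b, c)\<in>rational_pairs. near_event M B (window F (b / 4) b c) 0)"
proof (intro equalityI UN_least subsetI)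
  fix \<omega> assume "\<omega> \<in> double_times_event M B F"
  then obtain s t1 t2 where return: "\<omega> \<in> space M" "s \<in> F" "0 < t1" "t1 < t2" "B (s, t1) \<omega> = B (s, t2) \<omega>"
    by (auto simp: double_times_event_def double_times_def)
  then have "t1 < min (4 / 3 * t1) t2" by simp
  then obtain b where b: "b \<in> \<rat>" "t1 < b" "b < min (4 / 3 * t1) t2" using Rats_dense_in_real by blast
  have "max b (t2 - b / 4) < t2" using b return(3) by simp
  then obtain c where c: "c \<in> \<rat>" "max b (t2 - b / 4) < c" "c < t2" using Rats_dense_in_real by blast
  have "\<omega> \<in> near_event M B (window F (b / 4) b c) 0"
    unfolding near_event_def return_dist_def
    using return b c by (intro CollectI conjI bexI[of _ "(s, t1, t2)"]) auto
  then show "\<omega> \<in> (\<Union>(b, c)\<in>rational_pairs. near_event M B (window F (b / 4) b c) 0)"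
    using b c return(3) by (intro UN_I[of "(b, c)"]) auto
next
  fix p \<omega> assume "p \<in> rational_pairs" and "\<omega> \<in> (case p of (b, c) \<Rightarrow> near_event M B (window F (b / 4) b c) 0)"
  then show "\<omega> \<in> double_times_event M B F"
    using near_event_subset_double_times_event[OF _ F, of "window F (fst p / 4) (fst p) (snd p)" M B]
    by (force simp: subset_iff)
qed

lemma sets_near_rational_window:
  assumes "brownian_sheet M B" "compact F" "F \<subseteq> {0<..}" "p \<in> rational_pairs"
  shows "(case p of (b, c) \<Rightarrow> near_event M B (window F (b / 4) b c) 0) \<in> sets M"
  using assms by (auto intro!: sets_near_event compact_Times intro: less_imp_le)

lemma sets_double_times_event:
  assumes "brownian_sheet M B" "compact F" "F \<subseteq> {0<..}"
  shows "double_times_event M B F \<in> sets M"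
  unfolding double_times_event_eq[OF assms(3)]
  by (intro sets.countable_UN' countable_rational_pairs image_subsetI sets_near_rational_window[OF assms])

lemma exists_window_of_double_times_event:
  assumes B: "brownian_sheet M B" and F: "compact F" "F \<subseteq> {0<..}"
    and pos: "0 < emeasure M (double_times_event M B F)"
  obtains b c where "0 < b" "b < c" "0 < measure M (near_event M B (window F (b / 4) b c) 0)"
proof -
  interpret prob_space M using B by (simp add: brownian_sheet_def)
  let ?W = "\<lambda>(b, c). near_event M B (window F (b / 4) b c) 0"
  have "\<exists>p\<in>rational_pairs. emeasure M (?W p) \<noteq> 0"
  proof (rule ccontr)
    assume "\<not> ?thesis"
    then have "(\<Union>p\<in>rational_pairs. ?W p) \<in> null_sets M"
      by (intro null_sets_UN' countable_rational_pairs null_setsI sets_near_rational_window[OF B F]) auto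
    then show False using pos unfolding double_times_event_eq[OF F(2)] by (auto simp: null_sets_def)
  qed
  then show ?thesis
    using that by (auto simp: emeasure_eq_measure zero_less_measure_iff)
qed

lemma riesz_cap_pos_iff: "0 < riesz_cap \<beta> F \<longleftrightarrow> (\<exists>\<mu>\<in>prob_measures_on F. riesz_energy \<beta> \<mu> < \<top>)"
  unfolding riesz_cap_def by (simp add: zero_less_iff_neq_zero INF_less_iff flip: top.not_eq_extremum)

theorem theorem1p3:
  fixes M :: "'a measure"
    and B :: "real \<times> real \<Rightarrow> 'a \<Rightarrow> real ^ 'd"
    and F :: "real set"
  assumes "brownian_sheet M B"
    and "compact F" and "F \<subseteq> {0<..}"
  shows "emeasure M {\<omega> \<in> space M. double_times B \<omega> \<inter> F \<noteq> {}} > 0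
           \<longleftrightarrow> riesz_cap ((real CARD('d) - 4) / 2) F > 0"
  unfolding riesz_cap_pos_iff double_times_event_def[symmetric]
proof
  assume "0 < emeasure M (double_times_event M B F)"
  then obtain b c where bc: "0 < b" "b < c"
    and pos: "0 < measure M (near_event M B (window F (b / 4) b c) 0)"
    by (rule exists_window_of_double_times_event[OF assms])
  obtain \<nu> where "\<nu> \<in> prob_measures_on F" "riesz_energy ((real CARD('d) - 4) / 2) \<nu> < \<top>"
    by (rule finite_energy_of_near_event[OF assms bc(2) _ _ pos]) (use bc in auto)
  then show "\<exists>\<mu>\<in>prob_measures_on F. riesz_energy ((real CARD('d) - 4) / 2) \<mu> < \<top>" by blast
next
  interpret prob_space M using assms(1) by (simp add: brownian_sheet_def)
  assume "\<exists>\<mu>\<in>prob_measures_on F. riesz_energy ((real CARD('d) - 4) / 2) \<mu> < \<top>"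
  then have "0 < measure M (near_event M B (window F (2 * (1 / 4)) 1 2) 0)"
    by (elim bexE, intro prob_near_event_pos[OF assms]) auto
  also have "\<dots> \<le> measure M (double_times_event M B F)"
    using assms(3) by (intro finite_measure_mono near_event_subset_double_times_event sets_double_times_event assms) auto
  finally show "0 < emeasure M (double_times_event M B F)" by (simp add: emeasure_eq_measure)
qed

end
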